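(* Let $\Bbbk$ be a field. Let $Q$ and $Q'$ be two pointed affine semigroups of dimensions $r$ and $r'$, with $n$ and $n'$ canonical minimal generators, and let $\mathcal{B}=\mathcal{B}(\Bbbk[Q])$ and $\mathcal{B}'=\mathcal{B}(\Bbbk[Q'])$ be the Betti categories of the toric rings $\Bbbk[Q]$ and $\Bbbk[Q']$, respectively. Denote by $\varrho\colon\mathcal{B}\to\mathbb{N}^n\!\int\!\mathbb{Z}^r$ and $\varrho'\colon\mathcal{B}'\to\mathbb{N}^{n'}\!\int\!\mathbb{Z}^{r'}$ the inclusion functors into the corresponding action categories. Assume that there is an equivalence of categories $\alpha\colon\mathcal{B}\to\mathcal{B}'$, and let $P'_\bullet$ be a minimal free resolution of the toric ring $\Bbbk[Q']$ (as a module over $\mathbb{N}^{n'}\!\int\!\mathbb{Z}^{r'}$). Then the chain complex $\operatorname{ind}_{\varrho}\operatorname{res}_{\varrho'\circ\alpha}P'_\bullet$ is a minimal free resolution of the toric ring $\Bbbk[Q]$ (as a module over $\mathbb{N}^{n}\!\int\!\mathbb{Z}^{r}$).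
   Context: Modules over categories. For a small category $\mathcal{C}$, a $\Bbbk\mathcal{C}$-module is a functor $\mathcal{C}\to\Bbbk\text{-Mod}$; homomorphisms are natural transformations; exactness is objectwise. A $\Bbbk\mathcal{C}$-module is free if it is isomorphic to a direct sum of modules $\Bbbk[\operatorname{mor}_{\mathcal{C}}(c,-)]$, $c\in\operatorname{obj}\mathcal{C}$. For a functor $\alpha\colon\mathcal{C}\to\mathcal{D}$, $\operatorname{res}_\alpha L=L\circ\alpha$, and $\operatorname{ind}_\alpha$ is the left adjoint of $\operatorname{res}_\alpha$ (left Kan extension), applied degreewise to complexes. Affine semigroups. A finitely generated abelian semigroup (with identity) $Q$ is affine if it is isomorphic to a subsemigroup of $\mathbb{Z}^r$ for some positive integer $r$; the smallest such $r$ is its dimension. It is pointed if its only invertible element is the identity. A pointed affine semigroup $Q$ of dimension $r$ embeds in $\mathbb{N}^r$ and has a canonical (unique) minimal generating set $\{a_1,\dots,a_n\}$; one fixes such an embedding and regards the $a_i$ as nonzero elements of $\mathbb{N}^r$. Let $A\colon\mathbb{N}^n\to\mathbb{Z}^r$ be the monoid homomorphism with $e_i\mapsto a_i$. $R=\Bbbk[x_1,\dots,x_n]$ is $\mathbb{Z}^r$-graded by $\deg x_i=a_i$, and the toric ring $\Bbbk[Q]$ is a $\mathbb{Z}^r$-graded $R$-module via $x_i\mapsto t^{a_i}$. Action category. $\mathbb{N}^n\!\int\!\mathbb{Z}^r$ has object set $\mathbb{Z}^r$, morphisms $c\to d$ the $\lambda\in\mathbb{N}^n$ with $A\lambda=d-c$,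 and composition given by addition in $\mathbb{N}^n$. The functor $M\mapsto\bigoplus_{\gamma\in\mathbb{Z}^r}M(\gamma)$ is an equivalence between modules over $\mathbb{N}^n\!\int\!\mathbb{Z}^r$ and $\mathbb{Z}^r$-graded $R$-modules; via it $\Bbbk[Q]$ is viewed as a functor on $\mathbb{N}^n\!\int\!\mathbb{Z}^r$. Minimal resolutions and Betti category. An epimorphism $f\colon L\to M$ is superfluous if for every $g\colon K\to L$, $g$ is epic iff $fg$ is epic; a projective cover is a superfluous epimorphism from a projective; a projective resolution $P_\bullet\to M$ is minimal if $P_0\to M$ and all $P_i\to\ker(d_{i-1})$ are projective covers. Finitely generated modules over $\mathbb{N}^n\!\int\!\mathbb{Z}^r$ have minimal projective resolutions, and these are free. For a module $P$ over a small category and an object $c$, let $\mathfrak{S}P(c)$ be the quotient of $P(c)$ by the sum of the images of all $P(u)$ with $u\colon b\to c$ a non-isomorphism. $\mathcal{B}(\Bbbk[Q])$ is the full subcategory of $\mathbb{N}^n\!\int\!\mathbb{Z}^r$ whose objects are those $c$ with $\mathfrak{S}P_i(c)\ne0$ for some $i$, where $P_\bullet$ is the minimal free resolution of $\Bbbk[Q]$; i.e. the degrees of the basis elements of the minimal $\mathbb{Z}^r$-graded free resolution of $\Bbbk[Q]$ over $R$. *)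

theory Defs
  imports "HOL-Algebra.AbelCoset" "HOL-Algebra.Module"
begin

record ('o, 'm) cat =
  Obj :: "'o set"
  Arr :: "'m set"
  Dom :: "'m \<Rightarrow> 'o"
  Cod :: "'m \<Rightarrow> 'o"
  Ide :: "'o \<Rightarrow> 'm"
  Comp :: "'m \<Rightarrow> 'm \<Rightarrow> 'm"  \<comment> \<open>\<open>Comp C v u\<close> is \<open>v\<close> after \<open>u\<close>\<close>

definition Hom :: "('o, 'm) cat \<Rightarrow> 'o \<Rightarrow> 'o \<Rightarrow> 'm set" where
  "Hom C a b = {u \<in> Arr C. Dom C u = a \<and> Cod C u = b}"

locale category =
  fixes C :: "('o, 'm) cat"
  assumes Dom_closed: "u \<in> Arr C \<Longrightarrow> Dom C u \<in> Obj C"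
    and Cod_closed: "u \<in> Arr C \<Longrightarrow> Cod C u \<in> Obj C"
    and Ide_in_Hom: "c \<in> Obj C \<Longrightarrow> Ide C c \<in> Hom C c c"
    and Comp_in_Hom: "u \<in> Hom C a b \<Longrightarrow> v \<in> Hom C b c \<Longrightarrow> Comp C v u \<in> Hom C a c"
    and Comp_Ide: "u \<in> Hom C a b \<Longrightarrow> Comp C u (Ide C a) = u"
    and Ide_Comp: "u \<in> Hom C a b \<Longrightarrow> Comp C (Ide C b) u = u"
    and Comp_assoc: "u \<in> Hom C a b \<Longrightarrow> v \<in> Hom C b c \<Longrightarrow> w \<in> Hom C c d \<Longrightarrow>
      Comp C w (Comp C v u) = Comp C (Comp C w v) u"

definition cat_iso :: "('o, 'm) cat \<Rightarrow> 'm \<Rightarrow> bool" where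
  "cat_iso C u \<longleftrightarrow> u \<in> Arr C \<and>
     (\<exists>v \<in> Hom C (Cod C u) (Dom C u).
        Comp C v u = Ide C (Dom C u) \<and> Comp C u v = Ide C (Cod C u))"

definition full_subcat :: "('o, 'm) cat \<Rightarrow> 'o set \<Rightarrow> ('o, 'm) cat" where
  "full_subcat C S =
     C\<lparr>Obj := Obj C \<inter> S, Arr := {u \<in> Arr C. Dom C u \<in> S \<and> Cod C u \<in> S}\<rparr>"

record ('o, 'm, 'p, 'n) func =
  FObj :: "'o \<Rightarrow> 'p"
  FArr :: "'m \<Rightarrow> 'n"

definition is_func ::
  "('o, 'm) cat \<Rightarrow> ('p, 'n) cat \<Rightarrow> ('o, 'm, 'p, 'n) func \<Rightarrow> bool" where
  "is_func C D F \<longleftrightarrow>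
     (\<forall>c \<in> Obj C. FObj F c \<in> Obj D \<and> FArr F (Ide C c) = Ide D (FObj F c)) \<and>
     (\<forall>u \<in> Arr C. FArr F u \<in> Hom D (FObj F (Dom C u)) (FObj F (Cod C u))) \<and>
     (\<forall>u \<in> Arr C. \<forall>v \<in> Arr C. Dom C v = Cod C u \<longrightarrow>
        FArr F (Comp C v u) = Comp D (FArr F v) (FArr F u))"

definition func_id :: "('o, 'm, 'o, 'm) func" where
  "func_id = \<lparr>FObj = id, FArr = id\<rparr>"

definition func_comp ::
  "('p, 'n, 'q, 'l) func \<Rightarrow> ('o, 'm, 'p, 'n) func \<Rightarrow> ('o, 'm, 'q, 'l) func" where
  "func_comp G F = \<lparr>FObj = FObj G \<circ> FObj F, FArr = FArr G \<circ> FArr F\<rparr>"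

definition natural_iso ::
  "('o, 'm) cat \<Rightarrow> ('p, 'n) cat \<Rightarrow> ('o, 'm, 'p, 'n) func \<Rightarrow> ('o, 'm, 'p, 'n) func
     \<Rightarrow> ('o \<Rightarrow> 'n) \<Rightarrow> bool" where
  "natural_iso C D F G \<eta> \<longleftrightarrow>
     (\<forall>c \<in> Obj C. \<eta> c \<in> Hom D (FObj F c) (FObj G c) \<and> cat_iso D (\<eta> c)) \<and>
     (\<forall>u \<in> Arr C. Comp D (\<eta> (Cod C u)) (FArr F u) = Comp D (FArr G u) (\<eta> (Dom C u)))"

definition equivalence_of_cats ::
  "('o, 'm) cat \<Rightarrow> ('p, 'n) cat \<Rightarrow> ('o, 'm, 'p, 'n) func \<Rightarrow> bool" where
  "equivalence_of_cats C D F \<longleftrightarrow> is_func C D F \<and>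
     (\<exists>G \<eta> \<theta>. is_func D C G \<and>
        natural_iso C C (func_comp G F) func_id \<eta> \<and>
        natural_iso D D (func_comp F G) func_id \<theta>)"

text \<open>
  \<open>K\<close>-modules are records \<^typ>\<open>('k, 'v) module\<close> satisfying the library predicate
  \<^const>\<open>module\<close>; the inherited fields \<open>mult\<close> and \<open>one\<close> play no role.
\<close>

definition lin_map ::
  "('k, 'z) ring_scheme \<Rightarrow> ('k, 'v) module \<Rightarrow> ('k, 'w) module \<Rightarrow> ('v \<Rightarrow> 'w) \<Rightarrow> bool" where
  "lin_map K V W f \<longleftrightarrow> f \<in> carrier V \<rightarrow> carrier W \<and>
     (\<forall>x \<in> carrier V. \<forall>y \<in> carrier V. f (x \<oplus>\<^bsub>V\<^esub> y) = f x \<oplus>\<^bsub>W\<^esub> f y) \<and>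
     (\<forall>a \<in> carrier K. \<forall>x \<in> carrier V. f (a \<odot>\<^bsub>V\<^esub> x) = a \<odot>\<^bsub>W\<^esub> f x)"

definition submod_span ::
  "('k, 'z) ring_scheme \<Rightarrow> ('k, 'v) module \<Rightarrow> 'v set \<Rightarrow> 'v set" where
  "submod_span K V S = \<Inter>{H. submodule H K V \<and> S \<subseteq> H}"

definition quot_mod :: "('k, 'v) module \<Rightarrow> 'v set \<Rightarrow> ('k, 'v set) module" where
  "quot_mod V H = \<lparr>carrier = a_rcosets\<^bsub>V\<^esub> H, mult = undefined, one = undefined,
     zero = H, add = set_add V, smult = (\<lambda>a X. \<Union>x\<in>X. H +>\<^bsub>V\<^esub> (a \<odot>\<^bsub>V\<^esub> x))\<rparr>"

definition self_mod :: "('k, 'z) ring_scheme \<Rightarrow> ('k, 'k) module" where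
  "self_mod K = \<lparr>carrier = carrier K, mult = mult K, one = one K,
     zero = zero K, add = add K, smult = mult K\<rparr>"

text \<open>External direct sum of the modules \<open>V i\<close>, \<open>i \<in> I\<close>: finitely supported families,
  extensional outside \<open>I\<close>.\<close>

definition dsum_mod :: "'i set \<Rightarrow> ('i \<Rightarrow> ('k, 'v) module) \<Rightarrow> ('k, 'i \<Rightarrow> 'v) module" where
  "dsum_mod I V = \<lparr>
     carrier = {f \<in> (\<Pi>\<^sub>E i\<in>I. carrier (V i)). finite {i \<in> I. f i \<noteq> \<zero>\<^bsub>V i\<^esub>}},
     mult = undefined, one = undefined,
     zero = (\<lambda>i\<in>I. \<zero>\<^bsub>V i\<^esub>),
     add = (\<lambda>f g. \<lambda>i\<in>I. f i \<oplus>\<^bsub>V i\<^esub> g i),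
     smult = (\<lambda>a f. \<lambda>i\<in>I. a \<odot>\<^bsub>V i\<^esub> f i)\<rparr>"

definition dsum_single ::
  "'i set \<Rightarrow> ('i \<Rightarrow> ('k, 'v) module) \<Rightarrow> 'i \<Rightarrow> 'v \<Rightarrow> ('i \<Rightarrow> 'v)" where
  "dsum_single I V i x = (\<lambda>j\<in>I. if j = i then x else \<zero>\<^bsub>V j\<^esub>)"

text \<open>For \<open>h : I \<rightarrow> J\<close> with \<open>V (h i) = V i\<close>, the map of direct sums over \<open>I\<close> and \<open>J\<close> which
  sends the \<open>i\<close>-th summand identically onto the \<open>h i\<close>-th.  The sum is restricted to the support of
  \<open>f\<close> because \<^const>\<open>finsum\<close> over an infinite set is zero by convention.\<close>

definition dsum_push ::
  "'i set \<Rightarrow> 'j set \<Rightarrow> ('i \<Rightarrow> ('k, 'v) module) \<Rightarrow> ('j \<Rightarrow> ('k, 'v) module)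
     \<Rightarrow> ('i \<Rightarrow> 'j) \<Rightarrow> ('i \<Rightarrow> 'v) \<Rightarrow> ('j \<Rightarrow> 'v)" where
  "dsum_push I J V W h f =
     (\<lambda>j\<in>J. \<Oplus>\<^bsub>W j\<^esub> i \<in> {i \<in> I. h i = j \<and> f i \<noteq> \<zero>\<^bsub>V i\<^esub>}. f i)"

text \<open>The free module \<open>K[X]\<close> on a set \<open>X\<close>, and \<open>K[h] : K[X] \<rightarrow> K[Y]\<close> for \<open>h : X \<rightarrow> Y\<close>.\<close>

definition free_mod :: "('k, 'z) ring_scheme \<Rightarrow> 'x set \<Rightarrow> ('k, 'x \<Rightarrow> 'k) module" where
  "free_mod K X = dsum_mod X (\<lambda>_. self_mod K)"

definition free_map ::
  "('k, 'z) ring_scheme \<Rightarrow> 'x set \<Rightarrow> 'y set \<Rightarrow> ('x \<Rightarrow> 'y) \<Rightarrow> ('x \<Rightarrow> 'k) \<Rightarrow> ('y \<Rightarrow> 'k)" where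
  "free_map K X Y h = dsum_push X Y (\<lambda>_. self_mod K) (\<lambda>_. self_mod K) h"

record ('o, 'm, 'k, 'v) cmod =
  Val :: "'o \<Rightarrow> ('k, 'v) module"
  Act :: "'m \<Rightarrow> 'v \<Rightarrow> 'v"

definition is_cmod ::
  "('o, 'm) cat \<Rightarrow> ('k, 'z) ring_scheme \<Rightarrow> ('o, 'm, 'k, 'v) cmod \<Rightarrow> bool" where
  "is_cmod C K M \<longleftrightarrow>
     (\<forall>c \<in> Obj C. module K (Val M c)) \<and>
     (\<forall>u \<in> Arr C. lin_map K (Val M (Dom C u)) (Val M (Cod C u)) (Act M u)) \<and>
     (\<forall>c \<in> Obj C. \<forall>x \<in> carrier (Val M c). Act M (Ide C c) x = x) \<and>
     (\<forall>u \<in> Arr C. \<forall>v \<in> Arr C. Dom C v = Cod C u \<longrightarrow>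
        (\<forall>x \<in> carrier (Val M (Dom C u)). Act M (Comp C v u) x = Act M v (Act M u x)))"

definition cmod_hom ::
  "('o, 'm) cat \<Rightarrow> ('k, 'z) ring_scheme \<Rightarrow> ('o, 'm, 'k, 'v) cmod \<Rightarrow> ('o, 'm, 'k, 'w) cmod
     \<Rightarrow> ('o \<Rightarrow> 'v \<Rightarrow> 'w) \<Rightarrow> bool" where
  "cmod_hom C K M N f \<longleftrightarrow>
     (\<forall>c \<in> Obj C. lin_map K (Val M c) (Val N c) (f c)) \<and>
     (\<forall>u \<in> Arr C. \<forall>x \<in> carrier (Val M (Dom C u)).
        f (Cod C u) (Act M u x) = Act N u (f (Dom C u) x))"

definition cmod_iso ::
  "('o, 'm) cat \<Rightarrow> ('k, 'z) ring_scheme \<Rightarrow> ('o, 'm, 'k, 'v) cmod \<Rightarrow> ('o, 'm, 'k, 'w) cmod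
     \<Rightarrow> ('o \<Rightarrow> 'v \<Rightarrow> 'w) \<Rightarrow> bool" where
  "cmod_iso C K M N f \<longleftrightarrow> cmod_hom C K M N f \<and>
     (\<forall>c \<in> Obj C. bij_betw (f c) (carrier (Val M c)) (carrier (Val N c)))"

text \<open>Exactness, hence being epic, is objectwise.\<close>

definition cmod_epi ::
  "('o, 'm) cat \<Rightarrow> ('k, 'z) ring_scheme \<Rightarrow> ('o, 'm, 'k, 'v) cmod \<Rightarrow> ('o, 'm, 'k, 'w) cmod
     \<Rightarrow> ('o \<Rightarrow> 'v \<Rightarrow> 'w) \<Rightarrow> bool" where
  "cmod_epi C K M N f \<longleftrightarrow> cmod_hom C K M N f \<and>
     (\<forall>c \<in> Obj C. f c ` carrier (Val M c) = carrier (Val N c))"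

definition cmod_comp :: "('o \<Rightarrow> 'w \<Rightarrow> 'x) \<Rightarrow> ('o \<Rightarrow> 'v \<Rightarrow> 'w) \<Rightarrow> ('o \<Rightarrow> 'v \<Rightarrow> 'x)" where
  "cmod_comp g f = (\<lambda>c. g c \<circ> f c)"

definition ker_obj ::
  "('o, 'm, 'k, 'v) cmod \<Rightarrow> ('o, 'm, 'k, 'w) cmod \<Rightarrow> ('o \<Rightarrow> 'v \<Rightarrow> 'w) \<Rightarrow> 'o \<Rightarrow> 'v set" where
  "ker_obj M N f c = {x \<in> carrier (Val M c). f c x = \<zero>\<^bsub>Val N c\<^esub>}"

definition cmod_ker ::
  "('o, 'm, 'k, 'v) cmod \<Rightarrow> ('o, 'm, 'k, 'w) cmod \<Rightarrow> ('o \<Rightarrow> 'v \<Rightarrow> 'w)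
     \<Rightarrow> ('o, 'm, 'k, 'v) cmod" where
  "cmod_ker M N f =
     \<lparr>Val = (\<lambda>c. (Val M c)\<lparr>carrier := ker_obj M N f c\<rparr>), Act = Act M\<rparr>"

definition cmod_dsum ::
  "('o, 'm) cat \<Rightarrow> 'i set \<Rightarrow> ('i \<Rightarrow> ('o, 'm, 'k, 'v) cmod) \<Rightarrow> ('o, 'm, 'k, 'i \<Rightarrow> 'v) cmod" where
  "cmod_dsum C I M = \<lparr>Val = (\<lambda>c. dsum_mod I (\<lambda>i. Val (M i) c)),
     Act = (\<lambda>u f. \<lambda>i\<in>I. Act (M i) u (f i))\<rparr>"

definition rep_mod ::
  "('o, 'm) cat \<Rightarrow> ('k, 'z) ring_scheme \<Rightarrow> 'o \<Rightarrow> ('o, 'm, 'k, 'm \<Rightarrow> 'k) cmod" where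
  "rep_mod C K c = \<lparr>Val = (\<lambda>d. free_mod K (Hom C c d)),
     Act = (\<lambda>u. free_map K (Hom C c (Dom C u)) (Hom C c (Cod C u)) (\<lambda>v. Comp C u v))\<rparr>"

text \<open>The index set of the direct sum can be taken inside \<^typ>\<open>'o \<times> 'v\<close> without loss of generality:
  over a nontrivial \<open>K\<close>, a summand \<open>K[mor(c, -)]\<close> of \<open>P\<close> is determined by \<open>c\<close> and the element of
  \<open>P c\<close> corresponding to its generator, the identity of \<open>c\<close>.\<close>

definition free_cmod ::
  "('o, 'm) cat \<Rightarrow> ('k, 'z) ring_scheme \<Rightarrow> ('o, 'm, 'k, 'v) cmod \<Rightarrow> bool" where
  "free_cmod C K P \<longleftrightarrow> is_cmod C K P \<and>
     (\<exists>(I :: ('o \<times> 'v) set) b \<phi>. b ` I \<subseteq> Obj C \<and>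
        cmod_iso C K (cmod_dsum C I (\<lambda>i. rep_mod C K (b i))) P \<phi>)"

text \<open>The lifting property quantifies over modules with values in fixed types.  They are large
  enough: \<open>N\<close> may be \<open>P\<close> itself and \<open>M\<close> the sum of the \<open>K[mor(c, -)]\<close> over all \<open>c\<close> and all
  \<open>x \<in> P c\<close>, so that a \<open>P\<close> satisfying the condition is a retract of a free module.\<close>

definition projective_cmod ::
  "('o, 'm) cat \<Rightarrow> ('k, 'z) ring_scheme \<Rightarrow> ('o, 'm, 'k, 'v) cmod \<Rightarrow> bool" where
  "projective_cmod C K P \<longleftrightarrow> is_cmod C K P \<and>
     (\<forall>(M :: ('o, 'm, 'k, 'o \<times> 'v \<Rightarrow> 'm \<Rightarrow> 'k) cmod) (N :: ('o, 'm, 'k, 'v) cmod) e f.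
        is_cmod C K M \<and> is_cmod C K N \<and> cmod_epi C K M N e \<and> cmod_hom C K P N f \<longrightarrow>
        (\<exists>g. cmod_hom C K P M g \<and>
           (\<forall>c \<in> Obj C. \<forall>x \<in> carrier (Val P c). e c (g c x) = f c x)))"

text \<open>It suffices to test superfluity on modules \<open>L'\<close> with values in the same type as \<open>L\<close>, because
  an arbitrary \<open>g\<close> may be replaced by the inclusion of its image.\<close>

definition superfluous_epi ::
  "('o, 'm) cat \<Rightarrow> ('k, 'z) ring_scheme \<Rightarrow> ('o, 'm, 'k, 'v) cmod \<Rightarrow> ('o, 'm, 'k, 'w) cmod
     \<Rightarrow> ('o \<Rightarrow> 'v \<Rightarrow> 'w) \<Rightarrow> bool" where
  "superfluous_epi C K L M f \<longleftrightarrow> cmod_epi C K L M f \<and>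
     (\<forall>(L' :: ('o, 'm, 'k, 'v) cmod) g. is_cmod C K L' \<and> cmod_hom C K L' L g \<longrightarrow>
        (cmod_epi C K L' L g \<longleftrightarrow> cmod_epi C K L' M (cmod_comp f g)))"

definition projective_cover ::
  "('o, 'm) cat \<Rightarrow> ('k, 'z) ring_scheme \<Rightarrow> ('o, 'm, 'k, 'v) cmod \<Rightarrow> ('o, 'm, 'k, 'w) cmod
     \<Rightarrow> ('o \<Rightarrow> 'v \<Rightarrow> 'w) \<Rightarrow> bool" where
  "projective_cover C K P M f \<longleftrightarrow>
     projective_cmod C K P \<and> is_cmod C K M \<and> superfluous_epi C K P M f"

definition SP ::
  "('o, 'm) cat \<Rightarrow> ('k, 'z) ring_scheme \<Rightarrow> ('o, 'm, 'k, 'v) cmod \<Rightarrow> 'o \<Rightarrow> ('k, 'v set) module" where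
  "SP C K P c = quot_mod (Val P c) (submod_span K (Val P c)
     (\<Union>u \<in> {u \<in> Arr C. Cod C u = c \<and> \<not> cat_iso C u}. Act P u ` carrier (Val P (Dom C u))))"

text \<open>Nonnegatively graded sequences of modules and homomorphisms
  \<open>Diff X i : Term X (i + 1) \<rightarrow> Term X i\<close>.\<close>

record ('o, 'm, 'k, 'v) ccomplex =
  Term :: "nat \<Rightarrow> ('o, 'm, 'k, 'v) cmod"
  Diff :: "nat \<Rightarrow> 'o \<Rightarrow> 'v \<Rightarrow> 'v"

definition resolution ::
  "('o, 'm) cat \<Rightarrow> ('k, 'z) ring_scheme \<Rightarrow> ('o, 'm, 'k, 'v) ccomplex \<Rightarrow> ('o, 'm, 'k, 'w) cmod
     \<Rightarrow> ('o \<Rightarrow> 'v \<Rightarrow> 'w) \<Rightarrow> bool" where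
  "resolution C K X M \<epsilon> \<longleftrightarrow>
     is_cmod C K M \<and> (\<forall>i. is_cmod C K (Term X i)) \<and>
     (\<forall>i. cmod_hom C K (Term X (Suc i)) (Term X i) (Diff X i)) \<and>
     cmod_epi C K (Term X 0) M \<epsilon> \<and>
     (\<forall>c \<in> Obj C. ker_obj (Term X 0) M \<epsilon> c = Diff X 0 c ` carrier (Val (Term X 1) c)) \<and>
     (\<forall>i. \<forall>c \<in> Obj C. ker_obj (Term X (Suc i)) (Term X i) (Diff X i) c =
        Diff X (Suc i) c ` carrier (Val (Term X (Suc (Suc i))) c))"

definition minimal_resolution ::
  "('o, 'm) cat \<Rightarrow> ('k, 'z) ring_scheme \<Rightarrow> ('o, 'm, 'k, 'v) ccomplex \<Rightarrow> ('o, 'm, 'k, 'w) cmod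
     \<Rightarrow> ('o \<Rightarrow> 'v \<Rightarrow> 'w) \<Rightarrow> bool" where
  "minimal_resolution C K X M \<epsilon> \<longleftrightarrow> resolution C K X M \<epsilon> \<and>
     projective_cover C K (Term X 0) M \<epsilon> \<and>
     projective_cover C K (Term X 1) (cmod_ker (Term X 0) M \<epsilon>) (Diff X 0) \<and>
     (\<forall>i. projective_cover C K (Term X (Suc (Suc i)))
        (cmod_ker (Term X (Suc i)) (Term X i) (Diff X i)) (Diff X (Suc i)))"

definition minimal_free_resolution ::
  "('o, 'm) cat \<Rightarrow> ('k, 'z) ring_scheme \<Rightarrow> ('o, 'm, 'k, 'v) ccomplex \<Rightarrow> ('o, 'm, 'k, 'w) cmod
     \<Rightarrow> bool" where
  "minimal_free_resolution C K X M \<longleftrightarrow>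
     (\<forall>i. free_cmod C K (Term X i)) \<and> (\<exists>\<epsilon>. minimal_resolution C K X M \<epsilon>)"

text \<open>A minimal resolution is unique up to isomorphism, so the condition below does not depend on
  its choice.  The terms of the minimal free resolution of a finitely generated module over an action
  category are finitely generated free modules, and thus exist with values in finitely supported
  functions from \<open>{0..<p} \<times> mor\<close> to \<open>K\<close>; this motivates the value type.\<close>

definition betti_obj ::
  "('o, 'm) cat \<Rightarrow> ('k, 'z) ring_scheme \<Rightarrow> ('o, 'm, 'k, 'w) cmod \<Rightarrow> 'o set" where
  "betti_obj C K M = {c \<in> Obj C.
     \<exists>(X :: ('o, 'm, 'k, nat \<Rightarrow> 'm \<Rightarrow> 'k) ccomplex) i. minimal_free_resolution C K X M \<and>
       carrier (SP C K (Term X i) c) \<noteq> {\<zero>\<^bsub>SP C K (Term X i) c\<^esub>}}"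

definition betti_cat ::
  "('o, 'm) cat \<Rightarrow> ('k, 'z) ring_scheme \<Rightarrow> ('o, 'm, 'k, 'w) cmod \<Rightarrow> ('o, 'm) cat" where
  "betti_cat C K M = full_subcat C (betti_obj C K M)"

definition res_cmod ::
  "('o, 'm, 'p, 'n) func \<Rightarrow> ('p, 'n, 'k, 'v) cmod \<Rightarrow> ('o, 'm, 'k, 'v) cmod" where
  "res_cmod F L = \<lparr>Val = (\<lambda>c. Val L (FObj F c)), Act = (\<lambda>u. Act L (FArr F u))\<rparr>"

definition res_ccomplex ::
  "('o, 'm, 'p, 'n) func \<Rightarrow> ('p, 'n, 'k, 'v) ccomplex \<Rightarrow> ('o, 'm, 'k, 'v) ccomplex" where
  "res_ccomplex F X = \<lparr>Term = (\<lambda>i. res_cmod F (Term X i)),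
     Diff = (\<lambda>i c. Diff X i (FObj F c))\<rparr>"

text \<open>Pointwise left Kan extension along \<open>F : C \<rightarrow> D\<close>.  Its value at \<open>d\<close> is the colimit of
  \<open>N b\<close> over the comma category of all \<open>(b, u : F b \<rightarrow> d)\<close>, that is, the quotient of
  \<open>\<Oplus>\<^sub>(\<^sub>b\<^sub>,\<^sub>u\<^sub>) N b\<close> by the relations identifying \<open>x\<close> in the summand \<open>(b, u \<circ> F v)\<close> with \<open>N v x\<close> in the
  summand \<open>(b', u)\<close>, for \<open>v : b \<rightarrow> b'\<close>, \<open>u : F b' \<rightarrow> d\<close> and \<open>x \<in> N b\<close>.\<close>

definition comma_obj ::
  "('o, 'm) cat \<Rightarrow> ('p, 'n) cat \<Rightarrow> ('o, 'm, 'p, 'n) func \<Rightarrow> 'p \<Rightarrow> ('o \<times> 'n) set" where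
  "comma_obj C D F d = (SIGMA b : Obj C. Hom D (FObj F b) d)"

definition ind_sum ::
  "('o, 'm) cat \<Rightarrow> ('p, 'n) cat \<Rightarrow> ('o, 'm, 'p, 'n) func \<Rightarrow> ('o, 'm, 'k, 'v) cmod \<Rightarrow> 'p
     \<Rightarrow> ('k, 'o \<times> 'n \<Rightarrow> 'v) module" where
  "ind_sum C D F N d = dsum_mod (comma_obj C D F d) (\<lambda>(b, u). Val N b)"

definition ind_single ::
  "('o, 'm) cat \<Rightarrow> ('p, 'n) cat \<Rightarrow> ('o, 'm, 'p, 'n) func \<Rightarrow> ('o, 'm, 'k, 'v) cmod \<Rightarrow> 'p
     \<Rightarrow> 'o \<times> 'n \<Rightarrow> 'v \<Rightarrow> ('o \<times> 'n \<Rightarrow> 'v)" where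
  "ind_single C D F N d = dsum_single (comma_obj C D F d) (\<lambda>(b, u). Val N b)"

definition ind_rel ::
  "('o, 'm) cat \<Rightarrow> ('p, 'n) cat \<Rightarrow> ('k, 'z) ring_scheme \<Rightarrow> ('o, 'm, 'p, 'n) func
     \<Rightarrow> ('o, 'm, 'k, 'v) cmod \<Rightarrow> 'p \<Rightarrow> ('o \<times> 'n \<Rightarrow> 'v) set" where
  "ind_rel C D K F N d = submod_span K (ind_sum C D F N d)
     {ind_single C D F N d (Dom C v, Comp D u (FArr F v)) x
        \<ominus>\<^bsub>ind_sum C D F N d\<^esub> ind_single C D F N d (Cod C v, u) (Act N v x) | u v x.
        v \<in> Arr C \<and> u \<in> Hom D (FObj F (Cod C v)) d \<and> x \<in> carrier (Val N (Dom C v))}"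

definition ind_cmod ::
  "('o, 'm) cat \<Rightarrow> ('p, 'n) cat \<Rightarrow> ('k, 'z) ring_scheme \<Rightarrow> ('o, 'm, 'p, 'n) func
     \<Rightarrow> ('o, 'm, 'k, 'v) cmod \<Rightarrow> ('p, 'n, 'k, ('o \<times> 'n \<Rightarrow> 'v) set) cmod" where
  "ind_cmod C D K F N = \<lparr>
     Val = (\<lambda>d. quot_mod (ind_sum C D F N d) (ind_rel C D K F N d)),
     Act = (\<lambda>w X. \<Union>g\<in>X. ind_rel C D K F N (Cod D w) +>\<^bsub>ind_sum C D F N (Cod D w)\<^esub>
       dsum_push (comma_obj C D F (Dom D w)) (comma_obj C D F (Cod D w))
         (\<lambda>(b, u). Val N b) (\<lambda>(b, u). Val N b) (\<lambda>(b, u). (b, Comp D w u)) g)\<rparr>"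

definition ind_map ::
  "('o, 'm) cat \<Rightarrow> ('p, 'n) cat \<Rightarrow> ('k, 'z) ring_scheme \<Rightarrow> ('o, 'm, 'p, 'n) func
     \<Rightarrow> ('o, 'm, 'k, 'w) cmod \<Rightarrow> ('o \<Rightarrow> 'v \<Rightarrow> 'w)
     \<Rightarrow> 'p \<Rightarrow> ('o \<times> 'n \<Rightarrow> 'v) set \<Rightarrow> ('o \<times> 'n \<Rightarrow> 'w) set" where
  "ind_map C D K F N' f = (\<lambda>d X. \<Union>g\<in>X. ind_rel C D K F N' d +>\<^bsub>ind_sum C D F N' d\<^esub>
     (\<lambda>(b, u)\<in>comma_obj C D F d. f b (g (b, u))))"

definition ind_ccomplex ::
  "('o, 'm) cat \<Rightarrow> ('p, 'n) cat \<Rightarrow> ('k, 'z) ring_scheme \<Rightarrow> ('o, 'm, 'p, 'n) func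
     \<Rightarrow> ('o, 'm, 'k, 'v) ccomplex \<Rightarrow> ('p, 'n, 'k, ('o \<times> 'n \<Rightarrow> 'v) set) ccomplex" where
  "ind_ccomplex C D K F X = \<lparr>Term = (\<lambda>i. ind_cmod C D K F (Term X i)),
     Diff = (\<lambda>i. ind_map C D K F (Term X i) (Diff X i))\<rparr>"

text \<open>\<open>\<int>\<^sup>r\<close> consists of the functions \<^typ>\<open>nat \<Rightarrow> int\<close> vanishing outside \<open>{0..<r}\<close>, and
  \<open>\<nat>\<^sup>n\<close> is treated likewise; this allows \<open>r\<close> to vary, as the notion of dimension requires.\<close>

definition Zvec :: "nat \<Rightarrow> (nat \<Rightarrow> int) monoid" where
  "Zvec r = \<lparr>carrier = {v. \<forall>j\<ge>r. v j = 0}, mult = (\<lambda>v w j. v j + w j), one = (\<lambda>_. 0)\<rparr>"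

definition monoid_generates :: "('q, 'y) monoid_scheme \<Rightarrow> 'q set \<Rightarrow> bool" where
  "monoid_generates Q S \<longleftrightarrow> S \<subseteq> carrier Q \<and> (\<forall>H. submonoid H Q \<and> S \<subseteq> H \<longrightarrow> H = carrier Q)"

definition embeds_in_Zvec :: "('q, 'y) monoid_scheme \<Rightarrow> nat \<Rightarrow> bool" where
  "embeds_in_Zvec Q r \<longleftrightarrow> (\<exists>f \<in> hom Q (Zvec r). inj_on f (carrier Q))"

definition affine_semigroup :: "('q, 'y) monoid_scheme \<Rightarrow> bool" where
  "affine_semigroup Q \<longleftrightarrow> comm_monoid Q \<and> (\<exists>S. finite S \<and> monoid_generates Q S) \<and>
     (\<exists>r > 0. embeds_in_Zvec Q r)"

definition affine_dim :: "('q, 'y) monoid_scheme \<Rightarrow> nat" where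
  "affine_dim Q = (LEAST r. r > 0 \<and> embeds_in_Zvec Q r)"

definition pointed :: "('q, 'y) monoid_scheme \<Rightarrow> bool" where
  "pointed Q \<longleftrightarrow> Units Q = {\<one>\<^bsub>Q\<^esub>}"

definition minimal_generating_set :: "('q, 'y) monoid_scheme \<Rightarrow> 'q set \<Rightarrow> bool" where
  "minimal_generating_set Q S \<longleftrightarrow> monoid_generates Q S \<and> (\<forall>T. T \<subset> S \<longrightarrow> \<not> monoid_generates Q T)"

text \<open>\<open>Q\<close> is a pointed affine semigroup of dimension \<open>r\<close>; \<open>a 0, \<dots>, a (n - 1)\<close> are the distinct
  elements of its (unique) minimal generating set; \<open>emb\<close> is a fixed embedding into
  \<open>\<nat>\<^sup>r \<subseteq> \<int>\<^sup>r\<close>.\<close>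

definition pointed_affine_data ::
  "('q, 'y) monoid_scheme \<Rightarrow> nat \<Rightarrow> nat \<Rightarrow> (nat \<Rightarrow> 'q) \<Rightarrow> ('q \<Rightarrow> nat \<Rightarrow> int) \<Rightarrow> bool" where
  "pointed_affine_data Q r n a emb \<longleftrightarrow>
     affine_semigroup Q \<and> pointed Q \<and> affine_dim Q = r \<and>
     inj_on a {..<n} \<and> minimal_generating_set Q (a ` {..<n}) \<and>
     emb \<in> hom Q (Zvec r) \<and> inj_on emb (carrier Q) \<and> (\<forall>q \<in> carrier Q. \<forall>j. 0 \<le> emb q j)"

text \<open>The action category \<open>\<nat>\<^sup>n\<integral>\<int>\<^sup>r\<close> for the vectors \<open>g 0, \<dots>, g (n - 1)\<close> in \<open>\<int>\<^sup>r\<close>.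
  A morphism \<open>\<lambda> : c \<rightarrow> d\<close> is recorded as the triple \<open>(c, \<lambda>, d)\<close>.\<close>

type_synonym act_arr = "(nat \<Rightarrow> int) \<times> (nat \<Rightarrow> nat) \<times> (nat \<Rightarrow> int)"

definition act_cat :: "nat \<Rightarrow> nat \<Rightarrow> (nat \<Rightarrow> nat \<Rightarrow> int) \<Rightarrow> (nat \<Rightarrow> int, act_arr) cat" where
  "act_cat n r g = \<lparr>
     Obj = carrier (Zvec r),
     Arr = {(c, l, d). c \<in> carrier (Zvec r) \<and> d \<in> carrier (Zvec r) \<and> (\<forall>i\<ge>n. l i = 0) \<and>
              (\<forall>j. (\<Sum>i<n. int (l i) * g i j) = d j - c j)},
     Dom = (\<lambda>(c, l, d). c),
     Cod = (\<lambda>(c, l, d). d),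
     Ide = (\<lambda>c. (c, \<lambda>_. 0, c)),
     Comp = (\<lambda>(c', l', d') (c, l, d). (c, \<lambda>i. l i + l' i, d'))\<rparr>"

lemma in_Hom_act_cat: "u \<in> Hom (act_cat n r g) c d \<longleftrightarrow> (\<exists>l. u = (c,l,d) \<and> c \<in> carrier (Zvec r) \<and> d \<in> carrier (Zvec r) \<and> (\<forall>i\<ge>n. l i = 0) \<and>
              (\<forall>j. (\<Sum>i<n. int (l i) * g i j) = d j - c j))"
  by (auto simp: act_cat_def Hom_def)

lemma category_act_cat: "category (act_cat n r g)"
proof
  fix u a b v c assume "u \<in> Hom (act_cat n r g) a b" "v \<in> Hom (act_cat n r g) b c"
  then obtain l m where *: "u = (a,l,b)" "v = (b,m,c)" "a \<in> carrier (Zvec r)" "c \<in> carrier (Zvec r)"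
    "\<forall>i\<ge>n. l i = 0" "\<forall>i\<ge>n. m i = 0"
    and **: "\<And>j. (\<Sum>i<n. int (l i) * g i j) = b j - a j" "\<And>j. (\<Sum>i<n. int (m i) * g i j) = c j - b j"
    unfolding in_Hom_act_cat by auto
  have "(\<Sum>i<n. int (l i + m i) * g i j) = c j - a j" for j
    using **[of j] by (simp add: sum.distrib distrib_right)
  then show "Comp (act_cat n r g) v u \<in> Hom (act_cat n r g) a c"
    unfolding in_Hom_act_cat using * by (simp add: act_cat_def)
qed (auto simp: in_Hom_act_cat, auto simp: act_cat_def)

text \<open>The toric ring \<open>K[Q]\<close> as a module over the action category.  Its value at \<open>\<gamma>\<close> is the graded
  component \<open>K[Q]\<^sub>\<gamma>\<close>, spanned by those \<open>t\<^sup>q\<close> with \<open>emb q = \<gamma>\<close>; since \<open>x\<^sub>i\<close> acts as \<open>t\<close> to the power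
  \<open>a i\<close>, the morphism \<open>\<lambda>\<close> sends \<open>t\<^sup>q\<close> to \<open>t\<close> to the power \<open>q + \<lambda>\<^sub>0 a\<^sub>0 + \<dots>\<close>.  The operation of \<open>Q\<close>
  is written multiplicatively.\<close>

definition toric_cmod ::
  "('k, 'z) ring_scheme \<Rightarrow> ('q, 'y) monoid_scheme \<Rightarrow> nat \<Rightarrow> (nat \<Rightarrow> 'q) \<Rightarrow> ('q \<Rightarrow> nat \<Rightarrow> int)
     \<Rightarrow> (nat \<Rightarrow> int, act_arr, 'k, 'q \<Rightarrow> 'k) cmod" where
  "toric_cmod K Q n a emb = \<lparr>
     Val = (\<lambda>\<gamma>. free_mod K {q \<in> carrier Q. emb q = \<gamma>}),
     Act = (\<lambda>(c, l, d). free_map K {q \<in> carrier Q. emb q = c} {q \<in> carrier Q. emb q = d}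
       (\<lambda>q. q \<otimes>\<^bsub>Q\<^esub> (\<Otimes>\<^bsub>Q\<^esub>i\<in>{..<n}. a i [^]\<^bsub>Q\<^esub> l i)))\<rparr>"

definition toric_betti_cat ::
  "('k, 'z) ring_scheme \<Rightarrow> ('q, 'y) monoid_scheme \<Rightarrow> nat \<Rightarrow> nat \<Rightarrow> (nat \<Rightarrow> 'q)
     \<Rightarrow> ('q \<Rightarrow> nat \<Rightarrow> int) \<Rightarrow> (nat \<Rightarrow> int, act_arr) cat" where
  "toric_betti_cat K Q r n a emb =
     betti_cat (act_cat n r (emb \<circ> a)) K (toric_cmod K Q n a emb)"

end

theory Submission
  imports Defs "HOL-Library.Countable_Set"
begin

text \<open>
  Both resolutions restrict to minimal free resolutions over the Betti category \<open>\<B>\<close> of \<open>K[Q]\<close>,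
  where the modules that they resolve become isomorphic; the restrictions are then isomorphic by
  uniqueness, and induction recovers a free module from its restriction.

  In an action category of a pointed affine semigroup the only endomorphisms and isomorphisms are
  identities, and the other morphisms between degrees in the image of \<open>Q\<close> raise the coordinate sum
  (\<open>graded_category\<close>).  In this situation minimality can be read off from coordinates: an
  epimorphism from a free module with generators in such degrees is superfluous if and only if the
  elements of its kernel in degree \<open>c\<close> have coordinate zero at every generator of degree \<open>c\<close>
  (\<open>superfluous_imp_coord_zero\<close> and \<open>coord_zero_imp_superfluous\<close>, a form of Nakayama's lemma).  The
  criterion looks only at the degrees of the generators, so it survives restriction along a fully
  faithful functor that reaches all of them (\<open>free_cover_res\<close>).

  By definition and by uniqueness of minimal resolutions (\<open>cover_chain_unique\<close>), the generators of
  every minimal free resolution have Betti degrees (\<open>gens_in_betti_obj\<close>).  Isomorphisms in Betti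
  categories being identities, the equivalence \<open>\<alpha>\<close> is an isomorphism of categories
  (\<open>equivalence_imp_iso\<close>).  Hence any minimal free resolution \<open>X\<close> of \<open>K[Q]\<close> restricts along \<open>\<rho>\<close>, and
  \<open>P'\<close> along \<open>\<rho>' \<circ> \<alpha>\<close>, to a minimal free resolution over \<open>\<B>\<close>.  They resolve isomorphic modules: Betti
  degrees lie in the image of the semigroup, and there a toric ring is the constant functor \<open>K\<close>
  (\<open>toric_res_iso\<close>).  So the two restrictions are isomorphic complexes.

  Inducing the restriction of a free module with generators in \<open>\<B>\<close> gives back that module
  (\<open>ind_iso\<close>), whence the induced complex of the theorem is isomorphic to \<open>X\<close>
  (\<open>cover_chain_ind\<close>).  Induction is not an exact functor; exactness of the induced complex comes from
  this comparison with \<open>X\<close>.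

  The resolution \<open>X\<close> exists (\<open>cover_chain_exists\<close>) because every degree receives only finitely many
  morphisms from the image of \<open>Q\<close>.  All modules in its construction therefore have finite-dimensional
  components, and minimal generators can be chosen one degree at a time.
\<close>

section \<open>Linear maps and submodules\<close>

lemma lin_mapI:
  assumes "\<And>x. x \<in> carrier V \<Longrightarrow> f x \<in> carrier W"
    and "\<And>x y. x \<in> carrier V \<Longrightarrow> y \<in> carrier V \<Longrightarrow> f (x \<oplus>\<^bsub>V\<^esub> y) = f x \<oplus>\<^bsub>W\<^esub> f y"
    and "\<And>a x. a \<in> carrier K \<Longrightarrow> x \<in> carrier V \<Longrightarrow> f (a \<odot>\<^bsub>V\<^esub> x) = a \<odot>\<^bsub>W\<^esub> f x"
  shows "lin_map K V W f"
  using assms by (auto simp: lin_map_def)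

lemma lin_map_closed: "lin_map K V W f \<Longrightarrow> x \<in> carrier V \<Longrightarrow> f x \<in> carrier W"
  and lin_map_add: "lin_map K V W f \<Longrightarrow> x \<in> carrier V \<Longrightarrow> y \<in> carrier V \<Longrightarrow>
    f (x \<oplus>\<^bsub>V\<^esub> y) = f x \<oplus>\<^bsub>W\<^esub> f y"
  and lin_map_smult: "lin_map K V W f \<Longrightarrow> a \<in> carrier K \<Longrightarrow> x \<in> carrier V \<Longrightarrow>
    f (a \<odot>\<^bsub>V\<^esub> x) = a \<odot>\<^bsub>W\<^esub> f x"
  by (auto simp: lin_map_def)

lemma lin_map_zero:
  assumes "module K V" "module K W" "lin_map K V W f"
  shows "f \<zero>\<^bsub>V\<^esub> = \<zero>\<^bsub>W\<^esub>"
proof -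
  interpret V: module K V by fact
  interpret W: module K W by fact
  have "f \<zero>\<^bsub>V\<^esub> = f (\<zero>\<^bsub>K\<^esub> \<odot>\<^bsub>V\<^esub> \<zero>\<^bsub>V\<^esub>)" by simp
  also have "\<dots> = \<zero>\<^bsub>K\<^esub> \<odot>\<^bsub>W\<^esub> f \<zero>\<^bsub>V\<^esub>" using assms(3) by (intro lin_map_smult) auto
  also have "\<dots> = \<zero>\<^bsub>W\<^esub>" using lin_map_closed[OF assms(3)] by simp
  finally show ?thesis .
qed

lemma module_neg:
  assumes "module K V" "x \<in> carrier V"
  shows "\<ominus>\<^bsub>V\<^esub> x = (\<ominus>\<^bsub>K\<^esub> \<one>\<^bsub>K\<^esub>) \<odot>\<^bsub>V\<^esub> x"
proof -
  interpret V: module K V by fact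
  show ?thesis using assms(2) by (simp add: V.smult_l_minus)
qed

lemma lin_map_minus:
  assumes "module K V" "module K W" "lin_map K V W f" "x \<in> carrier V" "y \<in> carrier V"
  shows "f (x \<ominus>\<^bsub>V\<^esub> y) = f x \<ominus>\<^bsub>W\<^esub> f y"
proof -
  interpret V: module K V by fact
  interpret W: module K W by fact
  have 1: "f y \<in> carrier W" using assms lin_map_closed by metis
  show ?thesis
    using assms(4,5) 1
    by (simp add: a_minus_def module_neg[OF assms(1)] module_neg[OF assms(2)]
        lin_map_add[OF assms(3)] lin_map_smult[OF assms(3)])
qed

lemma lin_map_comp: "lin_map K V W f \<Longrightarrow> lin_map K W U g \<Longrightarrow> lin_map K V U (\<lambda>x. g (f x))"
  by (auto simp: lin_map_def Pi_iff)

lemma lin_map_id: "lin_map K V V (\<lambda>x. x)"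
  by (auto simp: lin_map_def)

lemma lin_map_inv:
  assumes "module K V" "lin_map K V W f" "bij_betw f (carrier V) (carrier W)"
  shows "lin_map K W V (inv_into (carrier V) f)"
proof -
  interpret V: module K V by fact
  let ?g = "inv_into (carrier V) f"
  have g: "?g y \<in> carrier V" "f (?g y) = y" if "y \<in> carrier W" for y
    using that assms(3) by (auto simp: bij_betw_def inv_into_into f_inv_into_f)
  have gf: "?g (f x) = x" if "x \<in> carrier V" for x
    using that assms(3) by (auto simp: bij_betw_def)
  show ?thesis
  proof (rule lin_mapI)
    fix x y assume xy: "x \<in> carrier W" "y \<in> carrier W"
    have "?g (x \<oplus>\<^bsub>W\<^esub> y) = ?g (f (?g x \<oplus>\<^bsub>V\<^esub> ?g y))"
      using g xy by (simp add: lin_map_add[OF assms(2)])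
    then show "?g (x \<oplus>\<^bsub>W\<^esub> y) = ?g x \<oplus>\<^bsub>V\<^esub> ?g y" using gf g xy by simp
  next
    fix a x assume xy: "a \<in> carrier K" "x \<in> carrier W"
    have "?g (a \<odot>\<^bsub>W\<^esub> x) = ?g (f (a \<odot>\<^bsub>V\<^esub> ?g x))"
      using g xy by (simp add: lin_map_smult[OF assms(2)])
    then show "?g (a \<odot>\<^bsub>W\<^esub> x) = a \<odot>\<^bsub>V\<^esub> ?g x" using gf g xy by simp
  qed (use g in auto)
qed

lemma submoduleI':
  assumes "module K V" "H \<subseteq> carrier V" "\<zero>\<^bsub>V\<^esub> \<in> H"
    and "\<And>x y. x \<in> H \<Longrightarrow> y \<in> H \<Longrightarrow> x \<oplus>\<^bsub>V\<^esub> y \<in> H"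
    and "\<And>a x. a \<in> carrier K \<Longrightarrow> x \<in> H \<Longrightarrow> a \<odot>\<^bsub>V\<^esub> x \<in> H"
  shows "submodule H K V"
proof -
  interpret V: module K V by fact
  show ?thesis
  proof (rule V.submoduleI)
    fix x assume "x \<in> H"
    then show "\<ominus>\<^bsub>V\<^esub> x \<in> H"
      using assms(2,5) by (subst module_neg[OF assms(1)]) auto
  qed (use assms in auto)
qed

lemma submoduleD:
  assumes "submodule H K V"
  shows submodule_subset: "H \<subseteq> carrier V"
    and submodule_zero: "\<zero>\<^bsub>V\<^esub> \<in> H"
    and submodule_add: "\<And>x y. x \<in> H \<Longrightarrow> y \<in> H \<Longrightarrow> x \<oplus>\<^bsub>V\<^esub> y \<in> H"
    and submodule_smult: "\<And>a x. a \<in> carrier K \<Longrightarrow> x \<in> H \<Longrightarrow> a \<odot>\<^bsub>V\<^esub> x \<in> H"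
  using subgroup.subset[OF submodule.axioms(1)[OF assms]]
    subgroup.one_closed[OF submodule.axioms(1)[OF assms]]
    subgroup.m_closed[OF submodule.axioms(1)[OF assms]]
    submodule.smult_closed[OF assms] by auto

lemma submodule_minus:
  assumes "module K V" "submodule H K V" "x \<in> H" "y \<in> H"
  shows "x \<ominus>\<^bsub>V\<^esub> y \<in> H"
proof -
  interpret V: module K V by fact
  have "y \<in> carrier V" using assms submodule_subset by blast
  then show ?thesis using assms
    by (auto simp: a_minus_def module_neg[OF assms(1)] intro!: submodule_add submodule_smult)
qed

lemma submodule_carrier: "module K V \<Longrightarrow> submodule (carrier V) K V"
  by (rule module.carrier_is_submodule)

lemma submodule_zero_set:
  assumes "module K V" shows "submodule {\<zero>\<^bsub>V\<^esub>} K V"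
proof -
  interpret V: module K V by fact
  show ?thesis by (rule submoduleI'[OF assms]) auto
qed

lemma submodule_Int:
  "module K V \<Longrightarrow> submodule H K V \<Longrightarrow> submodule H' K V \<Longrightarrow> submodule (H \<inter> H') K V"
  by (rule submoduleI') (auto dest: submoduleD)

lemma submodule_vimage:
  assumes "module K V" "module K W" "lin_map K V W f" "submodule H K W"
  shows "submodule {x \<in> carrier V. f x \<in> H} K V"
proof -
  interpret V: module K V by fact
  show ?thesis
    using lin_map_zero[OF assms(1-3)] submodule_zero[OF assms(4)]
    by (intro submoduleI'[OF assms(1)])
      (auto simp: lin_map_add[OF assms(3)] lin_map_smult[OF assms(3)] submodule_add[OF assms(4)]
        submodule_smult[OF assms(4)])
qed

lemma submodule_kernel:
  assumes "module K V" "module K W" "lin_map K V W f"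
  shows "submodule {x \<in> carrier V. f x = \<zero>\<^bsub>W\<^esub>} K V"
  using submodule_vimage[OF assms submodule_zero_set[OF assms(2)]] by simp

lemma submodule_equalizer:
  assumes "module K V" "module K W" "lin_map K V W f" "lin_map K V W g"
  shows "submodule {x \<in> carrier V. f x = g x} K V"
proof -
  interpret V: module K V by fact
  show ?thesis
    using lin_map_zero[OF assms(1-3)] lin_map_zero[OF assms(1,2,4)]
    by (intro submoduleI'[OF assms(1)])
      (auto simp: lin_map_add[OF assms(3)] lin_map_smult[OF assms(3)]
        lin_map_add[OF assms(4)] lin_map_smult[OF assms(4)])
qed

lemma submodule_image:
  assumes "module K V" "module K W" "lin_map K V W f" "submodule H K V"
  shows "submodule (f ` H) K W"
proof -
  note H = submoduleD[OF assms(4)]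
  have f0: "f \<zero>\<^bsub>V\<^esub> = \<zero>\<^bsub>W\<^esub>" using lin_map_zero[OF assms(1-3)] .
  show ?thesis
  proof (rule submoduleI'[OF assms(2)])
    show "f ` H \<subseteq> carrier W" using H(1) lin_map_closed[OF assms(3)] by auto
    show "\<zero>\<^bsub>W\<^esub> \<in> f ` H" using f0 H(2) by force
    show "x \<oplus>\<^bsub>W\<^esub> y \<in> f ` H" if xy: "x \<in> f ` H" "y \<in> f ` H" for x y
    proof -
      obtain x' y' where "x = f x'" "y = f y'" "x' \<in> H" "y' \<in> H" using xy by blast
      moreover from this have "f (x' \<oplus>\<^bsub>V\<^esub> y') = x \<oplus>\<^bsub>W\<^esub> y"
        using lin_map_add[OF assms(3)] H(1) by auto
      ultimately show ?thesis using H(3) by (metis imageI)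
    qed
    show "a \<odot>\<^bsub>W\<^esub> x \<in> f ` H" if ax: "a \<in> carrier K" "x \<in> f ` H" for a x
    proof -
      obtain x' where "x = f x'" "x' \<in> H" using ax by blast
      moreover from this have "f (a \<odot>\<^bsub>V\<^esub> x') = a \<odot>\<^bsub>W\<^esub> x"
        using lin_map_smult[OF assms(3)] H(1) ax by auto
      ultimately show ?thesis using H(4) ax by (metis imageI)
    qed
  qed
qed

lemma span_mono: "S \<subseteq> T \<Longrightarrow> submod_span K V S \<subseteq> submod_span K V T"
  by (auto simp: submod_span_def)

lemma span_superset: "S \<subseteq> submod_span K V S"
  by (auto simp: submod_span_def)

lemma span_minimal: "submodule H K V \<Longrightarrow> S \<subseteq> H \<Longrightarrow> submod_span K V S \<subseteq> H"
  by (auto simp: submod_span_def)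

lemma submodule_span:
  assumes "module K V" "S \<subseteq> carrier V"
  shows "submodule (submod_span K V S) K V"
proof -
  have "submod_span K V S \<subseteq> carrier V"
    by (rule span_minimal[OF submodule_carrier[OF assms(1)] assms(2)])
  then show ?thesis
    by (intro submoduleI'[OF assms(1)]) (auto simp: submod_span_def dest: submoduleD)
qed

lemma span_memI:
  "submod_span K V S = carrier V \<Longrightarrow> submodule H K V \<Longrightarrow> S \<subseteq> H \<Longrightarrow> x \<in> carrier V \<Longrightarrow> x \<in> H"
  using span_minimal by blast

lemma lin_map_ext:
  assumes "module K V" "module K W" "lin_map K V W f" "lin_map K V W g"
    and "S \<subseteq> carrier V" "submod_span K V S = carrier V" "\<And>x. x \<in> S \<Longrightarrow> f x = g x"
    and "x \<in> carrier V"
  shows "f x = g x"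
  using span_memI[OF assms(6) submodule_equalizer[OF assms(1-4)] _ assms(8)] assms(5,7) by auto

lemma span_image_subset:
  assumes "module K V" "module K W" "lin_map K V W f" "submodule H K W"
    and "S \<subseteq> carrier V" "\<And>x. x \<in> S \<Longrightarrow> f x \<in> H" "x \<in> submod_span K V S"
  shows "f x \<in> H"
  using span_minimal[OF submodule_vimage[OF assms(1-4)], of S] assms(5-7) by auto

lemma module_submodule: "module K V \<Longrightarrow> submodule H K V \<Longrightarrow> module K (V\<lparr>carrier := H\<rparr>)"
  by (rule submodule.submodule_is_module)

lemma submodule_of_submodule:
  assumes "module K V" "submodule H K V" "H' \<subseteq> H"
  shows "submodule H' K (V\<lparr>carrier := H\<rparr>) \<longleftrightarrow> submodule H' K V"
proof
  assume "submodule H' K (V\<lparr>carrier := H\<rparr>)"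
  from submoduleD[OF this] show "submodule H' K V"
    using submodule_subset[OF assms(2)] by (intro submoduleI'[OF assms(1)]) auto
next
  assume "submodule H' K V"
  from submoduleD[OF this] show "submodule H' K (V\<lparr>carrier := H\<rparr>)"
    using assms(3) by (intro submoduleI'[OF module_submodule[OF assms(1,2)]]) auto
qed

lemma finsum_in_submodule:
  assumes "module K V" "submodule H K V" "\<And>j. j \<in> A \<Longrightarrow> f j \<in> H"
  shows "finsum V f A \<in> H"
proof -
  interpret V: module K V by fact
  note H = submoduleD[OF assms(2)]
  show ?thesis
  proof (cases "finite A")
    case True
    then show ?thesis using assms(3)
    proof (induction A)
      case empty
      then show ?case using H by simp
    next
      case (insert x A)
      then have "f \<in> A \<rightarrow> carrier V" "f x \<in> carrier V" using H(1) by auto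
      then show ?case using insert H by (simp add: V.finsum_insert)
    qed
  next
    case False
    then show ?thesis using H by (simp add: V.add.finprod_infinite)
  qed
qed

text \<open>All maps built from finitely supported families (\<^const>\<open>dsum_push\<close>, maps out of a direct sum,
  maps defined on a basis) are sums of this shape.  Restricting each sum to the support of the
  argument makes it finite, and two arguments are compared over the union of their supports.\<close>

lemma lin_map_family:
  assumes V: "module K V" and W: "module K W" and t: "\<And>j. j \<in> J \<Longrightarrow> lin_map K V W (t j)"
    and fin: "\<And>x. x \<in> carrier V \<Longrightarrow> finite {j \<in> J. t j x \<noteq> \<zero>\<^bsub>W\<^esub>}"
  shows "lin_map K V W (\<lambda>x. \<Oplus>\<^bsub>W\<^esub>j\<in>{j \<in> J. t j x \<noteq> \<zero>\<^bsub>W\<^esub>}. t j x)"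
proof -
  interpret V: module K V by fact
  interpret W: module K W by fact
  let ?s = "\<lambda>x. {j \<in> J. t j x \<noteq> \<zero>\<^bsub>W\<^esub>}"
  let ?F = "\<lambda>x. \<Oplus>\<^bsub>W\<^esub>j\<in>?s x. t j x"
  have tc: "t j x \<in> carrier W" if "j \<in> J" "x \<in> carrier V" for j x
    using lin_map_closed[OF t] that by blast
  have big: "?F x = (\<Oplus>\<^bsub>W\<^esub>j\<in>A. t j x)" if "finite A" "A \<subseteq> J" "?s x \<subseteq> A" "x \<in> carrier V" for A x
    using that tc by (intro W.add.finprod_mono_neutral_cong_left) auto
  show ?thesis
  proof (rule lin_mapI)
    fix x assume "x \<in> carrier V" then show "?F x \<in> carrier W"
      using tc by (intro W.finsum_closed) auto
  next
    fix x y assume xy: "x \<in> carrier V" "y \<in> carrier V"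
    let ?A = "?s x \<union> ?s y"
    have A: "finite ?A" "?A \<subseteq> J" using fin xy by auto
    have "?s (x \<oplus>\<^bsub>V\<^esub> y) \<subseteq> ?A" using lin_map_add[OF t] xy tc by auto
    then have "?F (x \<oplus>\<^bsub>V\<^esub> y) = (\<Oplus>\<^bsub>W\<^esub>j\<in>?A. t j (x \<oplus>\<^bsub>V\<^esub> y))" using A xy by (intro big) auto
    also have "\<dots> = (\<Oplus>\<^bsub>W\<^esub>j\<in>?A. t j x \<oplus>\<^bsub>W\<^esub> t j y)"
      using lin_map_add[OF t] xy tc by (intro W.finsum_cong') auto
    also have "\<dots> = (\<Oplus>\<^bsub>W\<^esub>j\<in>?A. t j x) \<oplus>\<^bsub>W\<^esub> (\<Oplus>\<^bsub>W\<^esub>j\<in>?A. t j y)"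
      using tc xy by (intro W.finsum_addf) auto
    also have "\<dots> = ?F x \<oplus>\<^bsub>W\<^esub> ?F y"
      using big[of ?A x] big[of ?A y] A xy by simp
    finally show "?F (x \<oplus>\<^bsub>V\<^esub> y) = ?F x \<oplus>\<^bsub>W\<^esub> ?F y" .
  next
    fix a x assume ax: "a \<in> carrier K" "x \<in> carrier V"
    have A: "finite (?s x)" using fin ax by auto
    have "?s (a \<odot>\<^bsub>V\<^esub> x) \<subseteq> ?s x" using lin_map_smult[OF t] ax by auto
    then have "?F (a \<odot>\<^bsub>V\<^esub> x) = (\<Oplus>\<^bsub>W\<^esub>j\<in>?s x. t j (a \<odot>\<^bsub>V\<^esub> x))" using A ax by (intro big) auto
    also have "\<dots> = (\<Oplus>\<^bsub>W\<^esub>j\<in>?s x. a \<odot>\<^bsub>W\<^esub> t j x)"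
      using lin_map_smult[OF t] ax tc by (intro W.finsum_cong') auto
    also have "\<dots> = a \<odot>\<^bsub>W\<^esub> ?F x"
      using W.finsum_smult_ldistr[OF A ax(1), of "\<lambda>j. t j x"] tc ax by auto
    finally show "?F (a \<odot>\<^bsub>V\<^esub> x) = a \<odot>\<^bsub>W\<^esub> ?F x" .
  qed
qed

section \<open>Direct sums and quotients\<close>

lemma module_self: "cring K \<Longrightarrow> module K (self_mod K)"
proof -
  assume "cring K"
  then interpret cring K .
  have "abelian_group (self_mod K)"
    by (rule abelian_groupI) (auto simp: self_mod_def a_ac intro: l_neg)
  then show ?thesis
    by (intro moduleI) (auto simp: self_mod_def l_distr r_distr m_assoc is_cring)
qed

lemma dsum_simps:
  "f \<in> carrier (dsum_mod I V) \<longleftrightarrow> f \<in> (\<Pi>\<^sub>E i\<in>I. carrier (V i)) \<and> finite {i \<in> I. f i \<noteq> \<zero>\<^bsub>V i\<^esub>}"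
  "\<zero>\<^bsub>dsum_mod I V\<^esub> = (\<lambda>i\<in>I. \<zero>\<^bsub>V i\<^esub>)"
  "f \<oplus>\<^bsub>dsum_mod I V\<^esub> g = (\<lambda>i\<in>I. f i \<oplus>\<^bsub>V i\<^esub> g i)"
  "a \<odot>\<^bsub>dsum_mod I V\<^esub> f = (\<lambda>i\<in>I. a \<odot>\<^bsub>V i\<^esub> f i)"
  by (auto simp: dsum_mod_def)

lemma dsum_eqI:
  assumes "f \<in> carrier (dsum_mod I V)" "g \<in> carrier (dsum_mod I V)" "\<And>i. i \<in> I \<Longrightarrow> f i = g i"
  shows "f = g"
  using assms unfolding dsum_simps by (auto intro: PiE_ext)

lemma module_dsum:
  assumes K: "cring K" and V: "\<And>i. i \<in> I \<Longrightarrow> module K (V i)"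
  shows "module K (dsum_mod I V)"
proof -
  let ?D = "dsum_mod I V"
  interpret K: cring K by fact
  have ab: "abelian_group (V i)" if "i \<in> I" for i using V[OF that] by (rule module.axioms)
  have am: "abelian_monoid (V i)" if "i \<in> I" for i using ab[OF that] by (rule abelian_group.axioms)
  note A = abelian_monoid.a_closed[OF am] abelian_monoid.zero_closed[OF am]
    abelian_monoid.l_zero[OF am] abelian_monoid.r_zero[OF am] abelian_monoid.a_comm[OF am]
    abelian_monoid.a_assoc[OF am] abelian_monoid.a_lcomm[OF am] module.smult_closed[OF V] module.smult_r_null[OF V]
    module.smult_l_distr[OF V] module.smult_r_distr[OF V] module.smult_assoc1[OF V]
    module.smult_one[OF V]
  have sub: "finite {i \<in> I. P i}" if "finite A" "{i \<in> I. P i} \<subseteq> A" for A P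
    using that finite_subset by blast
  have 1: "f \<oplus>\<^bsub>?D\<^esub> g \<in> carrier ?D" if fg: "f \<in> carrier ?D" "g \<in> carrier ?D" for f g
  proof -
    have "finite {i \<in> I. f i \<oplus>\<^bsub>V i\<^esub> g i \<noteq> \<zero>\<^bsub>V i\<^esub>}"
      by (rule sub[where A = "{i \<in> I. f i \<noteq> \<zero>\<^bsub>V i\<^esub>} \<union> {i \<in> I. g i \<noteq> \<zero>\<^bsub>V i\<^esub>}"])
        (use fg in \<open>auto simp: dsum_simps A dest: PiE_mem\<close>)
    then show ?thesis using fg by (auto simp: dsum_simps PiE_iff A cong: conj_cong)
  qed
  have 2: "a \<odot>\<^bsub>?D\<^esub> f \<in> carrier ?D" if af: "a \<in> carrier K" "f \<in> carrier ?D" for a f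
  proof -
    have "finite {i \<in> I. a \<odot>\<^bsub>V i\<^esub> f i \<noteq> \<zero>\<^bsub>V i\<^esub>}"
      by (rule sub[where A = "{i \<in> I. f i \<noteq> \<zero>\<^bsub>V i\<^esub>}"]) (use af in \<open>auto simp: dsum_simps A dest: PiE_mem\<close>)
    then show ?thesis using af by (auto simp: dsum_simps PiE_iff A cong: conj_cong)
  qed
  have 3: "\<zero>\<^bsub>?D\<^esub> \<in> carrier ?D" by (auto simp: dsum_simps A cong: conj_cong)
  have c: "f i \<in> carrier (V i)" if "f \<in> carrier ?D" "i \<in> I" for f i
    using that by (auto simp: dsum_simps)
  have "abelian_group ?D"
  proof (rule abelian_groupI)
    fix f assume f: "f \<in> carrier ?D"
    show "\<exists>y\<in>carrier ?D. y \<oplus>\<^bsub>?D\<^esub> f = \<zero>\<^bsub>?D\<^esub>"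
    proof
      show "(\<ominus>\<^bsub>K\<^esub> \<one>\<^bsub>K\<^esub>) \<odot>\<^bsub>?D\<^esub> f \<in> carrier ?D" using f by (intro 2) auto
      have "(\<ominus>\<^bsub>K\<^esub> \<one>\<^bsub>K\<^esub>) \<odot>\<^bsub>V i\<^esub> f i \<oplus>\<^bsub>V i\<^esub> f i = \<zero>\<^bsub>V i\<^esub>" if i: "i \<in> I" for i
        using abelian_group.l_neg[OF ab[OF i] c[OF f i]] module_neg[OF V[OF i] c[OF f i]] by simp
      then show "(\<ominus>\<^bsub>K\<^esub> \<one>\<^bsub>K\<^esub>) \<odot>\<^bsub>?D\<^esub> f \<oplus>\<^bsub>?D\<^esub> f = \<zero>\<^bsub>?D\<^esub>"
        by (auto simp: dsum_simps restrict_def)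
    qed
    show "\<zero>\<^bsub>?D\<^esub> \<oplus>\<^bsub>?D\<^esub> f = f"
      by (rule dsum_eqI[OF 1[OF 3 f] f]) (simp_all add: dsum_simps(2-4) A c f)
  next
    fix f g assume fg: "f \<in> carrier ?D" "g \<in> carrier ?D"
    show "f \<oplus>\<^bsub>?D\<^esub> g = g \<oplus>\<^bsub>?D\<^esub> f"
      by (rule dsum_eqI[OF 1 1]) (simp_all add: dsum_simps(2-4) A c fg)
    fix h assume h: "h \<in> carrier ?D"
    show "f \<oplus>\<^bsub>?D\<^esub> g \<oplus>\<^bsub>?D\<^esub> h = f \<oplus>\<^bsub>?D\<^esub> (g \<oplus>\<^bsub>?D\<^esub> h)"
      by (rule dsum_eqI[OF 1[OF 1] 1[OF _ 1]]) (simp_all add: dsum_simps(2-4) A c fg h)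
  qed (use 1 3 in auto)
  then show ?thesis
  proof (rule moduleI[OF K])
    fix a b f assume ab: "a \<in> carrier K" "b \<in> carrier K" and f: "f \<in> carrier ?D"
    show "(a \<oplus>\<^bsub>K\<^esub> b) \<odot>\<^bsub>?D\<^esub> f = a \<odot>\<^bsub>?D\<^esub> f \<oplus>\<^bsub>?D\<^esub> b \<odot>\<^bsub>?D\<^esub> f"
      by (rule dsum_eqI[OF 2 1[OF 2 2]]) (simp_all add: dsum_simps(2-4) A c ab f)
    show "(a \<otimes>\<^bsub>K\<^esub> b) \<odot>\<^bsub>?D\<^esub> f = a \<odot>\<^bsub>?D\<^esub> (b \<odot>\<^bsub>?D\<^esub> f)"
      by (rule dsum_eqI[OF 2 2[OF _ 2]]) (simp_all add: dsum_simps(2-4) A c ab f)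
    fix g assume g: "g \<in> carrier ?D"
    show "a \<odot>\<^bsub>?D\<^esub> (f \<oplus>\<^bsub>?D\<^esub> g) = a \<odot>\<^bsub>?D\<^esub> f \<oplus>\<^bsub>?D\<^esub> a \<odot>\<^bsub>?D\<^esub> g"
      by (rule dsum_eqI[OF 2[OF _ 1] 1[OF 2 2]]) (simp_all add: dsum_simps(2-4) A c ab f g)
  next
    fix f assume f: "f \<in> carrier ?D"
    show "\<one>\<^bsub>K\<^esub> \<odot>\<^bsub>?D\<^esub> f = f"
      by (rule dsum_eqI[OF 2]) (simp_all add: dsum_simps(2-4) A c f)
  qed (use 2 in auto)
qed

lemma lin_map_dsum_eval: "i \<in> I \<Longrightarrow> lin_map K (dsum_mod I V) (V i) (\<lambda>f. f i)"
  by (rule lin_mapI) (auto simp: dsum_simps)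

lemma dsum_single_carrier:
  assumes "\<And>i. i \<in> I \<Longrightarrow> module K (V i)" "i \<in> I" "x \<in> carrier (V i)"
  shows "dsum_single I V i x \<in> carrier (dsum_mod I V)"
proof -
  have "\<zero>\<^bsub>V j\<^esub> \<in> carrier (V j)" if "j \<in> I" for j
    using assms(1)[OF that] by (meson abelian_monoid.zero_closed abelian_group.axioms module.axioms)
  moreover have "finite {j \<in> I. dsum_single I V i x j \<noteq> \<zero>\<^bsub>V j\<^esub>}"
    by (rule finite_subset[of _ "{i}"]) (auto simp: dsum_single_def)
  ultimately show ?thesis using assms by (auto simp: dsum_simps dsum_single_def)
qed

lemma lin_map_dsum_single:
  assumes K: "cring K" and V: "\<And>i. i \<in> I \<Longrightarrow> module K (V i)" and i: "i \<in> I"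
  shows "lin_map K (V i) (dsum_mod I V) (dsum_single I V i)"
proof -
  have ab: "abelian_monoid (V i)" if "i \<in> I" for i
    using V[OF that] by (meson abelian_group.axioms module.axioms)
  note A = abelian_monoid.zero_closed[OF ab]
    abelian_monoid.l_zero[OF ab] module.smult_r_null[OF V]
  show ?thesis
    by (rule lin_mapI) (simp_all add: dsum_single_carrier[of I K V, OF V] i,
      auto simp: dsum_simps(2-4) dsum_single_def fun_eq_iff restrict_def A i)
qed

lemma span_dsum:
  assumes K: "cring K" and V: "\<And>i. i \<in> I \<Longrightarrow> module K (V i)"
    and S: "\<And>i. i \<in> I \<Longrightarrow> S i \<subseteq> carrier (V i)" "\<And>i. i \<in> I \<Longrightarrow> submod_span K (V i) (S i) = carrier (V i)"
  shows "submod_span K (dsum_mod I V) (\<Union>i\<in>I. dsum_single I V i ` S i) = carrier (dsum_mod I V)"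
    (is "submod_span K ?D ?T = _")
proof -
  note D = module_dsum[of K I V, OF K V]
  interpret D: module K ?D by (rule D)
  have zc: "\<zero>\<^bsub>V i\<^esub> \<in> carrier (V i)" "\<And>x. x \<in> carrier (V i) \<Longrightarrow> x \<oplus>\<^bsub>V i\<^esub> \<zero>\<^bsub>V i\<^esub> = x"
    "\<And>x. x \<in> carrier (V i) \<Longrightarrow> \<zero>\<^bsub>V i\<^esub> \<oplus>\<^bsub>V i\<^esub> x = x" if "i \<in> I" for i
    using V[OF that] by (meson abelian_monoid.zero_closed abelian_monoid.r_zero abelian_monoid.l_zero abelian_group.axioms module.axioms)+
  have T: "?T \<subseteq> carrier ?D" using S dsum_single_carrier[of I K V, OF V] by blast
  let ?H = "submod_span K ?D ?T"
  have H: "submodule ?H K ?D" by (rule submodule_span[OF D T])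
  have single: "dsum_single I V i x \<in> ?H" if i: "i \<in> I" "x \<in> carrier (V i)" for i x
    using span_image_subset[OF V[OF i(1)] D lin_map_dsum_single[of K I V, OF K V i(1)] H S(1)[OF i(1)], of x]
      S(2)[OF i(1)] i span_superset[of ?T K ?D] by blast
  have "f \<in> ?H" if "finite A" "f \<in> carrier ?D" "{i \<in> I. f i \<noteq> \<zero>\<^bsub>V i\<^esub>} \<subseteq> A" for A f
    using that
  proof (induction A arbitrary: f)
    case empty
    then have "f = \<zero>\<^bsub>?D\<^esub>" by (intro dsum_eqI[OF _ D.zero_closed]) (auto simp: dsum_simps)
    then show ?case using submodule_zero[OF H] by simp
  next
    case (insert i A)
    show ?case
    proof (cases "i \<in> I")
      case False
      then show ?thesis using insert by (intro insert.IH) auto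
    next
      case True
      define g where "g = f(i := \<zero>\<^bsub>V i\<^esub>)"
      have g: "g \<in> carrier ?D"
      proof -
        have "finite {j \<in> I. g j \<noteq> \<zero>\<^bsub>V j\<^esub>}"
          using insert.prems(2) insert.hyps
          by (intro finite_subset[where A = "{j \<in> I. g j \<noteq> \<zero>\<^bsub>V j\<^esub>}" and B = A]) (auto simp: g_def split: if_splits)
        moreover have "g \<in> (\<Pi>\<^sub>E i\<in>I. carrier (V i))"
          using insert.prems(1) True by (auto simp: dsum_simps g_def PiE_iff extensional_def zc)
        ultimately show ?thesis by (simp add: dsum_simps)
      qed
      have fi: "f i \<in> carrier (V i)" using insert.prems(1) True by (auto simp: dsum_simps)
      have gH: "g \<in> ?H" using insert.prems(2) by (intro insert.IH g) (auto simp: g_def)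
      have fi_g: "dsum_single I V i (f i) \<oplus>\<^bsub>?D\<^esub> g \<in> ?H"
        by (rule submodule_add[OF H single[OF True fi] gH])
      have eq: "f = dsum_single I V i (f i) \<oplus>\<^bsub>?D\<^esub> g"
      proof (rule dsum_eqI[OF insert.prems(1)])
        show "dsum_single I V i (f i) \<oplus>\<^bsub>?D\<^esub> g \<in> carrier ?D"
          using g dsum_single_carrier[of I K V, OF V True fi] by simp
        fix j assume "j \<in> I"
        then show "f j = (dsum_single I V i (f i) \<oplus>\<^bsub>?D\<^esub> g) j"
          using insert.prems(1) by (auto simp: dsum_simps dsum_single_def g_def zc dest: PiE_mem)
      qed
      show ?thesis using fi_g by (simp only: eq[symmetric])
    qed
  qed
  then have "carrier ?D \<subseteq> ?H" by (auto simp: dsum_simps)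
  then show ?thesis using submodule_subset[OF H] by blast
qed

lemma span_carrier: "module K V \<Longrightarrow> submod_span K V (carrier V) = carrier V"
  using span_superset[of "carrier V"] span_minimal[OF submodule_carrier] by blast

lemma dsum_copair:
  assumes K: "cring K" and V: "\<And>i. i \<in> I \<Longrightarrow> module K (V i)" and W: "module K W"
    and f: "\<And>i. i \<in> I \<Longrightarrow> lin_map K (V i) W (f i)"
  shows "\<exists>F. lin_map K (dsum_mod I V) W F \<and>
    (\<forall>i\<in>I. \<forall>x\<in>carrier (V i). F (dsum_single I V i x) = f i x)"
proof -
  let ?D = "dsum_mod I V"
  note D = module_dsum[of K I V, OF K V]
  interpret W: module K W by fact
  have f0: "f i \<zero>\<^bsub>V i\<^esub> = \<zero>\<^bsub>W\<^esub>" if "i \<in> I" for i using lin_map_zero[OF V W f] that by blast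
  let ?F = "\<lambda>g. \<Oplus>\<^bsub>W\<^esub>i\<in>{i \<in> I. f i (g i) \<noteq> \<zero>\<^bsub>W\<^esub>}. f i (g i)"
  have "lin_map K ?D W ?F"
  proof (rule lin_map_family[OF D W])
    show "lin_map K ?D W (\<lambda>g. f i (g i))" if "i \<in> I" for i
      by (rule lin_map_comp[where f = "\<lambda>g. g i" and g = "f i", OF lin_map_dsum_eval[where V = V, OF that] f[OF that]])
    fix g assume "g \<in> carrier ?D"
    then show "finite {i \<in> I. f i (g i) \<noteq> \<zero>\<^bsub>W\<^esub>}"
      using f0 by (auto simp: dsum_simps elim!: rev_finite_subset)
  qed
  moreover have "?F (dsum_single I V i x) = f i x" if i: "i \<in> I" and x: "x \<in> carrier (V i)" for i x
  proof -
    have fx: "f i x \<in> carrier W" using lin_map_closed[OF f[OF i] x] .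
    have *: "f k (dsum_single I V i x k) = (if k = i then f i x else \<zero>\<^bsub>W\<^esub>)" if "k \<in> I" for k
      using that f0 by (simp add: dsum_single_def)
    have "?F (dsum_single I V i x) = (\<Oplus>\<^bsub>W\<^esub>k\<in>{i}. if k = i then f i x else \<zero>\<^bsub>W\<^esub>)"
      by (rule W.add.finprod_mono_neutral_cong_left) (use i fx * in \<open>auto split: if_splits\<close>)
    then show ?thesis using fx by simp
  qed
  ultimately show ?thesis by blast
qed

lemma dsum_push:
  assumes K: "cring K" and V: "\<And>i. i \<in> I \<Longrightarrow> module K (V i)"
    and W: "\<And>j. j \<in> J \<Longrightarrow> module K (W j)"
    and h: "\<And>i. i \<in> I \<Longrightarrow> h i \<in> J" "\<And>i. i \<in> I \<Longrightarrow> W (h i) = V i"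
  shows lin_map_dsum_push: "lin_map K (dsum_mod I V) (dsum_mod J W) (dsum_push I J V W h)"
    and dsum_push_single: "\<And>i x. i \<in> I \<Longrightarrow> x \<in> carrier (V i) \<Longrightarrow>
      dsum_push I J V W h (dsum_single I V i x) = dsum_single J W (h i) x"
proof -
  let ?D = "dsum_mod I V" and ?p = "dsum_push I J V W h"
  note D = module_dsum[of K I V, OF K V]
  have am: "abelian_monoid (W j)" if "j \<in> J" for j
    using W[OF that] by (meson abelian_group.axioms module.axioms)
  have p: "?p f j = (\<Oplus>\<^bsub>W j\<^esub>i\<in>{i \<in> {i \<in> I. h i = j}. f i \<noteq> \<zero>\<^bsub>W j\<^esub>}. f i)" if "j \<in> J" for f j
  proof -
    have "{i \<in> I. h i = j \<and> f i \<noteq> \<zero>\<^bsub>V i\<^esub>} = {i \<in> {i \<in> I. h i = j}. f i \<noteq> \<zero>\<^bsub>W j\<^esub>}" using h by auto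
    then show ?thesis using that by (simp add: dsum_push_def)
  qed
  have lin: "lin_map K ?D (W j) (\<lambda>f. ?p f j)" if j: "j \<in> J" for j
    unfolding p[OF j]
  proof (rule lin_map_family[OF D W[OF j]])
    show "lin_map K ?D (W j) (\<lambda>f. f i)" if "i \<in> {i \<in> I. h i = j}" for i
      using lin_map_dsum_eval[of i I K V] h(2)[of i] that by auto
    fix f assume "f \<in> carrier ?D"
    then have "finite {i \<in> I. f i \<noteq> \<zero>\<^bsub>V i\<^esub>}" by (simp add: dsum_simps)
    then show "finite {i \<in> {i \<in> I. h i = j}. f i \<noteq> \<zero>\<^bsub>W j\<^esub>}"
      by (rule rev_finite_subset) (use h in auto)
  qed
  have ext: "?p f = (\<lambda>j\<in>J. ?p f j)" for f by (simp add: dsum_push_def restrict_def fun_eq_iff)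
  have clo: "?p f \<in> carrier (dsum_mod J W)" if f: "f \<in> carrier ?D" for f
  proof -
    have "finite {j \<in> J. ?p f j \<noteq> \<zero>\<^bsub>W j\<^esub>}"
    proof (rule finite_subset)
      show "{j \<in> J. ?p f j \<noteq> \<zero>\<^bsub>W j\<^esub>} \<subseteq> h ` {i \<in> I. f i \<noteq> \<zero>\<^bsub>V i\<^esub>}"
      proof clarify
        fix j assume j: "j \<in> J" "?p f j \<noteq> \<zero>\<^bsub>W j\<^esub>"
        have "{i \<in> {i \<in> I. h i = j}. f i \<noteq> \<zero>\<^bsub>W j\<^esub>} \<noteq> {}"
          using j p[of j f] abelian_monoid.finsum_empty[OF am[OF j(1)]] by metis
        then show "j \<in> h ` {i \<in> I. f i \<noteq> \<zero>\<^bsub>V i\<^esub>}" using h by auto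
      qed
      show "finite (h ` {i \<in> I. f i \<noteq> \<zero>\<^bsub>V i\<^esub>})" using f by (auto simp: dsum_simps)
    qed
    then show ?thesis
      using lin_map_closed[OF lin f] by (auto simp: dsum_simps dsum_push_def)
  qed
  show "lin_map K ?D (dsum_mod J W) ?p"
  proof (rule lin_mapI)
    fix x y assume "x \<in> carrier ?D" "y \<in> carrier ?D"
    then show "?p (x \<oplus>\<^bsub>?D\<^esub> y) = ?p x \<oplus>\<^bsub>dsum_mod J W\<^esub> ?p y"
      using lin_map_add[OF lin] by (subst ext) (auto simp: dsum_simps(3))
  next
    fix a x assume "a \<in> carrier K" "x \<in> carrier ?D"
    then show "?p (a \<odot>\<^bsub>?D\<^esub> x) = a \<odot>\<^bsub>dsum_mod J W\<^esub> ?p x"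
      using lin_map_smult[OF lin] by (subst ext) (auto simp: dsum_simps(4))
  qed (rule clo)
  show "?p (dsum_single I V i x) = dsum_single J W (h i) x" if i: "i \<in> I" and x: "x \<in> carrier (V i)" for i x
  proof (rule dsum_eqI[where I = J and V = W])
    show "?p (dsum_single I V i x) \<in> carrier (dsum_mod J W)"
      by (rule clo[OF dsum_single_carrier[of I K V, OF V i x]])
    show "dsum_single J W (h i) x \<in> carrier (dsum_mod J W)"
      using dsum_single_carrier[of J K W "h i" x, OF W] h i x by simp
    fix j assume j: "j \<in> J"
    interpret Wj: module K "W j" using W[OF j] .
    have hV: "V k = V i" if "k \<in> I" "h k = h i" for k using h(2)[OF that(1)] h(2)[OF i] that by simp
    have "?p (dsum_single I V i x) j = (\<Oplus>\<^bsub>W j\<^esub>k\<in>{k \<in> {i}. h k = j}. x)"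
      unfolding p[OF j]
      by (rule Wj.add.finprod_mono_neutral_cong_left)
        (use i x in \<open>auto simp: dsum_single_def h dest: hV split: if_splits\<close>)
    also have "\<dots> = dsum_single J W (h i) x j"
    proof (cases "h i = j")
      case True
      then have "{k \<in> {i}. h k = j} = {i}" "x \<in> carrier (W j)" using h(2)[OF i] x by auto
      then show ?thesis using True j by (simp add: dsum_single_def Wj.finsum_insert)
    next
      case False
      then have "{k \<in> {i}. h k = j} = {}" by auto
      then have "(\<Oplus>\<^bsub>W j\<^esub>k\<in>{k \<in> {i}. h k = j}. x) = \<zero>\<^bsub>W j\<^esub>"
        by (simp only: Wj.finsum_empty)
      then show ?thesis using False j by (auto simp: dsum_single_def)
    qed
    finally show "?p (dsum_single I V i x) j = dsum_single J W (h i) x j" .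
  qed
qed

lemma abelian_subgroup_submodule:
  assumes "module K V" "submodule H K V" shows "abelian_subgroup H V"
proof -
  interpret V: module K V by fact
  show ?thesis
    using abelian_subgroupI3[OF additive_subgroup.intro[OF submodule.axioms(1)[OF assms(2)]]]
      V.abelian_group_axioms .
qed

lemma coset_self:
  assumes "module K V" "submodule H K V" "x \<in> carrier V" shows "x \<in> H +>\<^bsub>V\<^esub> x"
  by (rule abelian_subgroup.a_rcos_self[OF abelian_subgroup_submodule[OF assms(1,2)] assms(3)])

lemma coset_subset:
  assumes "module K V" "submodule H K V" "x \<in> carrier V" shows "H +>\<^bsub>V\<^esub> x \<subseteq> carrier V"
proof -
  interpret V: module K V by fact
  show ?thesis using V.a_r_coset_subset_G[OF submodule_subset[OF assms(2)] assms(3)] .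
qed

lemma coset_eq_iff:
  assumes "module K V" "submodule H K V" "x \<in> carrier V" "y \<in> carrier V"
  shows "H +>\<^bsub>V\<^esub> x = H +>\<^bsub>V\<^esub> y \<longleftrightarrow> x \<ominus>\<^bsub>V\<^esub> y \<in> H"
proof -
  interpret V: module K V by fact
  interpret A: abelian_subgroup H V by (rule abelian_subgroup_submodule[OF assms(1,2)])
  note H = submodule_subset[OF assms(2)]
  have sg: "subgroup H (add_monoid V)" by (rule submodule.axioms(1)[OF assms(2)])
  show ?thesis
  proof
    assume "H +>\<^bsub>V\<^esub> x = H +>\<^bsub>V\<^esub> y"
    then have "H +>\<^bsub>V\<^esub> (x \<oplus>\<^bsub>V\<^esub> \<ominus>\<^bsub>V\<^esub> y) = H"
      using V.a_coset_add_inv2[OF _ assms(3,4) H] by simp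
    then show "x \<ominus>\<^bsub>V\<^esub> y \<in> H"
      using V.a_coset_join1[OF _ _ sg] assms(3,4) by (simp add: a_minus_def)
  next
    assume "x \<ominus>\<^bsub>V\<^esub> y \<in> H"
    then have "H +>\<^bsub>V\<^esub> (x \<oplus>\<^bsub>V\<^esub> \<ominus>\<^bsub>V\<^esub> y) = H"
      using V.a_coset_join2[OF _ sg] assms(3,4) by (simp add: a_minus_def)
    then show "H +>\<^bsub>V\<^esub> x = H +>\<^bsub>V\<^esub> y" using V.a_coset_add_inv1[OF _ assms(3,4) H] by simp
  qed
qed

lemma coset_memD:
  assumes "module K V" "submodule H K V" "x \<in> carrier V" "y \<in> H +>\<^bsub>V\<^esub> x"
  shows "y \<in> carrier V" "y \<ominus>\<^bsub>V\<^esub> x \<in> H"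
proof -
  interpret V: module K V by fact
  show y: "y \<in> carrier V" using coset_subset[OF assms(1-3)] assms(4) by auto
  have "H +>\<^bsub>V\<^esub> x = H +>\<^bsub>V\<^esub> y"
    by (rule V.a_repr_independence[OF assms(4,3) submodule.axioms(1)[OF assms(2)]])
  then show "y \<ominus>\<^bsub>V\<^esub> x \<in> H" using coset_eq_iff[OF assms(1,2) y assms(3)] by simp
qed

text \<open>Scalar multiplication on quotients and all maps between quotients are given by such unions; they
  are computed on a representative because all cosets in the union coincide.\<close>

lemma coset_UN:
  assumes V: "module K V" "submodule H K V" and W: "module K W" "submodule H' K W"
    and f: "lin_map K V W f" "\<And>x. x \<in> H \<Longrightarrow> f x \<in> H'" and x: "x \<in> carrier V"
  shows "(\<Union>y\<in>H +>\<^bsub>V\<^esub> x. H' +>\<^bsub>W\<^esub> f y) = H' +>\<^bsub>W\<^esub> f x"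
proof -
  have "H' +>\<^bsub>W\<^esub> f y = H' +>\<^bsub>W\<^esub> f x" if "y \<in> H +>\<^bsub>V\<^esub> x" for y
    using coset_memD[OF V x that] f(2)[of "y \<ominus>\<^bsub>V\<^esub> x"] lin_map_closed[OF f(1)] x
    by (subst coset_eq_iff[OF W]) (auto simp: lin_map_minus[OF V(1) W(1) f(1)])
  then have "(\<Union>y\<in>H +>\<^bsub>V\<^esub> x. H' +>\<^bsub>W\<^esub> f y) = (\<Union>y\<in>H +>\<^bsub>V\<^esub> x. H' +>\<^bsub>W\<^esub> f x)"
    by (intro SUP_cong refl)
  also have "\<dots> = H' +>\<^bsub>W\<^esub> f x" using coset_self[OF V x] by (intro SUP_const) blast
  finally show ?thesis .
qed

lemma quot_carrier: "carrier (quot_mod V H) = {H +>\<^bsub>V\<^esub> x | x. x \<in> carrier V}"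
  by (auto simp: quot_mod_def A_RCOSETS_def' )

lemma quot_zero: "\<zero>\<^bsub>quot_mod V H\<^esub> = H"
  by (simp add: quot_mod_def)

lemma quot_add:
  assumes "module K V" "submodule H K V" "x \<in> carrier V" "y \<in> carrier V"
  shows "(H +>\<^bsub>V\<^esub> x) \<oplus>\<^bsub>quot_mod V H\<^esub> (H +>\<^bsub>V\<^esub> y) = H +>\<^bsub>V\<^esub> (x \<oplus>\<^bsub>V\<^esub> y)"
  using abelian_subgroup.a_rcos_sum[OF abelian_subgroup_submodule[OF assms(1,2)] assms(3,4)]
  by (simp add: quot_mod_def)

lemma lin_map_scale:
  assumes "module K V" "a \<in> carrier K" shows "lin_map K V V (\<lambda>x. a \<odot>\<^bsub>V\<^esub> x)"
proof -
  interpret V: module K V by fact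
  show ?thesis
    using assms(2) by (intro lin_mapI) (auto simp: V.smult_r_distr V.smult_assoc1[symmetric] V.R.m_comm)
qed

lemma quot_smult:
  assumes "module K V" "submodule H K V" "a \<in> carrier K" "x \<in> carrier V"
  shows "a \<odot>\<^bsub>quot_mod V H\<^esub> (H +>\<^bsub>V\<^esub> x) = H +>\<^bsub>V\<^esub> (a \<odot>\<^bsub>V\<^esub> x)"
  using coset_UN[OF assms(1,2) assms(1,2) lin_map_scale[OF assms(1,3)] _ assms(4)]
    submodule_smult[OF assms(2,3)]
  by (simp add: quot_mod_def)

lemma module_quot:
  assumes V: "module K V" and H: "submodule H K V"
  shows "module K (quot_mod V H)"
proof -
  interpret V: module K V by fact
  let ?Q = "quot_mod V H"
  note S = quot_add[OF V H] quot_smult[OF V H]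
  have z: "\<zero>\<^bsub>?Q\<^esub> = H +>\<^bsub>V\<^esub> \<zero>\<^bsub>V\<^esub>"
    using V.a_coset_add_zero[OF submodule_subset[OF H]] by (simp add: quot_zero)
  have "abelian_group ?Q"
  proof (rule abelian_groupI)
    fix X assume "X \<in> carrier ?Q"
    then obtain x where x: "X = H +>\<^bsub>V\<^esub> x" "x \<in> carrier V" by (auto simp: quot_carrier)
    then show "\<exists>Y\<in>carrier ?Q. Y \<oplus>\<^bsub>?Q\<^esub> X = \<zero>\<^bsub>?Q\<^esub>"
      by (intro bexI[of _ "H +>\<^bsub>V\<^esub> (\<ominus>\<^bsub>V\<^esub> x)"]) (auto simp: quot_carrier S z V.l_neg)
  qed (auto simp: quot_carrier S z V.a_ac)
  then show ?thesis
    by (rule moduleI[OF V.R.is_cring])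
      (auto simp: quot_carrier S V.smult_l_distr V.smult_r_distr V.smult_assoc1)
qed

lemma lin_map_coset:
  assumes V: "module K V" and H: "submodule H K V"
  shows "lin_map K V (quot_mod V H) (\<lambda>x. H +>\<^bsub>V\<^esub> x)"
  by (rule lin_mapI) (auto simp: quot_carrier quot_add[OF V H] quot_smult[OF V H])

lemma lin_map_quot:
  assumes V: "module K V" "submodule H K V" and W: "module K W" "submodule H' K W"
    and f: "lin_map K V W f" "\<And>x. x \<in> H \<Longrightarrow> f x \<in> H'"
  shows "lin_map K (quot_mod V H) (quot_mod W H') (\<lambda>X. \<Union>x\<in>X. H' +>\<^bsub>W\<^esub> f x)"
proof -
  interpret V: module K V by fact
  note c = lin_map_closed[OF f(1)]
  define F where "F X = (\<Union>x\<in>X. H' +>\<^bsub>W\<^esub> f x)" for X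
  have F: "F (H +>\<^bsub>V\<^esub> x) = H' +>\<^bsub>W\<^esub> f x" if "x \<in> carrier V" for x
    unfolding F_def by (rule coset_UN[OF V W f that])
  have "lin_map K (quot_mod V H) (quot_mod W H') F"
    using c by (intro lin_mapI)
      (auto simp: quot_carrier F quot_add[OF V] quot_smult[OF V] quot_add[OF W] quot_smult[OF W]
        lin_map_add[OF f(1)] lin_map_smult[OF f(1)])
  then show ?thesis unfolding F_def .
qed

lemma module_eqI:
  assumes "module K V" "x \<in> carrier V" "y \<in> carrier V" "x \<ominus>\<^bsub>V\<^esub> y = \<zero>\<^bsub>V\<^esub>"
  shows "x = y"
proof -
  interpret V: module K V by fact
  have "x = (x \<ominus>\<^bsub>V\<^esub> y) \<oplus>\<^bsub>V\<^esub> y" using assms(2,3) by (simp add: a_minus_def V.a_assoc V.l_neg)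
  then show ?thesis using assms by simp
qed

lemma quot_lift:
  assumes V: "module K V" "submodule H K V" and W: "module K W"
    and f: "lin_map K V W f" "\<And>x. x \<in> H \<Longrightarrow> f x = \<zero>\<^bsub>W\<^esub>"
  shows "\<exists>F. lin_map K (quot_mod V H) W F \<and> (\<forall>x\<in>carrier V. F (H +>\<^bsub>V\<^esub> x) = f x)"
proof -
  interpret V: module K V by fact
  interpret W: module K W by fact
  define F where "F X = f (SOME x. x \<in> X)" for X
  have F: "F (H +>\<^bsub>V\<^esub> x) = f x" if x: "x \<in> carrier V" for x
  proof -
    let ?y = "SOME y. y \<in> H +>\<^bsub>V\<^esub> x"
    have y: "?y \<in> H +>\<^bsub>V\<^esub> x" using coset_self[OF V x] by (rule someI)
    have "f ?y \<ominus>\<^bsub>W\<^esub> f x = \<zero>\<^bsub>W\<^esub>"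
      using coset_memD[OF V x y] f(2) lin_map_minus[OF V(1) W f(1) _ x] by metis
    then show ?thesis
      unfolding F_def using lin_map_closed[OF f(1)] coset_memD(1)[OF V x y] x
      by (auto intro: module_eqI[OF W])
  qed
  have "lin_map K (quot_mod V H) W F"
    using lin_map_closed[OF f(1)]
    by (intro lin_mapI) (auto simp: quot_carrier quot_add[OF V] quot_smult[OF V] F
        lin_map_add[OF f(1)] lin_map_smult[OF f(1)])
  then show ?thesis using F by blast
qed

lemma span_quot:
  assumes V: "module K V" "submodule H K V" and S: "S \<subseteq> carrier V" "submod_span K V S = carrier V"
  shows "submod_span K (quot_mod V H) ((\<lambda>x. H +>\<^bsub>V\<^esub> x) ` S) = carrier (quot_mod V H)"
proof -
  let ?Q = "quot_mod V H" and ?T = "(\<lambda>x. H +>\<^bsub>V\<^esub> x) ` S"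
  note Q = module_quot[OF V] and c = lin_map_coset[OF V]
  have T: "?T \<subseteq> carrier ?Q" using S(1) lin_map_closed[OF c] by blast
  note sub = submodule_span[OF Q T]
  have "H +>\<^bsub>V\<^esub> x \<in> submod_span K ?Q ?T" if "x \<in> carrier V" for x
    using span_image_subset[OF V(1) Q c sub S(1), of x] S(2) that span_superset[of ?T K ?Q] by auto
  then show ?thesis using submodule_subset[OF sub] by (auto simp: quot_carrier)
qed

section \<open>Bases of modules\<close>

text \<open>A basis is a spanning family with a family of dual functionals; the latter replace linear
  independence and give direct access to coordinates.\<close>

definition mbasis ::
  "('k, 'z) ring_scheme \<Rightarrow> ('k, 'v) module \<Rightarrow> 'j set \<Rightarrow> ('j \<Rightarrow> 'v) \<Rightarrow> ('j \<Rightarrow> 'v \<Rightarrow> 'k) \<Rightarrow> bool" where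
  "mbasis K V J e \<chi> \<longleftrightarrow> module K V \<and> e \<in> J \<rightarrow> carrier V \<and> submod_span K V (e ` J) = carrier V \<and>
     (\<forall>j\<in>J. lin_map K V (self_mod K) (\<chi> j) \<and>
        (\<forall>k\<in>J. \<chi> j (e k) = (if k = j then \<one>\<^bsub>K\<^esub> else \<zero>\<^bsub>K\<^esub>)))"

lemma mbasisD:
  assumes "mbasis K V J e \<chi>"
  shows mbasis_module: "module K V"
    and mbasis_elt: "\<And>j. j \<in> J \<Longrightarrow> e j \<in> carrier V"
    and mbasis_span: "submod_span K V (e ` J) = carrier V"
    and mbasis_coord: "\<And>j. j \<in> J \<Longrightarrow> lin_map K V (self_mod K) (\<chi> j)"
    and mbasis_dual: "\<And>j k. j \<in> J \<Longrightarrow> k \<in> J \<Longrightarrow> \<chi> j (e k) = (if k = j then \<one>\<^bsub>K\<^esub> else \<zero>\<^bsub>K\<^esub>)"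
  using assms by (auto simp: mbasis_def)

lemma self_mod_simps [simp]:
  "carrier (self_mod K) = carrier K" "\<zero>\<^bsub>self_mod K\<^esub> = \<zero>\<^bsub>K\<^esub>" "\<one>\<^bsub>self_mod K\<^esub> = \<one>\<^bsub>K\<^esub>"
  "x \<oplus>\<^bsub>self_mod K\<^esub> y = x \<oplus>\<^bsub>K\<^esub> y" "a \<odot>\<^bsub>self_mod K\<^esub> x = a \<otimes>\<^bsub>K\<^esub> x"
  by (auto simp: self_mod_def)

lemma mbasis_coord_closed:
  "mbasis K V J e \<chi> \<Longrightarrow> j \<in> J \<Longrightarrow> x \<in> carrier V \<Longrightarrow> \<chi> j x \<in> carrier K"
  using lin_map_closed[OF mbasis_coord] by fastforce

lemma mbasis_finite_support:
  assumes B: "mbasis K V J e \<chi>" and x: "x \<in> carrier V"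
  shows "finite {j \<in> J. \<chi> j x \<noteq> \<zero>\<^bsub>K\<^esub>}"
proof -
  note B' = mbasisD[OF B] and cl = mbasis_coord_closed[OF B]
  interpret V: module K V by (rule B')
  have sm: "module K (self_mod K)" by (rule module_self[OF V.R.is_cring])
  let ?H = "{x \<in> carrier V. finite {j \<in> J. \<chi> j x \<noteq> \<zero>\<^bsub>K\<^esub>}}"
  have fs: "finite {j \<in> J. P j}" if "finite A" "\<And>j. j \<in> J \<Longrightarrow> P j \<Longrightarrow> j \<in> A" for A P
    using that by (auto intro: finite_subset)
  have "submodule ?H K V"
  proof (rule submoduleI'[OF B'(1)])
    show "\<zero>\<^bsub>V\<^esub> \<in> ?H"
      using lin_map_zero[OF B'(1) sm B'(4)] by (auto intro: fs[of "{}"])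
    show "x \<oplus>\<^bsub>V\<^esub> y \<in> ?H" if "x \<in> ?H" "y \<in> ?H" for x y
      using that lin_map_add[OF B'(4)]
      by (auto intro!: fs[of "{j \<in> J. \<chi> j x \<noteq> \<zero>\<^bsub>K\<^esub>} \<union> {j \<in> J. \<chi> j y \<noteq> \<zero>\<^bsub>K\<^esub>}"])
    show "a \<odot>\<^bsub>V\<^esub> x \<in> ?H" if "a \<in> carrier K" "x \<in> ?H" for a x
      using that lin_map_smult[OF B'(4)]
      by (auto intro!: fs[of "{j \<in> J. \<chi> j x \<noteq> \<zero>\<^bsub>K\<^esub>}"])
  qed auto
  moreover have "e ` J \<subseteq> ?H"
  proof clarify
    fix k assume "k \<in> J"
    then have "finite {j \<in> J. \<chi> j (e k) \<noteq> \<zero>\<^bsub>K\<^esub>}"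
      using B'(5) by (intro fs[of "{k}"]) (auto split: if_splits)
    then show "e k \<in> carrier V \<and> finite {j \<in> J. \<chi> j (e k) \<noteq> \<zero>\<^bsub>K\<^esub>}" using B'(2) \<open>k \<in> J\<close> by auto
  qed
  ultimately have "x \<in> ?H" by (rule span_memI[OF B'(3) _ _ x])
  then show ?thesis by simp
qed

lemma lin_map_functional_smult:
  assumes V: "module K V" and W: "module K W" and m: "m \<in> carrier W"
    and f: "lin_map K V (self_mod K) f"
  shows "lin_map K V W (\<lambda>x. f x \<odot>\<^bsub>W\<^esub> m)"
proof -
  interpret W: module K W by fact
  have "lin_map K (self_mod K) W (\<lambda>a. a \<odot>\<^bsub>W\<^esub> m)"
    using m by (intro lin_mapI) (auto simp: W.smult_l_distr W.smult_assoc1)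
  then show ?thesis by (rule lin_map_comp[OF f])
qed

text \<open>The formula is kept explicit because for \<open>m = e\<close> it expands every vector in the basis.\<close>

lemma mbasis_lift_formula:
  assumes B: "mbasis K V J e \<chi>" and W: "module K W" and m: "\<And>j. j \<in> J \<Longrightarrow> m j \<in> carrier W"
  defines "F \<equiv> \<lambda>x. \<Oplus>\<^bsub>W\<^esub>j\<in>{j \<in> J. \<chi> j x \<odot>\<^bsub>W\<^esub> m j \<noteq> \<zero>\<^bsub>W\<^esub>}. \<chi> j x \<odot>\<^bsub>W\<^esub> m j"
  shows "lin_map K V W F" and "\<And>j. j \<in> J \<Longrightarrow> F (e j) = m j"
proof -
  note B' = mbasisD[OF B] and cl = mbasis_coord_closed[OF B]
  interpret W: module K W by (rule W)
  show "lin_map K V W F" unfolding F_def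
  proof (rule lin_map_family[OF B'(1) W])
    show "lin_map K V W (\<lambda>x. \<chi> j x \<odot>\<^bsub>W\<^esub> m j)" if "j \<in> J" for j
      by (rule lin_map_functional_smult[OF B'(1) W m[OF that] B'(4)[OF that]])
    show "finite {j \<in> J. \<chi> j x \<odot>\<^bsub>W\<^esub> m j \<noteq> \<zero>\<^bsub>W\<^esub>}" if "x \<in> carrier V" for x
      using m by (intro finite_subset[OF _ mbasis_finite_support[OF B that]]) auto
  qed
  fix j assume j: "j \<in> J"
  have "F (e j) = (\<Oplus>\<^bsub>W\<^esub>k\<in>{j}. \<chi> k (e j) \<odot>\<^bsub>W\<^esub> m k)"
    unfolding F_def
    by (rule W.add.finprod_mono_neutral_cong_left)
      (use j m in \<open>auto simp: B'(5) split: if_splits\<close>)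
  then show "F (e j) = m j" using j m by (simp add: B'(5))
qed

lemma mbasis_lift:
  assumes "mbasis K V J e \<chi>" "module K W" "\<And>j. j \<in> J \<Longrightarrow> m j \<in> carrier W"
  shows "\<exists>F. lin_map K V W F \<and> (\<forall>j\<in>J. F (e j) = m j)"
  using mbasis_lift_formula[where m = m, OF assms] by blast

lemma mbasis_ext:
  assumes "mbasis K V J e \<chi>" "module K W" "lin_map K V W f" "lin_map K V W g"
    and "\<And>j. j \<in> J \<Longrightarrow> f (e j) = g (e j)" "x \<in> carrier V"
  shows "f x = g x"
  by (rule lin_map_ext[OF mbasis_module[OF assms(1)] assms(2-4) _ mbasis_span[OF assms(1)] _ assms(6)])
    (use assms(5) mbasis_elt[OF assms(1)] in auto)

text \<open>A vector is a combination of the basis elements at which its coordinate is nonzero.  Membership is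
  all that is ever needed of this expansion, so the sum itself stays hidden.\<close>

lemma mbasis_memI:
  assumes B: "mbasis K V J e \<chi>" and H: "submodule H K V" and x: "x \<in> carrier V"
    and e: "\<And>j. j \<in> J \<Longrightarrow> \<chi> j x \<noteq> \<zero>\<^bsub>K\<^esub> \<Longrightarrow> e j \<in> H"
  shows "x \<in> H"
proof -
  note B' = mbasisD[OF B] and cl = mbasis_coord_closed[OF B]
  interpret V: module K V by (rule B')
  let ?F = "\<lambda>x. \<Oplus>\<^bsub>V\<^esub>j\<in>{j \<in> J. \<chi> j x \<odot>\<^bsub>V\<^esub> e j \<noteq> \<zero>\<^bsub>V\<^esub>}. \<chi> j x \<odot>\<^bsub>V\<^esub> e j"
  note F = mbasis_lift_formula[OF B B'(1) B'(2)]
  have "?F x = x"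
    by (rule mbasis_ext[OF B B'(1) F(1) lin_map_id _ x]) (use F(2) in auto)
  moreover have "?F x \<in> H"
  proof (rule finsum_in_submodule[OF B'(1) H])
    fix j assume "j \<in> {j \<in> J. \<chi> j x \<odot>\<^bsub>V\<^esub> e j \<noteq> \<zero>\<^bsub>V\<^esub>}"
    then have j: "j \<in> J" "\<chi> j x \<odot>\<^bsub>V\<^esub> e j \<noteq> \<zero>\<^bsub>V\<^esub>" by auto
    then have "\<chi> j x \<noteq> \<zero>\<^bsub>K\<^esub>" using B'(2) by auto
    then show "\<chi> j x \<odot>\<^bsub>V\<^esub> e j \<in> H" using e j cl x submodule_smult[OF H] by auto
  qed
  ultimately show ?thesis by simp
qed

lemma mbasis_reindex:
  assumes B: "mbasis K V J e \<chi>" and h: "bij_betw h J' J"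
    and e: "\<And>j. j \<in> J' \<Longrightarrow> e' j = e (h j)" and \<chi>: "\<And>j. j \<in> J' \<Longrightarrow> \<chi>' j = \<chi> (h j)"
  shows "mbasis K V J' e' \<chi>'"
proof -
  have "e' ` J' = e ` J" using h e by (force simp: bij_betw_def)
  then show ?thesis
    using B h e \<chi> by (auto simp: mbasis_def bij_betw_def inj_on_eq_iff)
qed

lemma mbasis_iso:
  assumes B: "mbasis K V J e \<chi>" and W: "module K W"
    and f: "lin_map K V W f" "bij_betw f (carrier V) (carrier W)"
  shows "mbasis K W J (\<lambda>j. f (e j)) (\<lambda>j y. \<chi> j (inv_into (carrier V) f y))"
proof -
  note B' = mbasisD[OF B]
  let ?g = "inv_into (carrier V) f"
  note g = lin_map_inv[OF B'(1) f]
  have T: "(\<lambda>j. f (e j)) ` J \<subseteq> carrier W" using B'(2) lin_map_closed[OF f(1)] by auto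
  let ?H = "submod_span K W ((\<lambda>j. f (e j)) ` J)"
  have "f x \<in> ?H" if "x \<in> carrier V" for x
    using span_image_subset[OF B'(1) W f(1) submodule_span[OF W T], of "e ` J" x]
      B'(2,3) that span_superset[of "(\<lambda>j. f (e j)) ` J" K W] by auto
  then have "f ` carrier V \<subseteq> ?H" by blast
  then have "carrier W \<subseteq> ?H" using f(2) by (simp add: bij_betw_def)
  then have "?H = carrier W" using submodule_subset[OF submodule_span[OF W T]] by auto
  moreover have "?g (f (e j)) = e j" if "j \<in> J" for j
    using f(2) B'(2)[OF that] by (auto simp: bij_betw_def)
  ultimately show ?thesis
    using T W lin_map_comp[OF g B'(4)] B'(5) by (auto simp: mbasis_def)
qed

lemma free_mod_single_carrier:
  assumes "cring K" "x \<in> X" "a \<in> carrier K"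
  shows "dsum_single X (\<lambda>_. self_mod K) x a \<in> carrier (free_mod K X)"
  unfolding free_mod_def
  by (rule dsum_single_carrier[where K = K]) (use assms module_self in auto)

lemma mbasis_self: "cring K \<Longrightarrow> mbasis K (self_mod K) {()} (\<lambda>_. \<one>\<^bsub>K\<^esub>) (\<lambda>_ a. a)"
proof -
  assume K: "cring K"
  then interpret cring K .
  have "carrier K \<subseteq> H" if "submodule H K (self_mod K)" "\<one>\<^bsub>K\<^esub> \<in> H" for H
    using submodule_smult[OF that(1) _ that(2)] by (auto simp: self_mod_def)
  then have "submod_span K (self_mod K) {\<one>\<^bsub>K\<^esub>} = carrier K"
    using submodule_carrier[OF module_self[OF K]] by (auto simp: submod_span_def)
  then show ?thesis using module_self[OF K] lin_map_id by (auto simp: mbasis_def)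
qed

lemma mbasis_dsum:
  assumes K: "cring K" and B: "\<And>i. i \<in> I \<Longrightarrow> mbasis K (V i) (J i) (e i) (\<chi> i)"
  shows "mbasis K (dsum_mod I V) (SIGMA i:I. J i) (\<lambda>(i, j). dsum_single I V i (e i j))
    (\<lambda>(i, j) f. \<chi> i j (f i))"
proof -
  note B' = mbasisD[OF B]
  have V: "module K (V i)" if "i \<in> I" for i using B'(1) that .
  note sm = module_self[OF K]
  note sc = dsum_single_carrier[of I K V, OF V]
  have im: "(\<lambda>(i, j). dsum_single I V i (e i j)) ` (SIGMA i:I. J i)
      = (\<Union>i\<in>I. dsum_single I V i ` (e i ` J i))" by auto
  have "submod_span K (dsum_mod I V) ((\<lambda>(i, j). dsum_single I V i (e i j)) ` (SIGMA i:I. J i))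
      = carrier (dsum_mod I V)"
    unfolding im by (rule span_dsum[OF K]) (use V B'(2,3) in auto)
  moreover have "lin_map K (dsum_mod I V) (self_mod K) (\<lambda>f. \<chi> i j (f i))" if "i \<in> I" "j \<in> J i" for i j
    by (rule lin_map_comp[where f = "\<lambda>f. f i" and g = "\<chi> i j",
        OF lin_map_dsum_eval[where V = V, OF that(1)] B'(4)[OF that]])
  moreover have "\<chi> i j (dsum_single I V k (e k l) i) = (if (k, l) = (i, j) then \<one>\<^bsub>K\<^esub> else \<zero>\<^bsub>K\<^esub>)"
    if "i \<in> I" "j \<in> J i" "k \<in> I" "l \<in> J k" for i j k l
    using B'(5)[of i j l] that lin_map_zero[OF V sm B'(4)] by (auto simp: dsum_single_def)
  ultimately show ?thesis
    using module_dsum[of K I V, OF K V] sc B'(2) by (auto simp: mbasis_def)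
qed

lemma mbasis_free:
  assumes K: "cring K"
  shows "mbasis K (free_mod K X) X (\<lambda>x. dsum_single X (\<lambda>_. self_mod K) x \<one>\<^bsub>K\<^esub>) (\<lambda>x f. f x)"
proof -
  have "bij_betw (\<lambda>x. (x, ())) X (SIGMA x:X. {()})" by (auto simp: bij_betw_def inj_on_def)
  from mbasis_reindex[OF mbasis_dsum[where I = X and V = "\<lambda>_. self_mod K", OF K mbasis_self[OF K]] this]
  show ?thesis unfolding free_mod_def by simp
qed

lemma free_map:
  assumes K: "cring K" and h: "\<And>x. x \<in> X \<Longrightarrow> h x \<in> Y"
  shows lin_map_free_map: "lin_map K (free_mod K X) (free_mod K Y) (free_map K X Y h)"
    and free_map_single: "\<And>x. x \<in> X \<Longrightarrow> free_map K X Y h (dsum_single X (\<lambda>_. self_mod K) x \<one>\<^bsub>K\<^esub>)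
      = dsum_single Y (\<lambda>_. self_mod K) (h x) \<one>\<^bsub>K\<^esub>"
proof -
  interpret cring K by (rule K)
  note sm = module_self[OF K]
  show "lin_map K (free_mod K X) (free_mod K Y) (free_map K X Y h)"
    unfolding free_mod_def free_map_def by (rule lin_map_dsum_push[OF K]) (use sm h in auto)
  show "free_map K X Y h (dsum_single X (\<lambda>_. self_mod K) x \<one>\<^bsub>K\<^esub>)
      = dsum_single Y (\<lambda>_. self_mod K) (h x) \<one>\<^bsub>K\<^esub>" if "x \<in> X" for x
    unfolding free_map_def by (rule dsum_push_single[OF K]) (use sm h that in auto)
qed

lemma module_free: "cring K \<Longrightarrow> module K (free_mod K X)"
  using mbasis_module[OF mbasis_free] .

lemma free_map_comp:
  assumes K: "cring K" and h: "\<And>x. x \<in> X \<Longrightarrow> h x \<in> Y" and g: "\<And>y. y \<in> Y \<Longrightarrow> g y \<in> Z"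
    and k: "\<And>x. x \<in> X \<Longrightarrow> k x = g (h x)" and x: "x \<in> carrier (free_mod K X)"
  shows "free_map K X Z k x = free_map K Y Z g (free_map K X Y h x)"
proof (rule mbasis_ext[OF mbasis_free[OF K] module_free[OF K] _ _ _ x])
  show "lin_map K (free_mod K X) (free_mod K Z) (free_map K X Z k)"
    using h g k by (intro lin_map_free_map[OF K]) auto
  show "lin_map K (free_mod K X) (free_mod K Z) (\<lambda>x. free_map K Y Z g (free_map K X Y h x))"
    by (rule lin_map_comp[OF lin_map_free_map[OF K h] lin_map_free_map[OF K g]])
  show "free_map K X Z k (dsum_single X (\<lambda>_. self_mod K) j \<one>\<^bsub>K\<^esub>) =
      free_map K Y Z g (free_map K X Y h (dsum_single X (\<lambda>_. self_mod K) j \<one>\<^bsub>K\<^esub>))" if "j \<in> X" for j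
    using free_map_single[OF K h that] free_map_single[of K Y g Z "h j", OF K g h[OF that]]
      free_map_single[of K X k Z j, OF K _ that] h g k that by auto
qed

lemma free_map_ident:
  assumes K: "cring K" and h: "\<And>x. x \<in> X \<Longrightarrow> h x = x" and x: "x \<in> carrier (free_mod K X)"
  shows "free_map K X X h x = x"
proof (rule mbasis_ext[OF mbasis_free[OF K] module_free[OF K] _ lin_map_id _ x])
  show "lin_map K (free_mod K X) (free_mod K X) (free_map K X X h)"
    using h by (intro lin_map_free_map[OF K]) auto
  show "free_map K X X h (dsum_single X (\<lambda>_. self_mod K) j \<one>\<^bsub>K\<^esub>) = dsum_single X (\<lambda>_. self_mod K) j \<one>\<^bsub>K\<^esub>"
    if "j \<in> X" for j
    using free_map_single[of K X h X, OF K _ that] h that by auto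
qed

section \<open>Finitely spanned vector spaces\<close>

definition finitely_spanned :: "('k, 'z) ring_scheme \<Rightarrow> ('k, 'v) module \<Rightarrow> bool" where
  "finitely_spanned K V \<longleftrightarrow>
     (\<exists>S. finite S \<and> S \<subseteq> carrier V \<and> submod_span K V S = carrier V)"

lemma span_insertD:
  assumes V: "module K V" and S: "S \<subseteq> carrier V" and s: "s \<in> carrier V"
    and x: "x \<in> submod_span K V (insert s S)"
  shows "\<exists>a\<in>carrier K. x \<ominus>\<^bsub>V\<^esub> a \<odot>\<^bsub>V\<^esub> s \<in> submod_span K V S"
proof -
  interpret V: module K V by fact
  let ?S = "submod_span K V S"
  note sub = submodule_span[OF V S]
  note D = submoduleD[OF sub]
  let ?H = "{x \<in> carrier V. \<exists>a\<in>carrier K. x \<ominus>\<^bsub>V\<^esub> a \<odot>\<^bsub>V\<^esub> s \<in> ?S}"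
  have "submodule ?H K V"
  proof (rule submoduleI'[OF V])
    show "\<zero>\<^bsub>V\<^esub> \<in> ?H" using s D(2) by (auto intro!: bexI[of _ "\<zero>\<^bsub>K\<^esub>"] simp: a_minus_def module_neg[OF V])
    show "x \<oplus>\<^bsub>V\<^esub> y \<in> ?H" if xy: "x \<in> ?H" "y \<in> ?H" for x y
    proof -
      obtain a b where ab: "a \<in> carrier K" "b \<in> carrier K" "x \<ominus>\<^bsub>V\<^esub> a \<odot>\<^bsub>V\<^esub> s \<in> ?S" "y \<ominus>\<^bsub>V\<^esub> b \<odot>\<^bsub>V\<^esub> s \<in> ?S"
        using xy by blast
      have "(x \<oplus>\<^bsub>V\<^esub> y) \<ominus>\<^bsub>V\<^esub> (a \<oplus>\<^bsub>K\<^esub> b) \<odot>\<^bsub>V\<^esub> s = (x \<ominus>\<^bsub>V\<^esub> a \<odot>\<^bsub>V\<^esub> s) \<oplus>\<^bsub>V\<^esub> (y \<ominus>\<^bsub>V\<^esub> b \<odot>\<^bsub>V\<^esub> s)"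
        using xy ab s by (simp add: a_minus_def V.smult_l_distr V.minus_add V.a_ac)
      then show ?thesis using D(3)[OF ab(3,4)] ab xy by (auto intro!: bexI[of _ "a \<oplus>\<^bsub>K\<^esub> b"])
    qed
    show "c \<odot>\<^bsub>V\<^esub> x \<in> ?H" if cx: "c \<in> carrier K" "x \<in> ?H" for c x
    proof -
      obtain a where a: "a \<in> carrier K" "x \<ominus>\<^bsub>V\<^esub> a \<odot>\<^bsub>V\<^esub> s \<in> ?S" using cx by blast
      have "c \<odot>\<^bsub>V\<^esub> x \<ominus>\<^bsub>V\<^esub> (c \<otimes>\<^bsub>K\<^esub> a) \<odot>\<^bsub>V\<^esub> s = c \<odot>\<^bsub>V\<^esub> (x \<ominus>\<^bsub>V\<^esub> a \<odot>\<^bsub>V\<^esub> s)"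
        using cx a s by (simp add: a_minus_def V.smult_r_distr V.smult_assoc1 V.smult_r_minus)
      then show ?thesis using D(4)[OF cx(1) a(2)] a cx by (auto intro!: bexI[of _ "c \<otimes>\<^bsub>K\<^esub> a"])
    qed
  qed auto
  moreover have "insert s S \<subseteq> ?H"
  proof -
    have "s \<in> ?H" using s D(2) by (auto intro!: bexI[of _ "\<one>\<^bsub>K\<^esub>"] simp: a_minus_def V.r_neg)
    moreover have "t \<in> ?H" if "t \<in> S" for t
      using that S s span_superset[of S K V]
      by (auto intro!: bexI[of _ "\<zero>\<^bsub>K\<^esub>"] simp: a_minus_def module_neg[OF V] subset_iff)
    ultimately show ?thesis by blast
  qed
  ultimately have "x \<in> ?H" using span_minimal x by blast
  then show ?thesis by blast
qed

text \<open>Gaussian elimination: if some element of the subspace involves the last generator, it can be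
  used to clear that generator from all others.\<close>

lemma finitely_spanned_submodule:
  assumes K: "field K" and V: "module K V" and fs: "finitely_spanned K V" and H: "submodule H K V"
  shows "finitely_spanned K (V\<lparr>carrier := H\<rparr>)"
proof -
  interpret K: field K by fact
  interpret V: module K V by fact
  have "\<exists>T. finite T \<and> T \<subseteq> H \<and> H \<subseteq> submod_span K V T"
    if "finite S" "S \<subseteq> carrier V" "submodule H K V" "H \<subseteq> submod_span K V S" for S H
    using that
  proof (induction S arbitrary: H)
    case empty
    then show ?case by (intro exI[of _ "{}"]) auto
  next
    case (insert s S)
    let ?S = "submod_span K V S"
    have S: "S \<subseteq> carrier V" and s: "s \<in> carrier V" using insert.prems by auto
    note HD = submoduleD[OF insert.prems(2)] and subS = submodule_span[OF V S]
    have "submodule (H \<inter> ?S) K V" by (rule submodule_Int[OF V insert.prems(2) subS])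
    then obtain T where T: "finite T" "T \<subseteq> H \<inter> ?S" "H \<inter> ?S \<subseteq> submod_span K V T"
      using insert.IH[OF S] by blast
    show ?case
    proof (cases "H \<subseteq> ?S")
      case True
      then show ?thesis using T by (intro exI[of _ T]) auto
    next
      case False
      then obtain h where h: "h \<in> H" "h \<notin> ?S" by auto
      obtain a where a: "a \<in> carrier K" "h \<ominus>\<^bsub>V\<^esub> a \<odot>\<^bsub>V\<^esub> s \<in> ?S"
        using span_insertD[OF V S s] h insert.prems(3) by blast
      have hc: "h \<in> carrier V" using h HD by auto
      have "a \<noteq> \<zero>\<^bsub>K\<^esub>"
      proof
        assume "a = \<zero>\<^bsub>K\<^esub>"
        then have "h \<ominus>\<^bsub>V\<^esub> a \<odot>\<^bsub>V\<^esub> s = h" using s hc by (simp add: a_minus_def)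
        then show False using a h by simp
      qed
      then have a_inv: "inv\<^bsub>K\<^esub> a \<in> carrier K" "inv\<^bsub>K\<^esub> a \<otimes>\<^bsub>K\<^esub> a = \<one>\<^bsub>K\<^esub>"
        using a K.field_Units by auto
      have T': "insert h T \<subseteq> H" "insert h T \<subseteq> carrier V" using h T HD by auto
      let ?T = "submod_span K V (insert h T)"
      note D = submoduleD[OF submodule_span[OF V T'(2)]]
      have "x \<in> ?T" if x: "x \<in> H" for x
      proof -
        have xc: "x \<in> carrier V" using x HD by auto
        obtain b where b: "b \<in> carrier K" "x \<ominus>\<^bsub>V\<^esub> b \<odot>\<^bsub>V\<^esub> s \<in> ?S"
          using span_insertD[OF V S s] x insert.prems(3) by blast
        define c where "c = b \<otimes>\<^bsub>K\<^esub> inv\<^bsub>K\<^esub> a"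
        have c: "c \<in> carrier K" "c \<otimes>\<^bsub>K\<^esub> a = b"
          using a_inv a b by (auto simp: c_def K.m_assoc)
        have "x \<ominus>\<^bsub>V\<^esub> c \<odot>\<^bsub>V\<^esub> h = (x \<ominus>\<^bsub>V\<^esub> b \<odot>\<^bsub>V\<^esub> s) \<ominus>\<^bsub>V\<^esub> c \<odot>\<^bsub>V\<^esub> (h \<ominus>\<^bsub>V\<^esub> a \<odot>\<^bsub>V\<^esub> s)"
          using xc hc s a b c
          by (simp add: a_minus_def V.smult_r_distr V.smult_r_minus V.smult_assoc1[symmetric]
              V.minus_add V.minus_minus V.a_ac V.r_neg V.r_neg1 V.r_neg2)
        moreover have "\<dots> \<in> ?S"
          using submodule_minus[OF V subS] b a c submodule_smult[OF subS] by auto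
        moreover have "x \<ominus>\<^bsub>V\<^esub> c \<odot>\<^bsub>V\<^esub> h \<in> H"
          using submodule_minus[OF V insert.prems(2) x HD(4)[OF c(1) h(1)]] .
        ultimately have "x \<ominus>\<^bsub>V\<^esub> c \<odot>\<^bsub>V\<^esub> h \<in> submod_span K V T" using T(3) by auto
        then have 1: "x \<ominus>\<^bsub>V\<^esub> c \<odot>\<^bsub>V\<^esub> h \<in> ?T" using span_mono[of T "insert h T"] by blast
        have 2: "c \<odot>\<^bsub>V\<^esub> h \<in> ?T" using span_superset[of "insert h T" K V] c D(4) by auto
        have "(x \<ominus>\<^bsub>V\<^esub> c \<odot>\<^bsub>V\<^esub> h) \<oplus>\<^bsub>V\<^esub> c \<odot>\<^bsub>V\<^esub> h = x"
          using xc hc c by (simp add: a_minus_def V.a_assoc V.l_neg)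
        then show ?thesis using D(3)[OF 1 2] by simp
      qed
      then show ?thesis using T' T(1) by (intro exI[of _ "insert h T"]) auto
    qed
  qed
  then obtain T where T: "finite T" "T \<subseteq> H" "H \<subseteq> submod_span K V T"
    using fs H submodule_subset[OF H] unfolding finitely_spanned_def by (metis (no_types, lifting))
  have "H \<subseteq> H'" if H': "submodule H' K (V\<lparr>carrier := H\<rparr>)" "T \<subseteq> H'" for H'
  proof -
    have "submodule H' K V"
      using H'(1) submodule_subset[OF H'(1)] by (subst submodule_of_submodule[OF V H, symmetric]) auto
    then show ?thesis using T(3) span_minimal H'(2) by blast
  qed
  then have "H \<subseteq> submod_span K (V\<lparr>carrier := H\<rparr>) T" by (auto simp: submod_span_def)
  moreover have "submod_span K (V\<lparr>carrier := H\<rparr>) T \<subseteq> H"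
    using submodule_subset[OF submodule_span[OF module_submodule[OF V H], of T]] T(2) by simp
  ultimately show ?thesis using T by (auto simp: finitely_spanned_def)
qed

lemma finitely_spanned_mbasis:
  assumes "mbasis K V J e \<chi>" "finite J" shows "finitely_spanned K V"
  using mbasis_span[OF assms(1)] mbasis_elt[OF assms(1)] assms(2)
  by (auto simp: finitely_spanned_def intro!: exI[of _ "e ` J"])

text \<open>Such an \<open>S\<close> represents a basis of \<open>V\<close> modulo the span of \<open>H\<close>.  One of least cardinality will do;
  linear independence is expressed as irredundancy.\<close>

lemma exists_relative_basis:
  assumes V: "module K V" and fs: "finitely_spanned K V" and H: "H \<subseteq> carrier V"
  shows "\<exists>S. finite S \<and> S \<subseteq> carrier V \<and> submod_span K V (H \<union> S) = carrier V \<and>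
    (\<forall>s\<in>S. submod_span K V (H \<union> (S - {s})) \<noteq> carrier V)"
proof -
  let ?P = "\<lambda>S. finite S \<and> S \<subseteq> carrier V \<and> submod_span K V (H \<union> S) = carrier V"
  obtain S0 where "finite S0" "S0 \<subseteq> carrier V" "submod_span K V S0 = carrier V"
    using fs by (auto simp: finitely_spanned_def)
  moreover have "submod_span K V (H \<union> S0) \<subseteq> carrier V"
    using submodule_subset[OF submodule_span[OF V]] H calculation by simp
  ultimately have "?P S0" using span_mono[of S0 "H \<union> S0" K V] by auto
  then obtain S where S: "?P S" "\<And>T. ?P T \<Longrightarrow> card S \<le> card T"
    using ex_has_least_nat[of ?P S0 card] by auto
  have "submod_span K V (H \<union> (S - {s})) \<noteq> carrier V" if "s \<in> S" for s
  proof
    assume "submod_span K V (H \<union> (S - {s})) = carrier V"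
    then have "?P (S - {s})" using S(1) by auto
    then have "card S \<le> card (S - {s})" by (rule S(2))
    then show False using S(1) that by (metis card_Diff1_less leD)
  qed
  then show ?thesis using S(1) by blast
qed

section \<open>Modules over a category\<close>

lemma (in category) Hom_objD: "u \<in> Hom C a b \<Longrightarrow> a \<in> Obj C" "u \<in> Hom C a b \<Longrightarrow> b \<in> Obj C"
  using Dom_closed Cod_closed by (auto simp: Hom_def)

lemma Arr_Hom: "u \<in> Arr C \<Longrightarrow> u \<in> Hom C (Dom C u) (Cod C u)"
  by (auto simp: Hom_def)

lemma cmod_module: "is_cmod C K M \<Longrightarrow> c \<in> Obj C \<Longrightarrow> module K (Val M c)"
  and act_lin: "is_cmod C K M \<Longrightarrow> u \<in> Hom C a b \<Longrightarrow> lin_map K (Val M a) (Val M b) (Act M u)"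
  and act_Ide: "is_cmod C K M \<Longrightarrow> c \<in> Obj C \<Longrightarrow> x \<in> carrier (Val M c) \<Longrightarrow> Act M (Ide C c) x = x"
  and act_Comp: "is_cmod C K M \<Longrightarrow> u \<in> Hom C a b \<Longrightarrow> v \<in> Hom C b c \<Longrightarrow> x \<in> carrier (Val M a) \<Longrightarrow>
    Act M (Comp C v u) x = Act M v (Act M u x)"
  by (auto simp: is_cmod_def Hom_def)

lemma act_closed:
  "is_cmod C K M \<Longrightarrow> u \<in> Hom C a b \<Longrightarrow> x \<in> carrier (Val M a) \<Longrightarrow> Act M u x \<in> carrier (Val M b)"
  using lin_map_closed[OF act_lin] .

lemma is_cmodI:
  assumes "\<And>c. c \<in> Obj C \<Longrightarrow> module K (Val M c)"
    and "\<And>a b u. u \<in> Hom C a b \<Longrightarrow> lin_map K (Val M a) (Val M b) (Act M u)"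
    and "\<And>c x. c \<in> Obj C \<Longrightarrow> x \<in> carrier (Val M c) \<Longrightarrow> Act M (Ide C c) x = x"
    and "\<And>a b c u v x. u \<in> Hom C a b \<Longrightarrow> v \<in> Hom C b c \<Longrightarrow> x \<in> carrier (Val M a) \<Longrightarrow>
      Act M (Comp C v u) x = Act M v (Act M u x)"
  shows "is_cmod C K M"
  using assms(1,3) assms(2)[OF Arr_Hom] assms(4) unfolding is_cmod_def
  by (auto simp: Hom_def)

lemma hom_lin: "cmod_hom C K M N f \<Longrightarrow> c \<in> Obj C \<Longrightarrow> lin_map K (Val M c) (Val N c) (f c)"
  and hom_nat: "cmod_hom C K M N f \<Longrightarrow> u \<in> Hom C a b \<Longrightarrow> x \<in> carrier (Val M a) \<Longrightarrow>
    f b (Act M u x) = Act N u (f a x)"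
  by (auto simp: cmod_hom_def Hom_def)

lemma hom_closed:
  "cmod_hom C K M N f \<Longrightarrow> c \<in> Obj C \<Longrightarrow> x \<in> carrier (Val M c) \<Longrightarrow> f c x \<in> carrier (Val N c)"
  using lin_map_closed[OF hom_lin] .

lemma cmod_homI:
  assumes "\<And>c. c \<in> Obj C \<Longrightarrow> lin_map K (Val M c) (Val N c) (f c)"
    and "\<And>a b u x. u \<in> Hom C a b \<Longrightarrow> x \<in> carrier (Val M a) \<Longrightarrow> f b (Act M u x) = Act N u (f a x)"
  shows "cmod_hom C K M N f"
  using assms(1) assms(2)[OF Arr_Hom] by (auto simp: cmod_hom_def)

lemma cmod_hom_id: "cmod_hom C K M M (\<lambda>c x. x)"
  by (intro cmod_homI lin_map_id) auto

context category
begin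

lemma cmod_hom_comp:
  assumes "cmod_hom C K L M f" "cmod_hom C K M N g"
  shows "cmod_hom C K L N (\<lambda>c x. g c (f c x))"
proof (rule cmod_homI)
  show "lin_map K (Val L c) (Val N c) (\<lambda>x. g c (f c x))" if "c \<in> Obj C" for c
    by (rule lin_map_comp[OF hom_lin[OF assms(1) that] hom_lin[OF assms(2) that]])
  fix a b u x assume u: "u \<in> Hom C a b" "x \<in> carrier (Val L a)"
  then show "g b (f b (Act L u x)) = Act N u (g a (f a x))"
    using hom_nat[OF assms(1) u] hom_nat[OF assms(2) u(1)] hom_closed[OF assms(1)] Hom_objD(1)[OF u(1)]
    by auto
qed

lemma cmod_epi_comp:
  assumes "cmod_epi C K L M f" "cmod_epi C K M N g"
  shows "cmod_epi C K L N (\<lambda>c x. g c (f c x))"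
proof -
  have "(\<lambda>x. g c (f c x)) ` carrier (Val L c) = g c ` f c ` carrier (Val L c)" for c
    by (simp only: image_image)
  then show ?thesis using assms cmod_hom_comp[of K L M f N g] by (simp add: cmod_epi_def)
qed

lemma cmod_iso_inv:
  assumes M: "is_cmod C K M" and f: "cmod_iso C K M N f"
  obtains g where "cmod_iso C K N M g"
    and "\<And>c x. c \<in> Obj C \<Longrightarrow> x \<in> carrier (Val M c) \<Longrightarrow> g c (f c x) = x"
    and "\<And>c y. c \<in> Obj C \<Longrightarrow> y \<in> carrier (Val N c) \<Longrightarrow> f c (g c y) = y"
proof -
  let ?g = "\<lambda>c. inv_into (carrier (Val M c)) (f c)"
  have hom: "cmod_hom C K M N f" and bij: "\<And>c. c \<in> Obj C \<Longrightarrow> bij_betw (f c) (carrier (Val M c)) (carrier (Val N c))"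
    using f by (auto simp: cmod_iso_def)
  have gf: "?g c (f c x) = x" if "c \<in> Obj C" "x \<in> carrier (Val M c)" for c x
    using bij[OF that(1)] that(2) by (simp add: bij_betw_def)
  have fg: "f c (?g c y) = y" and gc: "?g c y \<in> carrier (Val M c)"
    if "c \<in> Obj C" "y \<in> carrier (Val N c)" for c y
    using bij[OF that(1)] that(2) by (auto simp: bij_betw_def f_inv_into_f inv_into_into)
  have "cmod_hom C K N M ?g"
  proof (rule cmod_homI)
    show "lin_map K (Val N c) (Val M c) (?g c)" if "c \<in> Obj C" for c
      by (rule lin_map_inv[OF cmod_module[OF M that] hom_lin[OF hom that] bij[OF that]])
    fix a b u y assume u: "u \<in> Hom C a b" and y: "y \<in> carrier (Val N a)"
    note ab = Hom_objD[OF u]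
    have "Act N u y = f b (Act M u (?g a y))"
      using hom_nat[OF hom u gc[OF ab(1) y]] fg[OF ab(1) y] by simp
    then show "?g b (Act N u y) = Act M u (?g a y)"
      using gf[OF ab(2) act_closed[OF M u gc[OF ab(1) y]]] by simp
  qed
  moreover have "bij_betw (?g c) (carrier (Val N c)) (carrier (Val M c))" if "c \<in> Obj C" for c
    by (rule bij_betw_inv_into[OF bij[OF that]])
  ultimately show ?thesis using that[of ?g] gf fg by (auto simp: cmod_iso_def)
qed

lemma cmod_isoI:
  assumes f: "cmod_hom C K M N f" and g: "cmod_hom C K N M g"
    and "\<And>c x. c \<in> Obj C \<Longrightarrow> x \<in> carrier (Val M c) \<Longrightarrow> g c (f c x) = x"
    and "\<And>c y. c \<in> Obj C \<Longrightarrow> y \<in> carrier (Val N c) \<Longrightarrow> f c (g c y) = y"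
  shows "cmod_iso C K M N f"
  unfolding cmod_iso_def
proof (intro conjI ballI f)
  fix c assume "c \<in> Obj C"
  then show "bij_betw (f c) (carrier (Val M c)) (carrier (Val N c))"
    using hom_closed[OF f] hom_closed[OF g] assms(3,4)
    by (intro bij_betw_byWitness[where f' = "g c"]) auto
qed

end

text \<open>The carrier alone is replaced, so that \<^const>\<open>cmod_ker\<close> is literally an instance.\<close>

definition sub_cmod :: "('o, 'm, 'k, 'v) cmod \<Rightarrow> ('o \<Rightarrow> 'v set) \<Rightarrow> ('o, 'm, 'k, 'v) cmod" where
  "sub_cmod M H = \<lparr>Val = (\<lambda>c. (Val M c)\<lparr>carrier := H c\<rparr>), Act = Act M\<rparr>"

lemma sub_cmod_simps [simp]:
  "carrier (Val (sub_cmod M H) c) = H c" "\<zero>\<^bsub>Val (sub_cmod M H) c\<^esub> = \<zero>\<^bsub>Val M c\<^esub>"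
  "x \<oplus>\<^bsub>Val (sub_cmod M H) c\<^esub> y = x \<oplus>\<^bsub>Val M c\<^esub> y" "a \<odot>\<^bsub>Val (sub_cmod M H) c\<^esub> x = a \<odot>\<^bsub>Val M c\<^esub> x"
  "Act (sub_cmod M H) = Act M"
  by (auto simp: sub_cmod_def)

lemma cmod_ker_sub: "cmod_ker M N f = sub_cmod M (ker_obj M N f)"
  by (simp add: cmod_ker_def sub_cmod_def)

context category
begin

lemma is_cmod_sub:
  assumes M: "is_cmod C K M" and H: "\<And>c. c \<in> Obj C \<Longrightarrow> submodule (H c) K (Val M c)"
    and act: "\<And>a b u x. u \<in> Hom C a b \<Longrightarrow> x \<in> H a \<Longrightarrow> Act M u x \<in> H b"
  shows "is_cmod C K (sub_cmod M H)"
proof -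
  have sub: "x \<in> carrier (Val M c)" if "c \<in> Obj C" "x \<in> H c" for c x
    using submodule_subset[OF H[OF that(1)]] that(2) by auto
  show ?thesis
  proof (rule is_cmodI)
    show "module K (Val (sub_cmod M H) c)" if "c \<in> Obj C" for c
      using module_submodule[OF cmod_module[OF M that] H[OF that]] by (simp add: sub_cmod_def)
    show "lin_map K (Val (sub_cmod M H) a) (Val (sub_cmod M H) b) (Act (sub_cmod M H) u)"
      if u: "u \<in> Hom C a b" for a b u
      using act[OF u] sub[OF Hom_objD(1)[OF u]] lin_map_add[OF act_lin[OF M u]] lin_map_smult[OF act_lin[OF M u]]
      by (intro lin_mapI) auto
    show "Act (sub_cmod M H) (Ide C c) x = x" if "c \<in> Obj C" "x \<in> carrier (Val (sub_cmod M H) c)" for c x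
      using act_Ide[OF M] sub that by auto
    show "Act (sub_cmod M H) (Comp C v u) x = Act (sub_cmod M H) v (Act (sub_cmod M H) u x)"
      if "u \<in> Hom C a b" "v \<in> Hom C b c" "x \<in> carrier (Val (sub_cmod M H) a)" for a b c u v x
      using act_Comp[OF M that(1,2)] sub[OF Hom_objD(1)[OF that(1)]] that(3) by auto
  qed
qed

lemma sub_cmod_incl:
  assumes "is_cmod C K M" "\<And>c. c \<in> Obj C \<Longrightarrow> submodule (H c) K (Val M c)"
  shows "cmod_hom C K (sub_cmod M H) M (\<lambda>c x. x)"
  using submodule_subset[OF assms(2)] by (intro cmod_homI lin_mapI) auto

lemma submodule_ker:
  assumes "is_cmod C K M" "is_cmod C K N" "cmod_hom C K M N f" "c \<in> Obj C"
  shows "submodule (ker_obj M N f c) K (Val M c)"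
  unfolding ker_obj_def
  by (rule submodule_kernel[OF cmod_module[OF assms(1,4)] cmod_module[OF assms(2,4)] hom_lin[OF assms(3,4)]])

lemma ker_act:
  assumes "is_cmod C K M" "is_cmod C K N" "cmod_hom C K M N f"
    and u: "u \<in> Hom C a b" "x \<in> ker_obj M N f a"
  shows "Act M u x \<in> ker_obj M N f b"
proof -
  note ab = Hom_objD[OF u(1)]
  have "Act N u \<zero>\<^bsub>Val N a\<^esub> = \<zero>\<^bsub>Val N b\<^esub>"
    by (rule lin_map_zero[OF cmod_module[OF assms(2) ab(1)] cmod_module[OF assms(2) ab(2)] act_lin[OF assms(2) u(1)]])
  then show ?thesis
    using u hom_nat[OF assms(3) u(1)] act_closed[OF assms(1) u(1)] by (auto simp: ker_obj_def)
qed

lemma is_cmod_ker: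
  assumes "is_cmod C K M" "is_cmod C K N" "cmod_hom C K M N f"
  shows "is_cmod C K (cmod_ker M N f)"
  unfolding cmod_ker_sub using submodule_ker[OF assms] ker_act[OF assms] is_cmod_sub[OF assms(1)] by blast

lemma ker_incl:
  assumes "is_cmod C K M" "is_cmod C K N" "cmod_hom C K M N f"
  shows "cmod_hom C K (cmod_ker M N f) M (\<lambda>c x. x)"
  unfolding cmod_ker_sub using submodule_ker[OF assms] sub_cmod_incl[OF assms(1)] by blast

text \<open>The definition of a superfluous epimorphism tests modules with values in a single type.  Replacing
  a test map by the inclusion of its image extends it to all types, as is necessary for comparing
  resolutions whose terms take values in different types.\<close>

lemma superfluous_epiD:
  fixes L :: "('o, 'm, 'k, 'v) cmod" and M :: "('o, 'm, 'k, 'w) cmod" and L' :: "('o, 'm, 'k, 'u) cmod"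
  assumes L: "is_cmod C K L" and f: "superfluous_epi C K L M f" and L': "is_cmod C K L'"
    and g: "cmod_hom C K L' L g" and fg: "\<And>c y. c \<in> Obj C \<Longrightarrow> y \<in> carrier (Val M c) \<Longrightarrow>
      \<exists>x\<in>carrier (Val L' c). f c (g c x) = y"
  shows "cmod_epi C K L' L g"
proof -
  define H where "H c = g c ` carrier (Val L' c)" for c
  have H: "submodule (H c) K (Val L c)" if "c \<in> Obj C" for c
    unfolding H_def
    by (rule submodule_image[OF cmod_module[OF L' that] cmod_module[OF L that] hom_lin[OF g that]
          submodule_carrier[OF cmod_module[OF L' that]]])
  have act: "Act L u x \<in> H b" if "u \<in> Hom C a b" "x \<in> H a" for a b u x
    using that hom_nat[OF g that(1), symmetric] act_closed[OF L' that(1)] by (auto simp: H_def)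
  note I = is_cmod_sub[OF L H act] and i = sub_cmod_incl[OF L H]
  have fhom: "cmod_hom C K L M f" using f by (auto simp: superfluous_epi_def cmod_epi_def)
  have fH: "f c ` H c = carrier (Val M c)" if c: "c \<in> Obj C" for c
  proof
    show "f c ` H c \<subseteq> carrier (Val M c)"
      using submodule_subset[OF H[OF c]] hom_closed[OF fhom c] by blast
    show "carrier (Val M c) \<subseteq> f c ` H c"
      using fg[OF c] by (force simp: H_def)
  qed
  have "cmod_epi C K (sub_cmod L H) M (cmod_comp f (\<lambda>c x. x))"
    using cmod_hom_comp[OF i fhom] fH by (auto simp: cmod_epi_def cmod_comp_def comp_def)
  then have "cmod_epi C K (sub_cmod L H) L (\<lambda>c x. x)"
    using f I i by (auto simp: superfluous_epi_def)
  then have "H c = carrier (Val L c)" if "c \<in> Obj C" for c using that by (auto simp: cmod_epi_def)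
  then show ?thesis using g by (auto simp: cmod_epi_def H_def)
qed

lemma superfluous_epiI:
  fixes L :: "('o, 'm, 'k, 'v) cmod" and M :: "('o, 'm, 'k, 'w) cmod"
  assumes f: "cmod_epi C K L M f"
    and "\<And>(L' :: ('o, 'm, 'k, 'v) cmod) g. is_cmod C K L' \<Longrightarrow> cmod_hom C K L' L g \<Longrightarrow>
      (\<And>c y. c \<in> Obj C \<Longrightarrow> y \<in> carrier (Val M c) \<Longrightarrow> \<exists>x\<in>carrier (Val L' c). f c (g c x) = y) \<Longrightarrow>
      cmod_epi C K L' L g"
  shows "superfluous_epi C K L M f"
  unfolding superfluous_epi_def
proof (intro conjI allI impI f)
  fix L' :: "('o, 'm, 'k, 'v) cmod" and g assume L': "is_cmod C K L' \<and> cmod_hom C K L' L g"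
  show "cmod_epi C K L' L g = cmod_epi C K L' M (cmod_comp f g)"
  proof
    assume "cmod_epi C K L' L g"
    from cmod_epi_comp[OF this f] show "cmod_epi C K L' M (cmod_comp f g)"
      by (simp add: cmod_comp_def comp_def)
  next
    assume fg: "cmod_epi C K L' M (cmod_comp f g)"
    show "cmod_epi C K L' L g"
    proof (rule assms(2))
      fix c y assume "c \<in> Obj C" "y \<in> carrier (Val M c)"
      then have "y \<in> cmod_comp f g c ` carrier (Val L' c)" using fg by (auto simp: cmod_epi_def)
      then show "\<exists>x\<in>carrier (Val L' c). f c (g c x) = y" by (auto simp: cmod_comp_def)
    qed (use L' in auto)
  qed
qed

end

section \<open>Free modules and their bases\<close>

text \<open>A basis of \<open>P\<close> consists of elements \<open>e j\<close> of \<open>P (b j)\<close> such that for every object \<open>c\<close> the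
  elements \<open>P w (e j)\<close>, \<open>w : b j \<rightarrow> c\<close>, form a basis of \<open>P c\<close>; \<open>\<chi> c (j, w)\<close> is the coordinate
  at \<open>P w (e j)\<close>.\<close>

definition cbasis ::
  "('o, 'm) cat \<Rightarrow> ('k, 'z) ring_scheme \<Rightarrow> ('o, 'm, 'k, 'v) cmod \<Rightarrow> 'i set \<Rightarrow> ('i \<Rightarrow> 'o) \<Rightarrow> ('i \<Rightarrow> 'v)
     \<Rightarrow> ('o \<Rightarrow> 'i \<times> 'm \<Rightarrow> 'v \<Rightarrow> 'k) \<Rightarrow> bool" where
  "cbasis C K P I b e \<chi> \<longleftrightarrow> is_cmod C K P \<and>
     (\<forall>j\<in>I. b j \<in> Obj C \<and> e j \<in> carrier (Val P (b j))) \<and>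
     (\<forall>c\<in>Obj C. mbasis K (Val P c) (SIGMA j:I. Hom C (b j) c) (\<lambda>(j, w). Act P w (e j)) (\<chi> c))"

lemma cbasisD:
  assumes "cbasis C K P I b e \<chi>"
  shows cbasis_cmod: "is_cmod C K P"
    and cbasis_obj: "\<And>j. j \<in> I \<Longrightarrow> b j \<in> Obj C"
    and cbasis_elt: "\<And>j. j \<in> I \<Longrightarrow> e j \<in> carrier (Val P (b j))"
    and cbasis_mbasis: "\<And>c. c \<in> Obj C \<Longrightarrow>
      mbasis K (Val P c) (SIGMA j:I. Hom C (b j) c) (\<lambda>(j, w). Act P w (e j)) (\<chi> c)"
  using assms by (auto simp: cbasis_def)

lemma cbasis_dual:
  assumes "cbasis C K P I b e \<chi>" "c \<in> Obj C" "j \<in> I" "w \<in> Hom C (b j) c" "k \<in> I" "v \<in> Hom C (b k) c"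
  shows "\<chi> c (j, w) (Act P v (e k)) = (if k = j \<and> v = w then \<one>\<^bsub>K\<^esub> else \<zero>\<^bsub>K\<^esub>)"
  using mbasis_dual[OF cbasis_mbasis[OF assms(1,2)], of "(j, w)" "(k, v)"] assms(3-) by auto

lemma cbasis_coord:
  assumes "cbasis C K P I b e \<chi>" "c \<in> Obj C" "j \<in> I" "w \<in> Hom C (b j) c"
  shows "lin_map K (Val P c) (self_mod K) (\<chi> c (j, w))"
  using mbasis_coord[OF cbasis_mbasis[OF assms(1,2)], of "(j, w)"] assms(3-) by auto

lemma cbasis_reindex:
  assumes B: "cbasis C K P I b e \<chi>" and h: "bij_betw h I' I"
    and b: "\<And>j. j \<in> I' \<Longrightarrow> b' j = b (h j)" and e: "\<And>j. j \<in> I' \<Longrightarrow> e' j = e (h j)"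
  shows "cbasis C K P I' b' e' (\<lambda>c (j, w). \<chi> c (h j, w))"
proof -
  note B' = cbasisD[OF B]
  have hI: "h j \<in> I" if "j \<in> I'" for j using h that by (auto simp: bij_betw_def)
  have "mbasis K (Val P c) (SIGMA j:I'. Hom C (b' j) c) (\<lambda>(j, w). Act P w (e' j)) (\<lambda>(j, w). \<chi> c (h j, w))"
    if c: "c \<in> Obj C" for c
  proof (rule mbasis_reindex[OF B'(4)[OF c]])
    show "bij_betw (\<lambda>(j, w). (h j, w)) (SIGMA j:I'. Hom C (b' j) c) (SIGMA j:I. Hom C (b j) c)"
    proof (rule bij_betw_byWitness[where f' = "\<lambda>(j, w). (inv_into I' h j, w)"])
    qed (use h b in \<open>auto simp: bij_betw_def inv_into_into f_inv_into_f\<close>)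
  qed (use e in auto)
  then show ?thesis using B' hI b e by (auto simp: cbasis_def)
qed

context category
begin

text \<open>Basis elements generate: every \<open>P c\<close> is spanned by their images, on which a homomorphism is
  determined by naturality.\<close>

lemma cbasis_hom_ext:
  assumes B: "cbasis C K P I b e \<chi>" and M: "is_cmod C K M"
    and f: "cmod_hom C K P M f" and g: "cmod_hom C K P M g"
    and eq: "\<And>j. j \<in> I \<Longrightarrow> f (b j) (e j) = g (b j) (e j)"
    and c: "c \<in> Obj C" and x: "x \<in> carrier (Val P c)"
  shows "f c x = g c x"
proof (rule mbasis_ext[OF cbasis_mbasis[OF B c] cmod_module[OF M c] hom_lin[OF f c] hom_lin[OF g c] _ x])
  show "f c (case p of (j, w) \<Rightarrow> Act P w (e j)) = g c (case p of (j, w) \<Rightarrow> Act P w (e j))"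
    if p: "p \<in> (SIGMA j:I. Hom C (b j) c)" for p
  proof -
    obtain j w where jw: "p = (j, w)" "j \<in> I" "w \<in> Hom C (b j) c" using p by auto
    show ?thesis
      using hom_nat[OF f jw(3) cbasis_elt[OF B jw(2)]] hom_nat[OF g jw(3) cbasis_elt[OF B jw(2)]]
        eq[OF jw(2)] jw(1) by simp
  qed
qed

text \<open>Each component is defined on the basis of \<open>P c\<close>; naturality need only be checked on basis elements,
  where it is functoriality of \<open>M\<close>.\<close>

lemma cbasis_lift:
  assumes B: "cbasis C K P I b e \<chi>" and M: "is_cmod C K M"
    and m: "\<And>j. j \<in> I \<Longrightarrow> m j \<in> carrier (Val M (b j))"
  shows "\<exists>F. cmod_hom C K P M F \<and> (\<forall>j\<in>I. F (b j) (e j) = m j)"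
proof -
  note B' = cbasisD[OF B]
  let ?J = "\<lambda>c. SIGMA j:I. Hom C (b j) c"
  have "\<exists>F. lin_map K (Val P c) (Val M c) F \<and> (\<forall>p\<in>?J c. F (case p of (j, w) \<Rightarrow> Act P w (e j)) =
      (case p of (j, w) \<Rightarrow> Act M w (m j)))" if c: "c \<in> Obj C" for c
    by (rule mbasis_lift[OF B'(4)[OF c] cmod_module[OF M c]])
      (use act_closed[OF M] m in auto)
  then obtain F where F: "\<And>c. c \<in> Obj C \<Longrightarrow> lin_map K (Val P c) (Val M c) (F c)"
    and Fe: "\<And>c j w. c \<in> Obj C \<Longrightarrow> j \<in> I \<Longrightarrow> w \<in> Hom C (b j) c \<Longrightarrow> F c (Act P w (e j)) = Act M w (m j)"
    by (simp add: Ball_def) metis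
  have "cmod_hom C K P M F"
  proof (rule cmod_homI[OF F])
    fix a d u x assume u: "u \<in> Hom C a d" and x: "x \<in> carrier (Val P a)"
    note ad = Hom_objD[OF u]
    show "F d (Act P u x) = Act M u (F a x)"
    proof (rule mbasis_ext[OF B'(4)[OF ad(1)] cmod_module[OF M ad(2)] _ _ _ x])
      show "lin_map K (Val P a) (Val M d) (\<lambda>x. F d (Act P u x))"
        by (rule lin_map_comp[OF act_lin[OF B'(1) u] F[OF ad(2)]])
      show "lin_map K (Val P a) (Val M d) (\<lambda>x. Act M u (F a x))"
        by (rule lin_map_comp[OF F[OF ad(1)] act_lin[OF M u]])
      fix p assume "p \<in> ?J a"
      then obtain j w where jw: "p = (j, w)" "j \<in> I" "w \<in> Hom C (b j) a" by auto
      have "F d (Act P u (Act P w (e j))) = F d (Act P (Comp C u w) (e j))"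
        using act_Comp[OF B'(1) jw(3) u B'(3)[OF jw(2)]] by simp
      also have "\<dots> = Act M (Comp C u w) (m j)"
        using Fe[OF ad(2) jw(2)] Comp_in_Hom[OF jw(3) u] by blast
      also have "\<dots> = Act M u (Act M w (m j))" by (rule act_Comp[OF M jw(3) u m[OF jw(2)]])
      also have "\<dots> = Act M u (F a (Act P w (e j)))" using Fe[OF ad(1) jw(2,3)] by simp
      finally show "F d (Act P u (case p of (j, w) \<Rightarrow> Act P w (e j))) =
          Act M u (F a (case p of (j, w) \<Rightarrow> Act P w (e j)))" using jw(1) by simp
    qed
  qed auto
  moreover have "F (b j) (e j) = m j" if j: "j \<in> I" for j
    using Fe[OF B'(2)[OF j] j Ide_in_Hom[OF B'(2)[OF j]]] act_Ide[OF B'(1) B'(2)[OF j] B'(3)[OF j]]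
      act_Ide[OF M B'(2)[OF j] m[OF j]] by simp
  ultimately show ?thesis by blast
qed

lemma cbasis_lift_epi:
  assumes B: "cbasis C K P I b e \<chi>" and M: "is_cmod C K M" and N: "is_cmod C K N"
    and p: "cmod_epi C K M N p" and f: "cmod_hom C K P N f"
  shows "\<exists>g. cmod_hom C K P M g \<and> (\<forall>c\<in>Obj C. \<forall>x\<in>carrier (Val P c). p c (g c x) = f c x)"
proof -
  have phom: "cmod_hom C K M N p" using p by (simp add: cmod_epi_def)
  have "\<exists>m\<in>carrier (Val M (b j)). p (b j) m = f (b j) (e j)" if j: "j \<in> I" for j
  proof -
    have "f (b j) (e j) \<in> p (b j) ` carrier (Val M (b j))"
      using p hom_closed[OF f] cbasisD[OF B] j by (auto simp: cmod_epi_def)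
    then show ?thesis by force
  qed
  then obtain m where m: "\<And>j. j \<in> I \<Longrightarrow> m j \<in> carrier (Val M (b j))"
    "\<And>j. j \<in> I \<Longrightarrow> p (b j) (m j) = f (b j) (e j)" by metis
  obtain g where g: "cmod_hom C K P M g" "\<forall>j\<in>I. g (b j) (e j) = m j"
    using cbasis_lift[where m = m, OF B M m(1)] by blast
  have "p c (g c x) = f c x" if "c \<in> Obj C" "x \<in> carrier (Val P c)" for c x
    by (rule cbasis_hom_ext[OF B N cmod_hom_comp[OF g(1) phom] f _ that]) (use g(2) m(2) in auto)
  then show ?thesis using g(1) by blast
qed

lemma cbasis_iso:
  assumes B: "cbasis C K P I b e \<chi>" and M: "is_cmod C K M" and f: "cmod_iso C K P M f"
  shows "cbasis C K M I b (\<lambda>j. f (b j) (e j)) (\<lambda>c j y. \<chi> c j (inv_into (carrier (Val P c)) (f c) y))"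
proof -
  note B' = cbasisD[OF B]
  have hom: "cmod_hom C K P M f" using f by (simp add: cmod_iso_def)
  have "mbasis K (Val M c) (SIGMA j:I. Hom C (b j) c) (\<lambda>(j, w). Act M w (f (b j) (e j)))
      (\<lambda>j y. \<chi> c j (inv_into (carrier (Val P c)) (f c) y))" if c: "c \<in> Obj C" for c
  proof (rule mbasis_reindex[OF mbasis_iso[OF B'(4)[OF c] cmod_module[OF M c] hom_lin[OF hom c]], where h = "\<lambda>x. x"])
    show "bij_betw (f c) (carrier (Val P c)) (carrier (Val M c))" using f c by (simp add: cmod_iso_def)
    show "bij_betw (\<lambda>x. x) (SIGMA j:I. Hom C (b j) c) (SIGMA j:I. Hom C (b j) c)"
      by (simp add: bij_betw_def)
    show "(case j of (j, w) \<Rightarrow> Act M w (f (b j) (e j))) = f c (case j of (j, w) \<Rightarrow> Act P w (e j))"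
      if "j \<in> (SIGMA j:I. Hom C (b j) c)" for j
      using that hom_nat[OF hom _ B'(3)] by auto
  qed simp
  then show ?thesis using B' M hom_closed[OF hom] by (auto simp: cbasis_def)
qed

end

lemma lin_map_dsum_map:
  assumes V: "\<And>i. i \<in> I \<Longrightarrow> module K (V i)" and W: "\<And>i. i \<in> I \<Longrightarrow> module K (W i)"
    and f: "\<And>i. i \<in> I \<Longrightarrow> lin_map K (V i) (W i) (f i)"
  shows "lin_map K (dsum_mod I V) (dsum_mod I W) (\<lambda>x. \<lambda>i\<in>I. f i (x i))"
    and "\<And>i x. i \<in> I \<Longrightarrow> x \<in> carrier (V i) \<Longrightarrow>
      (\<lambda>k\<in>I. f k (dsum_single I V i x k)) = dsum_single I W i (f i x)"
proof -
  have f0: "f i \<zero>\<^bsub>V i\<^esub> = \<zero>\<^bsub>W i\<^esub>" if "i \<in> I" for i by (rule lin_map_zero[OF V[OF that] W[OF that] f[OF that]])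
  show "lin_map K (dsum_mod I V) (dsum_mod I W) (\<lambda>x. \<lambda>i\<in>I. f i (x i))"
  proof (rule lin_mapI)
    fix x assume x: "x \<in> carrier (dsum_mod I V)"
    have "finite {i \<in> I. f i (x i) \<noteq> \<zero>\<^bsub>W i\<^esub>}"
      by (rule finite_subset[of _ "{i \<in> I. x i \<noteq> \<zero>\<^bsub>V i\<^esub>}"]) (use x f0 in \<open>auto simp: dsum_simps\<close>)
    moreover have "f i (x i) \<in> carrier (W i)" if "i \<in> I" for i
      using lin_map_closed[OF f[OF that]] x that by (auto simp: dsum_simps)
    ultimately show "(\<lambda>i\<in>I. f i (x i)) \<in> carrier (dsum_mod I W)"
      by (auto simp: dsum_simps cong: conj_cong)
  next
    fix x y assume "x \<in> carrier (dsum_mod I V)" "y \<in> carrier (dsum_mod I V)"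
    then show "(\<lambda>i\<in>I. f i ((x \<oplus>\<^bsub>dsum_mod I V\<^esub> y) i)) =
        (\<lambda>i\<in>I. f i (x i)) \<oplus>\<^bsub>dsum_mod I W\<^esub> (\<lambda>i\<in>I. f i (y i))"
      using lin_map_add[OF f] by (auto simp: dsum_simps restrict_def fun_eq_iff PiE_iff)
  next
    fix a x assume "a \<in> carrier K" "x \<in> carrier (dsum_mod I V)"
    then show "(\<lambda>i\<in>I. f i ((a \<odot>\<^bsub>dsum_mod I V\<^esub> x) i)) = a \<odot>\<^bsub>dsum_mod I W\<^esub> (\<lambda>i\<in>I. f i (x i))"
      using lin_map_smult[OF f] by (auto simp: dsum_simps restrict_def fun_eq_iff PiE_iff)
  qed
  show "(\<lambda>k\<in>I. f k (dsum_single I V i x k)) = dsum_single I W i (f i x)" for i x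
    using f0 by (auto simp: dsum_single_def restrict_def fun_eq_iff)
qed

context category
begin

lemma is_cmod_dsum:
  assumes K: "cring K" and M: "\<And>i. i \<in> I \<Longrightarrow> is_cmod C K (M i)"
  shows "is_cmod C K (cmod_dsum C I M)"
proof (rule is_cmodI)
  note mv = cmod_module[OF M]
  show "module K (Val (cmod_dsum C I M) c)" if "c \<in> Obj C" for c
    using module_dsum[OF K mv] that by (simp add: cmod_dsum_def)
  show "lin_map K (Val (cmod_dsum C I M) a) (Val (cmod_dsum C I M) b) (Act (cmod_dsum C I M) u)"
    if u: "u \<in> Hom C a b" for a b u
    unfolding cmod_dsum_def cmod.simps
    by (rule lin_map_dsum_map(1)) (use mv Hom_objD[OF u] act_lin[OF M u] in auto)
  show "Act (cmod_dsum C I M) (Ide C c) x = x"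
    if "c \<in> Obj C" "x \<in> carrier (Val (cmod_dsum C I M) c)" for c x
    using that act_Ide[OF M that(1)]
    by (auto simp: cmod_dsum_def dsum_simps PiE_iff extensional_def restrict_def fun_eq_iff)
  show "Act (cmod_dsum C I M) (Comp C v u) x = Act (cmod_dsum C I M) v (Act (cmod_dsum C I M) u x)"
    if "u \<in> Hom C a b" "v \<in> Hom C b c" "x \<in> carrier (Val (cmod_dsum C I M) a)" for a b c u v x
    using that(3) act_Comp[OF M that(1,2)]
    by (auto simp: cmod_dsum_def dsum_simps PiE_iff restrict_def fun_eq_iff)
qed

lemma is_cmod_rep:
  assumes K: "cring K" and c: "c \<in> Obj C" shows "is_cmod C K (rep_mod C K c)"
proof (rule is_cmodI)
  show "module K (Val (rep_mod C K c) d)" for d by (simp add: rep_mod_def module_free[OF K])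
  show "lin_map K (Val (rep_mod C K c) a) (Val (rep_mod C K c) b) (Act (rep_mod C K c) u)"
    if u: "u \<in> Hom C a b" for a b u
    using lin_map_free_map[OF K, of "Hom C c a" "\<lambda>v. Comp C u v" "Hom C c b"] Comp_in_Hom u
    by (auto simp: rep_mod_def Hom_def)
  show "Act (rep_mod C K c) (Ide C d) x = x" if "d \<in> Obj C" "x \<in> carrier (Val (rep_mod C K c) d)" for d x
    using free_map_ident[OF K, of "Hom C c d" "\<lambda>v. Comp C (Ide C d) v" x] Ide_Comp that Ide_in_Hom[OF that(1)]
    by (auto simp: rep_mod_def Hom_def)
  show "Act (rep_mod C K c) (Comp C v u) x = Act (rep_mod C K c) v (Act (rep_mod C K c) u x)"
    if u: "u \<in> Hom C a b" and v: "v \<in> Hom C b d" and x: "x \<in> carrier (Val (rep_mod C K c) a)" for a b d u v x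
  proof -
    have "free_map K (Hom C c a) (Hom C c d) (Comp C (Comp C v u)) x =
      free_map K (Hom C c b) (Hom C c d) (Comp C v) (free_map K (Hom C c a) (Hom C c b) (Comp C u) x)"
      by (rule free_map_comp[OF K])
        (use u v x Comp_in_Hom Comp_assoc[symmetric] in \<open>auto simp: rep_mod_def\<close>)
    then show ?thesis using u v Comp_in_Hom[OF u v] by (auto simp: rep_mod_def Hom_def)
  qed
qed

text \<open>The generators are the identities, placed in their summands; the coordinate at \<open>(i, w)\<close> is the entry
  \<open>f i w\<close>.\<close>

lemma cbasis_dsum_rep:
  fixes b :: "'i \<Rightarrow> 'o"
  assumes K: "cring K" and b: "\<And>i. i \<in> I \<Longrightarrow> b i \<in> Obj C"
  shows "cbasis C K (cmod_dsum C I (\<lambda>i. rep_mod C K (b i))) I b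
    (\<lambda>i. dsum_single I (\<lambda>k. free_mod K (Hom C (b k) (b i))) i
       (dsum_single (Hom C (b i) (b i)) (\<lambda>_. self_mod K) (Ide C (b i)) \<one>\<^bsub>K\<^esub>))
    (\<lambda>c (i, w) f. f i w)"
proof -
  interpret K: cring K by (rule K)
  let ?P = "cmod_dsum C I (\<lambda>i. rep_mod C K (b i))"
  let ?d = "\<lambda>i c w. dsum_single (Hom C (b i) c) (\<lambda>_. self_mod K) w \<one>\<^bsub>K\<^esub>"
  let ?s = "\<lambda>i c. dsum_single I (\<lambda>k. free_mod K (Hom C (b k) c)) i"
  have P: "is_cmod C K ?P" by (rule is_cmod_dsum[OF K is_cmod_rep[OF K b]])
  have dc: "?d i c w \<in> carrier (free_mod K (Hom C (b i) c))" if "w \<in> Hom C (b i) c" for i c w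
    using free_mod_single_carrier[OF K that] by auto
  have "mbasis K (Val ?P c) (SIGMA i:I. Hom C (b i) c)
      (\<lambda>(i, w). Act ?P w (?s i (b i) (?d i (b i) (Ide C (b i))))) (\<lambda>(i, w) f. f i w)" if c: "c \<in> Obj C" for c
  proof -
    have V: "Val ?P c = dsum_mod I (\<lambda>i. free_mod K (Hom C (b i) c))"
      by (simp add: cmod_dsum_def rep_mod_def)
    note B = mbasis_dsum[where I = I and V = "\<lambda>i. free_mod K (Hom C (b i) c)", OF K mbasis_free[OF K]]
    show ?thesis
      unfolding V
    proof (rule mbasis_reindex[OF B, where h = "\<lambda>x. x"])
      show "bij_betw (\<lambda>x. x) (SIGMA j:I. Hom C (b j) c) (SIGMA j:I. Hom C (b j) c)"
        by (simp add: bij_betw_def)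
      fix p assume "p \<in> (SIGMA j:I. Hom C (b j) c)"
      then obtain i w where p: "p = (i, w)" and i: "i \<in> I" and w: "w \<in> Hom C (b i) c" by auto
      have "Act ?P w (?s i (b i) (?d i (b i) (Ide C (b i)))) =
          ?s i c (Act (rep_mod C K (b i)) w (?d i (b i) (Ide C (b i))))"
      proof -
        have "lin_map K (free_mod K (Hom C (b k) (b i))) (free_mod K (Hom C (b k) c)) (Act (rep_mod C K (b k)) w)"
          if "k \<in> I" for k
          using act_lin[OF is_cmod_rep[OF K b[OF that]] w] by (simp add: rep_mod_def)
        from lin_map_dsum_map(2)[of I K "\<lambda>k. free_mod K (Hom C (b k) (b i))" "\<lambda>k. free_mod K (Hom C (b k) c)"
            "\<lambda>k. Act (rep_mod C K (b k)) w", OF _ _ this i dc[OF Ide_in_Hom[OF b[OF i]]]]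
        show ?thesis by (simp add: cmod_dsum_def module_free[OF K])
      qed
      also have "Act (rep_mod C K (b i)) w (?d i (b i) (Ide C (b i))) = ?d i c w"
        using free_map_single[OF K, of "Hom C (b i) (b i)" "Comp C w" "Hom C (b i) c" "Ide C (b i)"]
          w Comp_in_Hom[OF _ w] Ide_in_Hom[OF b[OF i]] Comp_Ide[OF w]
        by (auto simp: rep_mod_def Hom_def)
      finally show "(case p of (i, w) \<Rightarrow> Act ?P w (?s i (b i) (?d i (b i) (Ide C (b i))))) =
          (case p of (i, w) \<Rightarrow> ?s i c (?d i c w))" using p by simp
    qed simp
  qed
  moreover have "?s i (b i) (?d i (b i) (Ide C (b i))) \<in> carrier (Val ?P (b i))" if "i \<in> I" for i
    using dsum_single_carrier[where K = K and I = I and V = "\<lambda>k. free_mod K (Hom C (b k) (b i))", OF module_free[OF K] that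
        dc[OF Ide_in_Hom[OF b[OF that]]]]
    by (simp add: cmod_dsum_def rep_mod_def)
  ultimately show ?thesis using P b by (simp add: cbasis_def)
qed

lemma free_imp_cbasis:
  fixes P :: "('o, 'm, 'k, 'v) cmod"
  assumes K: "cring K" and P: "free_cmod C K P"
  shows "\<exists>(I :: ('o \<times> 'v) set) b e \<chi>. cbasis C K P I b e \<chi>"
proof -
  obtain I :: "('o \<times> 'v) set" and b \<phi> where I: "b ` I \<subseteq> Obj C"
    "cmod_iso C K (cmod_dsum C I (\<lambda>i. rep_mod C K (b i))) P \<phi>" and M: "is_cmod C K P"
    using P by (auto simp: free_cmod_def)
  have b: "b i \<in> Obj C" if "i \<in> I" for i using I(1) that by auto
  show ?thesis using cbasis_iso[OF cbasis_dsum_rep[where I = I and b = b, OF K b] M I(2)] by blast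
qed

text \<open>An index \<open>j\<close> is determined by \<open>b j\<close> and \<open>e j\<close>, so any index set can be moved into the type prescribed
  by \<^const>\<open>free_cmod\<close>.\<close>

lemma cbasis_imp_free:
  fixes P :: "('o, 'm, 'k, 'v) cmod"
  assumes K: "field K" and B: "cbasis C K P I b e \<chi>"
  shows "free_cmod C K P"
proof -
  interpret K: field K by fact
  have Kc: "cring K" by (rule K.is_cring)
  note B' = cbasisD[OF B]
  let ?h = "\<lambda>j. (b j, e j)"
  have inj: "inj_on ?h I"
  proof (rule inj_onI)
    fix j k assume jk: "j \<in> I" "k \<in> I" "?h j = ?h k"
    have i: "Ide C (b j) \<in> Hom C (b j) (b j)" "Ide C (b j) \<in> Hom C (b k) (b j)"
      using Ide_in_Hom[OF B'(2)[OF jk(1)]] jk(3) by auto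
    have "\<chi> (b j) (j, Ide C (b j)) (Act P (Ide C (b j)) (e k)) = (if k = j then \<one>\<^bsub>K\<^esub> else \<zero>\<^bsub>K\<^esub>)"
      using cbasis_dual[OF B B'(2)[OF jk(1)] jk(1) i(1) jk(2) i(2)] by simp
    moreover have "\<chi> (b j) (j, Ide C (b j)) (Act P (Ide C (b j)) (e j)) = \<one>\<^bsub>K\<^esub>"
      using cbasis_dual[OF B B'(2)[OF jk(1)] jk(1) i(1) jk(1) i(1)] by simp
    moreover have "e k = e j" using jk(3) by simp
    ultimately have "(if k = j then \<one>\<^bsub>K\<^esub> else \<zero>\<^bsub>K\<^esub>) = \<one>\<^bsub>K\<^esub>" by simp
    then show "j = k" using K.one_not_zero by (cases "k = j") auto
  qed
  let ?I = "?h ` I" and ?k = "inv_into I ?h"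
  have k: "?k (?h j) = j" if "j \<in> I" for j by (rule inv_into_f_f[OF inj that])
  have "cbasis C K P ?I fst snd (\<lambda>c (j, w). \<chi> c (?k j, w))"
  proof (rule cbasis_reindex[OF B])
    show "bij_betw ?k ?I I" by (rule bij_betw_inv_into[OF inj_on_imp_bij_betw[OF inj]])
  qed (auto simp: k)
  note R = this and R' = cbasisD[OF this]
  let ?F = "cmod_dsum C ?I (\<lambda>i. rep_mod C K (fst i))"
  note F = cbasis_dsum_rep[where I = ?I and b = fst, OF Kc R'(2)]
  note F' = cbasisD[OF F]
  obtain f where f: "cmod_hom C K ?F P f"
    "\<forall>i\<in>?I. f (fst i) (dsum_single ?I (\<lambda>k. free_mod K (Hom C (fst k) (fst i))) i
       (dsum_single (Hom C (fst i) (fst i)) (\<lambda>_. self_mod K) (Ide C (fst i)) \<one>\<^bsub>K\<^esub>)) = snd i"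
    using cbasis_lift[where m = snd, OF F R'(1,3)] by blast
  obtain g where g: "cmod_hom C K P ?F g"
    "\<forall>i\<in>?I. g (fst i) (snd i) = dsum_single ?I (\<lambda>k. free_mod K (Hom C (fst k) (fst i))) i
       (dsum_single (Hom C (fst i) (fst i)) (\<lambda>_. self_mod K) (Ide C (fst i)) \<one>\<^bsub>K\<^esub>)"
    using cbasis_lift[OF R F'(1,3)] by blast
  have "cmod_iso C K ?F P f"
  proof (rule cmod_isoI[OF f(1) g(1)])
    show "g c (f c x) = x" if "c \<in> Obj C" "x \<in> carrier (Val ?F c)" for c x
      by (rule cbasis_hom_ext[OF F F'(1) cmod_hom_comp[OF f(1) g(1)] cmod_hom_id _ that])
        (use f(2) g(2) in auto)
    show "f c (g c y) = y" if "c \<in> Obj C" "y \<in> carrier (Val P c)" for c y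
      by (rule cbasis_hom_ext[OF R R'(1) cmod_hom_comp[OF g(1) f(1)] cmod_hom_id _ that])
        (use f(2) g(2) in auto)
  qed
  moreover have "fst ` ?I \<subseteq> Obj C" using R'(2) by blast
  ultimately show ?thesis using R'(1) unfolding free_cmod_def by blast
qed

lemma cbasis_imp_projective:
  assumes B: "cbasis C K P I b e \<chi>" shows "projective_cmod C K P"
  unfolding projective_cmod_def using cbasis_cmod[OF B] cbasis_lift_epi[OF B] by blast

end

section \<open>Minimal free covers\<close>

definition free_cover ::
  "('o, 'm) cat \<Rightarrow> ('k, 'z) ring_scheme \<Rightarrow> ('o, 'm, 'k, 'v) cmod \<Rightarrow> ('o, 'm, 'k, 'w) cmod
     \<Rightarrow> ('o \<Rightarrow> 'v \<Rightarrow> 'w) \<Rightarrow> bool" where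
  "free_cover C K F M f \<longleftrightarrow> free_cmod C K F \<and> is_cmod C K M \<and> superfluous_epi C K F M f"

lemma free_coverD:
  assumes "free_cover C K F M f"
  shows "free_cmod C K F" "is_cmod C K F" "is_cmod C K M" "superfluous_epi C K F M f"
    "cmod_epi C K F M f" "cmod_hom C K F M f"
  using assms by (auto simp: free_cover_def free_cmod_def superfluous_epi_def cmod_epi_def)

context category
begin

text \<open>A lift of one cover through the other is epic by superfluity; a section of it exists by
  freeness and is epic for the same reason, so both are bijective.\<close>

lemma free_cover_unique:
  fixes F :: "('o, 'm, 'k, 'v) cmod" and G :: "('o, 'm, 'k, 'w) cmod"
  assumes K: "cring K" and F: "free_cover C K F M f" and G: "free_cover C K G N g"
    and t: "cmod_iso C K M N t"
  shows "\<exists>\<phi>. cmod_iso C K F G \<phi> \<and>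
    (\<forall>c\<in>Obj C. \<forall>x\<in>carrier (Val F c). g c (\<phi> c x) = t c (f c x))"
proof -
  note F' = free_coverD[OF F] and G' = free_coverD[OF G]
  obtain I :: "('o \<times> 'v) set" and b e \<chi> where BF: "cbasis C K F I b e \<chi>"
    using free_imp_cbasis[OF K F'(1)] by blast
  obtain J :: "('o \<times> 'w) set" and b' e' \<chi>' where BG: "cbasis C K G J b' e' \<chi>'"
    using free_imp_cbasis[OF K G'(1)] by blast
  have thom: "cmod_hom C K M N t" using t by (simp add: cmod_iso_def)
  obtain \<phi> where \<phi>: "cmod_hom C K F G \<phi>"
    "\<And>c x. c \<in> Obj C \<Longrightarrow> x \<in> carrier (Val F c) \<Longrightarrow> g c (\<phi> c x) = t c (f c x)"
    using cbasis_lift_epi[OF BF G'(2,3,5) cmod_hom_comp[OF F'(6) thom]] by blast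
  have tinj: "inj_on (t c) (carrier (Val M c))" and tsurj: "t c ` carrier (Val M c) = carrier (Val N c)"
    if "c \<in> Obj C" for c using t that by (auto simp: cmod_iso_def bij_betw_def)
  have fsurj: "f c ` carrier (Val F c) = carrier (Val M c)"
    and gsurj: "g c ` carrier (Val G c) = carrier (Val N c)" if "c \<in> Obj C" for c
    using F'(5) G'(5) that by (auto simp: cmod_epi_def)
  have \<phi>epi: "cmod_epi C K F G \<phi>"
  proof (rule superfluous_epiD[OF G'(2,4) F'(2) \<phi>(1)])
    fix c y assume c: "c \<in> Obj C" and y: "y \<in> carrier (Val N c)"
    have "y \<in> t c ` f c ` carrier (Val F c)" using y tsurj[OF c] fsurj[OF c] by simp
    then obtain x where "x \<in> carrier (Val F c)" "y = t c (f c x)" by blast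
    then show "\<exists>x\<in>carrier (Val F c). g c (\<phi> c x) = y" using \<phi>(2)[OF c] by auto
  qed
  obtain \<sigma> where \<sigma>: "cmod_hom C K G F \<sigma>"
    "\<And>c x. c \<in> Obj C \<Longrightarrow> x \<in> carrier (Val G c) \<Longrightarrow> \<phi> c (\<sigma> c x) = x"
    using cbasis_lift_epi[OF BG F'(2) G'(2) \<phi>epi cmod_hom_id] by blast
  have "cmod_epi C K G F \<sigma>"
  proof (rule superfluous_epiD[OF F'(2,4) G'(2) \<sigma>(1)])
    fix c y assume c: "c \<in> Obj C" and y: "y \<in> carrier (Val M c)"
    have "t c y \<in> g c ` carrier (Val G c)" using tsurj[OF c] gsurj[OF c] y by blast
    then obtain z where z: "z \<in> carrier (Val G c)" "t c y = g c z" by blast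
    have \<sigma>z: "\<sigma> c z \<in> carrier (Val F c)" by (rule hom_closed[OF \<sigma>(1) c z(1)])
    have "t c (f c (\<sigma> c z)) = t c y" using \<phi>(2)[OF c \<sigma>z] \<sigma>(2)[OF c z(1)] z(2) by simp
    then have "f c (\<sigma> c z) = y"
      using inj_onD[OF tinj[OF c]] hom_closed[OF F'(6) c \<sigma>z] y by blast
    then show "\<exists>x\<in>carrier (Val G c). f c (\<sigma> c x) = y" using z(1) by blast
  qed
  then have surj: "\<sigma> c ` carrier (Val G c) = carrier (Val F c)" if "c \<in> Obj C" for c
    using that by (simp add: cmod_epi_def)
  have "cmod_iso C K F G \<phi>"
  proof (rule cmod_isoI[OF \<phi>(1) \<sigma>(1) _ \<sigma>(2)])
    fix c x assume c: "c \<in> Obj C" and x: "x \<in> carrier (Val F c)"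
    then obtain z where "z \<in> carrier (Val G c)" "x = \<sigma> c z" using surj[OF c] by blast
    then show "\<sigma> c (\<phi> c x) = x" using \<sigma>(2)[OF c] by simp
  qed
  then show ?thesis using \<phi>(2) by blast
qed

text \<open>The new source may take its values in another type, hence superfluity is not transported by a mere
  renaming but through \<open>superfluous_epiD\<close>.\<close>

lemma free_cover_transfer:
  assumes K: "field K" and F: "free_cover C K F M f" and F': "is_cmod C K F'" and M': "is_cmod C K M'"
    and f': "cmod_hom C K F' M' f'" and p: "cmod_iso C K F' F p" and t: "cmod_iso C K M' M t"
    and comm: "\<And>c x. c \<in> Obj C \<Longrightarrow> x \<in> carrier (Val F' c) \<Longrightarrow> t c (f' c x) = f c (p c x)"
  shows "free_cover C K F' M' f'"
proof -
  interpret K: field K by fact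
  note D = free_coverD[OF F]
  obtain q where q: "cmod_iso C K F F' q" using cmod_iso_inv[OF F' p] by metis
  have free: "free_cmod C K F'"
    using free_imp_cbasis[OF K.is_cring D(1)] cbasis_iso[OF _ F' q] cbasis_imp_free[OF K] by blast
  have tinj: "inj_on (t c) (carrier (Val M' c))" and tsurj: "t c ` carrier (Val M' c) = carrier (Val M c)"
    if "c \<in> Obj C" for c using t that by (auto simp: cmod_iso_def bij_betw_def)
  have pinj: "inj_on (p c) (carrier (Val F' c))" and psurj: "p c ` carrier (Val F' c) = carrier (Val F c)"
    if "c \<in> Obj C" for c using p that by (auto simp: cmod_iso_def bij_betw_def)
  have fsurj: "f c ` carrier (Val F c) = carrier (Val M c)" if "c \<in> Obj C" for c
    using D(5) that by (auto simp: cmod_epi_def)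
  have phom: "cmod_hom C K F' F p" and thom: "cmod_hom C K M' M t" using p t by (auto simp: cmod_iso_def)
  have epi: "cmod_epi C K F' M' f'"
    unfolding cmod_epi_def
  proof (intro conjI ballI f' equalityI subsetI)
    show "y \<in> carrier (Val M' c)" if "c \<in> Obj C" "y \<in> f' c ` carrier (Val F' c)" for c y
      using that hom_closed[OF f'] by blast
    fix c y assume c: "c \<in> Obj C" and y: "y \<in> carrier (Val M' c)"
    have "t c y \<in> f c ` p c ` carrier (Val F' c)" using tsurj[OF c] fsurj[OF c] psurj[OF c] y by auto
    then obtain x where x: "x \<in> carrier (Val F' c)" "t c y = f c (p c x)" by blast
    have "t c y = t c (f' c x)" using x(2) comm[OF c x(1)] by simp
    then have "y = f' c x" by (rule inj_onD[OF tinj[OF c] _ y hom_closed[OF f' c x(1)]])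
    then show "y \<in> f' c ` carrier (Val F' c)" using x(1) by blast
  qed
  have "superfluous_epi C K F' M' f'"
  proof (rule superfluous_epiI[OF epi])
    fix L' g assume L': "is_cmod C K L'" and g: "cmod_hom C K L' F' g"
      and s: "\<And>c y. c \<in> Obj C \<Longrightarrow> y \<in> carrier (Val M' c) \<Longrightarrow> \<exists>x\<in>carrier (Val L' c). f' c (g c x) = y"
    have "cmod_epi C K L' F (\<lambda>c x. p c (g c x))"
    proof (rule superfluous_epiD[OF D(2,4) L' cmod_hom_comp[OF g phom]])
      fix c y assume c: "c \<in> Obj C" and y: "y \<in> carrier (Val M c)"
      have "y \<in> t c ` carrier (Val M' c)" using tsurj[OF c] y by simp
      then obtain z where z: "z \<in> carrier (Val M' c)" "t c z = y" by blast
      obtain x where x: "x \<in> carrier (Val L' c)" "f' c (g c x) = z" using s[OF c z(1)] by blast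
      then show "\<exists>x\<in>carrier (Val L' c). f c (p c (g c x)) = y"
        using comm[OF c hom_closed[OF g c x(1)]] z by auto
    qed
    then have s2: "(\<lambda>x. p c (g c x)) ` carrier (Val L' c) = carrier (Val F c)" if "c \<in> Obj C" for c
      using that by (simp add: cmod_epi_def)
    have "carrier (Val F' c) \<subseteq> g c ` carrier (Val L' c)" if c: "c \<in> Obj C" for c
    proof
      fix y assume y: "y \<in> carrier (Val F' c)"
      then have "p c y \<in> (\<lambda>x. p c (g c x)) ` carrier (Val L' c)" using s2[OF c] hom_closed[OF phom c y] by simp
      then obtain x where x: "x \<in> carrier (Val L' c)" "p c y = p c (g c x)" by blast
      have "y = g c x" by (rule inj_onD[OF pinj[OF c] x(2) y hom_closed[OF g c x(1)]])
      then show "y \<in> g c ` carrier (Val L' c)" using x(1) by blast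
    qed
    then show "cmod_epi C K L' F' g" using g hom_closed[OF g] by (auto simp: cmod_epi_def)
  qed
  then show ?thesis using free M' by (simp add: free_cover_def)
qed

end

section \<open>Resolutions as chains of covers\<close>

text \<open>The augmentation plays the role of a differential out of \<open>Term X 0\<close>, but its codomain takes values
  in another type; naming the successive kernels lets the rest of the argument treat all steps alike.\<close>

fun syz ::
  "('o, 'm, 'k, 'v) ccomplex \<Rightarrow> ('o, 'm, 'k, 'w) cmod \<Rightarrow> ('o \<Rightarrow> 'v \<Rightarrow> 'w) \<Rightarrow> nat
     \<Rightarrow> ('o, 'm, 'k, 'v) cmod" where
  "syz X M \<epsilon> 0 = cmod_ker (Term X 0) M \<epsilon>"
| "syz X M \<epsilon> (Suc i) = cmod_ker (Term X (Suc i)) (Term X i) (Diff X i)"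

definition cover_chain ::
  "('o, 'm) cat \<Rightarrow> ('k, 'z) ring_scheme \<Rightarrow> ('o, 'm, 'k, 'v) ccomplex \<Rightarrow> ('o, 'm, 'k, 'w) cmod
     \<Rightarrow> ('o \<Rightarrow> 'v \<Rightarrow> 'w) \<Rightarrow> bool" where
  "cover_chain C K X M \<epsilon> \<longleftrightarrow> free_cover C K (Term X 0) M \<epsilon> \<and>
     (\<forall>i. free_cover C K (Term X (Suc i)) (syz X M \<epsilon> i) (Diff X i))"

lemma syz_zero: "\<zero>\<^bsub>Val (syz X M \<epsilon> i) c\<^esub> = \<zero>\<^bsub>Val (Term X i) c\<^esub>"
  by (cases i) (auto simp: cmod_ker_sub)

lemma cmod_ker_syz: "cmod_ker F (syz X M \<epsilon> i) f = cmod_ker F (Term X i) f"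
proof -
  have "ker_obj F (syz X M \<epsilon> i) f = ker_obj F (Term X i) f"
    by (rule ext) (simp add: ker_obj_def syz_zero)
  then show ?thesis by (simp add: cmod_ker_sub)
qed

lemma syz_Suc: "syz X M \<epsilon> (Suc i) = cmod_ker (Term X (Suc i)) (syz X M \<epsilon> i) (Diff X i)"
  by (simp add: cmod_ker_syz)

context category
begin

lemma cover_chain_cmod: "cover_chain C K X M \<epsilon> \<Longrightarrow> is_cmod C K (Term X i)"
  by (cases i) (auto simp: cover_chain_def dest: free_coverD)

lemma syz_incl:
  assumes X: "cover_chain C K X M \<epsilon>"
  shows "cmod_hom C K (syz X M \<epsilon> i) (Term X i) (\<lambda>c x. x)"
proof (cases i)
  case 0
  have "free_cover C K (Term X 0) M \<epsilon>" using X by (simp add: cover_chain_def)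
  note F = free_coverD[OF this]
  show ?thesis using ker_incl[OF F(2,3,6)] 0 by simp
next
  case (Suc k)
  have "free_cover C K (Term X (Suc k)) (syz X M \<epsilon> k) (Diff X k)" using X by (simp add: cover_chain_def)
  note F = free_coverD[OF this]
  show ?thesis using ker_incl[OF F(2,3,6)] Suc syz_Suc[of X M \<epsilon> k] by simp
qed

lemma cover_chain_diff:
  assumes X: "cover_chain C K X M \<epsilon>"
  shows "cmod_hom C K (Term X (Suc i)) (Term X i) (Diff X i)"
proof -
  have "free_cover C K (Term X (Suc i)) (syz X M \<epsilon> i) (Diff X i)" using X by (simp add: cover_chain_def)
  from cmod_hom_comp[OF free_coverD(6)[OF this] syz_incl[OF X]] show ?thesis by simp
qed

lemma cover_chain_imp_minimal_free_resolution:
  assumes K: "cring K" and X: "cover_chain C K X M \<epsilon>"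
  shows "minimal_free_resolution C K X M"
proof -
  have F0: "free_cover C K (Term X 0) M \<epsilon>" and FS: "\<And>i. free_cover C K (Term X (Suc i)) (syz X M \<epsilon> i) (Diff X i)"
    using X by (auto simp: cover_chain_def)
  note D0 = free_coverD[OF F0] and DS = free_coverD[OF FS]
  have free: "free_cmod C K (Term X i)" for i by (cases i) (auto intro: D0 DS)
  have proj: "projective_cmod C K (Term X i)" for i
    using free_imp_cbasis[OF K free] cbasis_imp_projective by blast
  have ex: "carrier (Val (syz X M \<epsilon> i) c) = Diff X i c ` carrier (Val (Term X (Suc i)) c)"
    if "c \<in> Obj C" for i c using DS(5)[of i] that by (simp add: cmod_epi_def)
  have "resolution C K X M \<epsilon>"
    unfolding resolution_def
  proof (intro conjI allI ballI D0 cover_chain_cmod[OF X] cover_chain_diff[OF X])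
    fix c assume c: "c \<in> Obj C"
    show "ker_obj (Term X 0) M \<epsilon> c = Diff X 0 c ` carrier (Val (Term X 1) c)"
      using ex[OF c, of 0] by (simp add: cmod_ker_sub)
    show "ker_obj (Term X (Suc i)) (Term X i) (Diff X i) c =
        Diff X (Suc i) c ` carrier (Val (Term X (Suc (Suc i))) c)" for i
      using ex[OF c, of "Suc i"] by (simp add: cmod_ker_sub)
  qed
  moreover have "projective_cover C K (Term X 0) M \<epsilon>"
    using proj D0 by (simp add: projective_cover_def)
  moreover have "projective_cover C K (Term X (Suc i)) (syz X M \<epsilon> i) (Diff X i)" for i
    using proj DS(3,4) by (simp add: projective_cover_def)
  note this[of 0, simplified] this[of "Suc _", simplified]
  ultimately show ?thesis
    unfolding minimal_free_resolution_def minimal_resolution_def using free by auto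
qed

lemma minimal_free_resolution_imp_cover_chain:
  assumes "minimal_free_resolution C K X M"
  shows "\<exists>\<epsilon>. cover_chain C K X M \<epsilon>"
proof -
  obtain \<epsilon> where \<epsilon>: "minimal_resolution C K X M \<epsilon>" and free: "\<And>i. free_cmod C K (Term X i)"
    using assms by (auto simp: minimal_free_resolution_def)
  have pc: "projective_cover C K (Term X (Suc i)) (syz X M \<epsilon> i) (Diff X i)" for i
    using \<epsilon> by (cases i) (auto simp: minimal_resolution_def)
  have "cover_chain C K X M \<epsilon>"
    using pc \<epsilon> free by (auto simp: cover_chain_def free_cover_def projective_cover_def minimal_resolution_def)
  then show ?thesis by blast
qed

lemma ker_iso:
  assumes F: "is_cmod C K F" and M: "is_cmod C K M" and N: "is_cmod C K N"
    and f: "cmod_hom C K F M f" and p: "cmod_iso C K F G p" and t: "cmod_iso C K M N t"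
    and comm: "\<And>c x. c \<in> Obj C \<Longrightarrow> x \<in> carrier (Val F c) \<Longrightarrow> g c (p c x) = t c (f c x)"
  shows "cmod_iso C K (cmod_ker F M f) (cmod_ker G N g) p"
proof -
  have phom: "cmod_hom C K F G p" and thom: "cmod_hom C K M N t" using p t by (auto simp: cmod_iso_def)
  have pbij: "bij_betw (p c) (carrier (Val F c)) (carrier (Val G c))"
    and tbij: "bij_betw (t c) (carrier (Val M c)) (carrier (Val N c))" if "c \<in> Obj C" for c
    using p t that by (auto simp: cmod_iso_def)
  have ker: "p c x \<in> ker_obj G N g c \<longleftrightarrow> x \<in> ker_obj F M f c" if c: "c \<in> Obj C" and x: "x \<in> carrier (Val F c)" for c x
  proof -
    note m = cmod_module[OF M c] and n = cmod_module[OF N c]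
    interpret m: module K "Val M c" by (rule m)
    have "t c (f c x) = \<zero>\<^bsub>Val N c\<^esub> \<longleftrightarrow> f c x = \<zero>\<^bsub>Val M c\<^esub>"
      using lin_map_zero[OF m n hom_lin[OF thom c]] inj_onD[OF bij_betw_imp_inj_on[OF tbij[OF c]], of "f c x" "\<zero>\<^bsub>Val M c\<^esub>"]
        hom_closed[OF f c x] by auto
    then show ?thesis using x comm[OF c x] hom_closed[OF phom c x] by (auto simp: ker_obj_def)
  qed
  have img: "p c ` ker_obj F M f c = ker_obj G N g c" if c: "c \<in> Obj C" for c
  proof (intro equalityI subsetI)
    fix y assume "y \<in> p c ` ker_obj F M f c"
    then show "y \<in> ker_obj G N g c" using ker[OF c] by (auto simp: ker_obj_def)
  next
    fix y assume y: "y \<in> ker_obj G N g c"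
    then obtain x where "x \<in> carrier (Val F c)" "y = p c x"
      using pbij[OF c] by (auto simp: bij_betw_def ker_obj_def)
    then show "y \<in> p c ` ker_obj F M f c" using ker[OF c] y by blast
  qed
  have "cmod_hom C K (cmod_ker F M f) (cmod_ker G N g) p"
  proof (rule cmod_homI)
    show "lin_map K (Val (cmod_ker F M f) c) (Val (cmod_ker G N g) c) (p c)" if c: "c \<in> Obj C" for c
      using lin_map_add[OF hom_lin[OF phom c]] lin_map_smult[OF hom_lin[OF phom c]] img[OF c]
      by (intro lin_mapI) (auto simp: cmod_ker_sub ker_obj_def)
    show "p b (Act (cmod_ker F M f) u x) = Act (cmod_ker G N g) u (p a x)"
      if "u \<in> Hom C a b" "x \<in> carrier (Val (cmod_ker F M f) a)" for a b u x
      using that hom_nat[OF phom that(1)] by (auto simp: cmod_ker_sub ker_obj_def)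
  qed
  moreover have "bij_betw (p c) (ker_obj F M f c) (ker_obj G N g c)" if c: "c \<in> Obj C" for c
    using img[OF c] pbij[OF c] by (auto simp: bij_betw_def ker_obj_def intro: inj_on_subset)
  ultimately show ?thesis by (simp add: cmod_iso_def cmod_ker_sub)
qed

text \<open>An isomorphism of covers restricts to one of their kernels, which are the modules covered in the
  next step.\<close>

lemma cover_chain_unique:
  assumes K: "cring K" and X: "cover_chain C K X M \<epsilon>" and Y: "cover_chain C K Y N \<delta>"
    and t: "cmod_iso C K M N t"
  shows "\<exists>\<phi>. (\<forall>i. cmod_iso C K (Term X i) (Term Y i) (\<phi> i)) \<and>
    (\<forall>i. \<forall>c\<in>Obj C. \<forall>x\<in>carrier (Val (Term X (Suc i)) c).
       Diff Y i c (\<phi> (Suc i) c x) = \<phi> i c (Diff X i c x))"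
proof -
  let ?P = "\<lambda>i \<phi>. cmod_iso C K (Term X i) (Term Y i) \<phi> \<and> cmod_iso C K (syz X M \<epsilon> i) (syz Y N \<delta> i) \<phi>"
  let ?Q = "\<lambda>i \<phi> \<psi>. \<forall>c\<in>Obj C. \<forall>x\<in>carrier (Val (Term X (Suc i)) c). Diff Y i c (\<psi> c x) = \<phi> c (Diff X i c x)"
  have X0: "free_cover C K (Term X 0) M \<epsilon>" and XS: "\<And>i. free_cover C K (Term X (Suc i)) (syz X M \<epsilon> i) (Diff X i)"
    using X by (auto simp: cover_chain_def)
  have Y0: "free_cover C K (Term Y 0) N \<delta>" and YS: "\<And>i. free_cover C K (Term Y (Suc i)) (syz Y N \<delta> i) (Diff Y i)"
    using Y by (auto simp: cover_chain_def)
  have "\<exists>\<phi>. ?P 0 \<phi>"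
  proof -
    obtain \<phi> where \<phi>: "cmod_iso C K (Term X 0) (Term Y 0) \<phi>"
      "\<And>c x. c \<in> Obj C \<Longrightarrow> x \<in> carrier (Val (Term X 0) c) \<Longrightarrow> \<delta> c (\<phi> c x) = t c (\<epsilon> c x)"
      using free_cover_unique[OF K X0 Y0 t] by blast
    have "cmod_iso C K (syz X M \<epsilon> 0) (syz Y N \<delta> 0) \<phi>"
      using ker_iso[OF free_coverD(2,3)[OF X0] free_coverD(3)[OF Y0] free_coverD(6)[OF X0] \<phi>(1) t \<phi>(2)] by simp
    then show ?thesis using \<phi>(1) by blast
  qed
  moreover have "\<exists>\<psi>. ?P (Suc i) \<psi> \<and> ?Q i \<phi> \<psi>" if P: "?P i \<phi>" for i \<phi>
  proof -
    obtain \<psi> where \<psi>: "cmod_iso C K (Term X (Suc i)) (Term Y (Suc i)) \<psi>"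
      "\<And>c x. c \<in> Obj C \<Longrightarrow> x \<in> carrier (Val (Term X (Suc i)) c) \<Longrightarrow> Diff Y i c (\<psi> c x) = \<phi> c (Diff X i c x)"
      using free_cover_unique[OF K XS YS conjunct2[OF P]] by blast
    have "cmod_iso C K (syz X M \<epsilon> (Suc i)) (syz Y N \<delta> (Suc i)) \<psi>"
      unfolding syz_Suc
      using ker_iso[OF free_coverD(2,3)[OF XS] free_coverD(3)[OF YS] free_coverD(6)[OF XS] \<psi>(1) conjunct2[OF P] \<psi>(2)] .
    then show ?thesis using \<psi> by blast
  qed
  ultimately have "\<exists>\<phi>. \<forall>i. ?P i (\<phi> i) \<and> ?Q i (\<phi> i) (\<phi> (Suc i))"
    by (rule dependent_nat_choice)
  then show ?thesis by blast
qed

text \<open>A complex isomorphic to a minimal free resolution is one; again the types of the values may differ.\<close>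

lemma cover_chain_transfer:
  assumes K: "field K" and X: "cover_chain C K X M \<epsilon>" and Y: "\<And>i. is_cmod C K (Term Y i)"
    and d: "\<And>i. cmod_hom C K (Term Y (Suc i)) (Term Y i) (Diff Y i)"
    and p: "\<And>i. cmod_iso C K (Term Y i) (Term X i) (p i)"
    and comm: "\<And>i c x. c \<in> Obj C \<Longrightarrow> x \<in> carrier (Val (Term Y (Suc i)) c) \<Longrightarrow>
      p i c (Diff Y i c x) = Diff X i c (p (Suc i) c x)"
  shows "cover_chain C K Y M (\<lambda>c x. \<epsilon> c (p 0 c x))"
proof -
  let ?e = "\<lambda>c x. \<epsilon> c (p 0 c x)"
  have X0: "free_cover C K (Term X 0) M \<epsilon>" and XS: "\<And>i. free_cover C K (Term X (Suc i)) (syz X M \<epsilon> i) (Diff X i)"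
    using X by (auto simp: cover_chain_def)
  note X0' = free_coverD[OF X0] and XS' = free_coverD[OF XS]
  have M: "is_cmod C K M" by (rule X0')
  have phom: "cmod_hom C K (Term Y i) (Term X i) (p i)" for i using p by (simp add: cmod_iso_def)
  have idM: "cmod_iso C K M M (\<lambda>c x. x)" by (rule cmod_isoI[OF cmod_hom_id cmod_hom_id]) auto
  have eh: "cmod_hom C K (Term Y 0) M ?e" by (rule cmod_hom_comp[OF phom X0'(6)])
  have Y0: "free_cover C K (Term Y 0) M ?e"
    by (rule free_cover_transfer[OF K X0 Y M eh p idM]) auto
  have siso: "cmod_iso C K (syz Y M ?e i) (syz X M \<epsilon> i) (p i)" for i
  proof (cases i)
    case 0
    show ?thesis unfolding 0 syz.simps
      by (rule ker_iso[OF Y M M eh p idM]) auto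
  next
    case (Suc k)
    show ?thesis unfolding Suc syz.simps
      by (rule ker_iso[OF Y Y cover_chain_cmod[OF X] d p p]) (use comm in auto)
  qed
  have scm: "is_cmod C K (syz Y M ?e i)" for i
    using is_cmod_ker[OF Y M eh] is_cmod_ker[OF Y Y d] by (cases i) auto
  have dsyz: "cmod_hom C K (Term Y (Suc i)) (syz Y M ?e i) (Diff Y i)" for i
  proof (rule cmod_homI)
    fix c assume c: "c \<in> Obj C"
    have "Diff Y i c x \<in> carrier (Val (syz Y M ?e i) c)" if x: "x \<in> carrier (Val (Term Y (Suc i)) c)" for x
    proof -
      have 1: "p i c (Diff Y i c x) \<in> carrier (Val (syz X M \<epsilon> i) c)"
        using comm[OF c x] hom_closed[OF XS'(6) c hom_closed[OF phom c x]] by simp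
      then obtain y where y: "y \<in> carrier (Val (syz Y M ?e i) c)" "p i c (Diff Y i c x) = p i c y"
        using siso[of i] c by (auto simp: cmod_iso_def bij_betw_def)
      have "y \<in> carrier (Val (Term Y i) c)" using y(1) by (cases i) (auto simp: cmod_ker_sub ker_obj_def)
      then have "Diff Y i c x = y"
        using y(2) hom_closed[OF d c x] p[of i] c by (auto simp: cmod_iso_def bij_betw_def inj_on_def)
      then show ?thesis using y(1) by simp
    qed
    then show "lin_map K (Val (Term Y (Suc i)) c) (Val (syz Y M ?e i) c) (Diff Y i c)"
      using hom_lin[OF d c, of i] by (cases i) (auto simp: cmod_ker_sub lin_map_def)
  next
    fix a b u x assume "u \<in> Hom C a b" "x \<in> carrier (Val (Term Y (Suc i)) a)"
    then show "Diff Y i b (Act (Term Y (Suc i)) u x) = Act (syz Y M ?e i) u (Diff Y i a x)"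
      using hom_nat[OF d] by (cases i) (auto simp: cmod_ker_sub)
  qed
  have "free_cover C K (Term Y (Suc i)) (syz Y M ?e i) (Diff Y i)" for i
    by (rule free_cover_transfer[OF K XS Y scm dsyz p siso]) (use comm in auto)
  then show ?thesis using Y0 by (simp add: cover_chain_def)
qed

end

section \<open>Graded categories\<close>

text \<open>The objects of an action category are not bounded below, but all modules of interest are supported
  on an upward closed set \<open>S\<close> of degrees with a height; induction on the height is what makes
  Nakayama's lemma work.\<close>

locale graded_category = category C for C :: "('o, 'm) cat" +
  fixes S :: "'o set" and ht :: "'o \<Rightarrow> nat"
  assumes S_Obj: "S \<subseteq> Obj C"
    and endo: "u \<in> Hom C c c \<Longrightarrow> u = Ide C c"
    and iso_endo: "cat_iso C u \<Longrightarrow> Dom C u = Cod C u"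
    and up: "u \<in> Hom C a b \<Longrightarrow> a \<in> S \<Longrightarrow> b \<in> S"
    and ht: "u \<in> Hom C a b \<Longrightarrow> a \<in> S \<Longrightarrow> a \<noteq> b \<Longrightarrow> ht a < ht b"

definition supported :: "('o, 'm) cat \<Rightarrow> 'o set \<Rightarrow> ('o, 'm, 'k, 'v) cmod \<Rightarrow> bool" where
  "supported C S M \<longleftrightarrow> (\<forall>c\<in>Obj C - S. carrier (Val M c) = {\<zero>\<^bsub>Val M c\<^esub>})"

lemma lin_map_const_zero:
  assumes "module K W" shows "lin_map K V W (\<lambda>_. \<zero>\<^bsub>W\<^esub>)"
proof -
  interpret W: module K W by fact
  show ?thesis by (rule lin_mapI) auto
qed

context graded_category
begin

lemma no_loops:
  assumes u: "u \<in> Hom C a b" and v: "v \<in> Hom C b a" shows "a = b"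
proof -
  have "Comp C v u = Ide C a" "Comp C u v = Ide C b"
    using endo Comp_in_Hom[OF u v] Comp_in_Hom[OF v u] by auto
  then have "cat_iso C u" using u v by (auto simp: cat_iso_def Hom_def)
  from iso_endo[OF this] have "Dom C u = Cod C u" .
  moreover have "Dom C u = a" "Cod C u = b" using u by (auto simp: Hom_def)
  ultimately show ?thesis by (simp only:)
qed

lemma noniso_iff:
  assumes u: "u \<in> Hom C a b" shows "\<not> cat_iso C u \<longleftrightarrow> a \<noteq> b"
proof
  assume n: "\<not> cat_iso C u"
  show "a \<noteq> b"
  proof
    assume ab: "a = b"
    then have "u = Ide C b" using endo u by simp
    moreover have "b \<in> Obj C" using Hom_objD u by simp
    ultimately have "cat_iso C u"
      using Ide_in_Hom[of b] Comp_Ide[OF Ide_in_Hom[of b]] by (auto simp: cat_iso_def Hom_def)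
    then show False using n by simp
  qed
next
  assume "a \<noteq> b" then show "\<not> cat_iso C u" using iso_endo[of u] u by (auto simp: Hom_def)
qed

text \<open>The identity of \<open>c\<close> does not factor through another object, so what comes from another object has no
  component along it.\<close>

lemma coord_act_zero:
  assumes K: "cring K" and B: "cbasis C K P I b e \<chi>" and j: "j \<in> I" "b j = c"
    and u: "u \<in> Hom C a c" "a \<noteq> c" and x: "x \<in> carrier (Val P a)"
  shows "\<chi> c (j, Ide C c) (Act P u x) = \<zero>\<^bsub>K\<^esub>"
proof -
  note B' = cbasisD[OF B] and ac = Hom_objD[OF u(1)]
  note sm = module_self[OF K]
  have i: "Ide C c \<in> Hom C (b j) c" using Ide_in_Hom[OF ac(2)] j by simp
  have "\<chi> c (j, Ide C c) (Act P u x) = \<zero>\<^bsub>self_mod K\<^esub>"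
  proof (rule mbasis_ext[OF B'(4)[OF ac(1)] sm _ lin_map_const_zero[OF sm] _ x])
    show "lin_map K (Val P a) (self_mod K) (\<lambda>x. \<chi> c (j, Ide C c) (Act P u x))"
      by (rule lin_map_comp[OF act_lin[OF B'(1) u(1)] cbasis_coord[OF B ac(2) j(1) i]])
    fix p assume "p \<in> (SIGMA j:I. Hom C (b j) a)"
    then obtain k w where p: "p = (k, w)" and k: "k \<in> I" and w: "w \<in> Hom C (b k) a" by auto
    have "\<not> (k = j \<and> Comp C u w = Ide C c)"
      using no_loops[OF u(1)] w j u(2) by auto
    then have "\<chi> c (j, Ide C c) (Act P (Comp C u w) (e k)) = \<zero>\<^bsub>K\<^esub>"
      using cbasis_dual[OF B ac(2) j(1) i k Comp_in_Hom[OF w u(1)]] by auto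
    then show "\<chi> c (j, Ide C c) (Act P u (case p of (j, w) \<Rightarrow> Act P w (e j))) = \<zero>\<^bsub>self_mod K\<^esub>"
      using act_Comp[OF B'(1) w u(1) B'(3)[OF k]] p by simp
  qed
  then show ?thesis by simp
qed

lemma coord_elt:
  assumes B: "cbasis C K P I b e \<chi>" and j: "j \<in> I" "b j = c"
  shows "\<chi> c (j, Ide C c) (e j) = \<one>\<^bsub>K\<^esub>"
proof -
  note B' = cbasisD[OF B]
  have c: "c \<in> Obj C" using B'(2) j by auto
  have i: "Ide C c \<in> Hom C (b j) c" using Ide_in_Hom[OF c] j by simp
  show ?thesis
    using cbasis_dual[OF B c j(1) i j(1) i] act_Ide[OF B'(1) c] B'(3)[OF j(1)] j(2) by simp
qed

text \<open>If the coordinate of some kernel element at a generator in its own degree were nonzero, the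
  proper submodule on which this coordinate vanishes would still map onto \<open>M\<close>.\<close>

lemma superfluous_imp_coord_zero:
  fixes F :: "('o, 'm, 'k, 'v) cmod"
  assumes K: "field K" and B: "cbasis C K F I b e \<chi>" and M: "is_cmod C K M"
    and f: "superfluous_epi C K F M f" and x: "x \<in> ker_obj F M f c" and j: "j \<in> I" "b j = c"
  shows "\<chi> c (j, Ide C c) x = \<zero>\<^bsub>K\<^esub>"
proof (rule ccontr)
  let ?\<chi> = "\<chi> c (j, Ide C c)"
  assume nz: "?\<chi> x \<noteq> \<zero>\<^bsub>K\<^esub>"
  interpret K: field K by fact
  have Kc: "cring K" by (rule K.is_cring)
  note B' = cbasisD[OF B] and sm = module_self[OF Kc]
  have c: "c \<in> Obj C" using B'(2) j by auto
  have i: "Ide C c \<in> Hom C (b j) c" using Ide_in_Hom[OF c] j by simp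
  note Fc = cmod_module[OF B'(1) c] and Mc = cmod_module[OF M c]
  interpret F: module K "Val F c" by (rule Fc)
  interpret M: module K "Val M c" by (rule Mc)
  have fepi: "cmod_epi C K F M f" and fhom: "cmod_hom C K F M f"
    using f by (auto simp: superfluous_epi_def cmod_epi_def)
  note \<chi>lin = cbasis_coord[OF B c j(1) i]
  have xc: "x \<in> carrier (Val F c)" "f c x = \<zero>\<^bsub>Val M c\<^esub>" using x by (auto simp: ker_obj_def)
  define H where "H d = (if d = c then {y \<in> carrier (Val F c). ?\<chi> y = \<zero>\<^bsub>K\<^esub>} else carrier (Val F d))" for d
  have H: "submodule (H d) K (Val F d)" if "d \<in> Obj C" for d
    using submodule_kernel[OF Fc sm \<chi>lin] submodule_carrier[OF cmod_module[OF B'(1) that]]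
    by (simp add: H_def)
  have Hact: "Act F u y \<in> H d" if u: "u \<in> Hom C a d" and y: "y \<in> H a" for a d u y
  proof -
    have yc: "y \<in> carrier (Val F a)" using y by (auto simp: H_def split: if_splits)
    consider "d \<noteq> c" | "d = c" "a = c" | "d = c" "a \<noteq> c" by auto
    then show ?thesis
    proof cases
      case 1 then show ?thesis using act_closed[OF B'(1) u yc] by (simp add: H_def)
    next
      case 2 then show ?thesis using endo[of u c] u y act_Ide[OF B'(1) c] yc by simp
    next
      case 3
      then have u': "u \<in> Hom C a c" using u by simp
      show ?thesis
        using coord_act_zero[OF Kc B j u' 3(2) yc] act_closed[OF B'(1) u yc] 3 by (simp add: H_def)
    qed
  qed
  note L = is_cmod_sub[OF B'(1) H Hact] and Li = sub_cmod_incl[OF B'(1) H]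
  have "cmod_epi C K (sub_cmod F H) F (\<lambda>c x. x)"
  proof (rule superfluous_epiD[OF B'(1) f L Li])
    fix d y assume d: "d \<in> Obj C" and y: "y \<in> carrier (Val M d)"
    have "y \<in> f d ` carrier (Val F d)" using fepi d y by (simp add: cmod_epi_def)
    then obtain z where z: "z \<in> carrier (Val F d)" "f d z = y" by blast
    show "\<exists>x\<in>carrier (Val (sub_cmod F H) d). f d x = y"
    proof (cases "d = c")
      case False
      then show ?thesis using z by (auto simp: H_def)
    next
      case True
      have zc: "z \<in> carrier (Val F c)" using z True by simp
      have k: "?\<chi> x \<in> carrier K" "?\<chi> z \<in> carrier K" using lin_map_closed[OF \<chi>lin] xc zc by auto
      \<comment> \<open>Subtracting a multiple of the kernel element \<open>x\<close> clears the coordinate of \<open>z\<close>.\<close>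
      define a where "a = ?\<chi> z \<otimes>\<^bsub>K\<^esub> inv\<^bsub>K\<^esub> ?\<chi> x"
      have inv: "inv\<^bsub>K\<^esub> ?\<chi> x \<in> carrier K" "inv\<^bsub>K\<^esub> ?\<chi> x \<otimes>\<^bsub>K\<^esub> ?\<chi> x = \<one>\<^bsub>K\<^esub>"
        using nz k K.field_Units by auto
      have a: "a \<in> carrier K" "a \<otimes>\<^bsub>K\<^esub> ?\<chi> x = ?\<chi> z"
        using inv k by (auto simp: a_def K.m_assoc)
      let ?z = "z \<ominus>\<^bsub>Val F c\<^esub> a \<odot>\<^bsub>Val F c\<^esub> x"
      have "?\<chi> ?z = ?\<chi> z \<ominus>\<^bsub>self_mod K\<^esub> ?\<chi> z"
        using a xc zc by (simp add: lin_map_minus[OF Fc sm \<chi>lin] lin_map_smult[OF \<chi>lin])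
      moreover have "\<dots> = \<zero>\<^bsub>K\<^esub>"
      proof -
        interpret sm: module K "self_mod K" by (rule sm)
        show ?thesis using sm.M.r_neg[of "?\<chi> z"] k by (simp add: a_minus_def)
      qed
      ultimately have "?z \<in> H c" using zc xc a by (simp add: H_def)
      moreover have "f c ?z = y"
      proof -
        have "f c ?z = f c z \<ominus>\<^bsub>Val M c\<^esub> a \<odot>\<^bsub>Val M c\<^esub> f c x"
          using a xc(1) zc
          by (simp add: lin_map_minus[OF Fc Mc hom_lin[OF fhom c]] lin_map_smult[OF hom_lin[OF fhom c]])
        then show ?thesis
          using a xc(2) z True hom_closed[OF fhom c zc] by (simp add: a_minus_def module_neg[OF Mc])
      qed
      ultimately show ?thesis using True by auto
    qed
  qed
  then have "H c = carrier (Val F c)" using c by (simp add: cmod_epi_def)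
  moreover have "e j \<in> carrier (Val F c)" using B'(3)[OF j(1)] j(2) by simp
  ultimately have "?\<chi> (e j) = \<zero>\<^bsub>K\<^esub>" by (auto simp: H_def)
  then show False using coord_elt[OF B j] K.one_not_zero by simp
qed

text \<open>Nakayama's lemma: if \<open>f\<close> composed with \<open>g\<close> is epic, every generator lies in the image of \<open>g\<close> up to
  an element of the kernel of \<open>f\<close>, and by hypothesis the latter involves generators of smaller height
  only.\<close>

lemma coord_zero_imp_superfluous:
  fixes F :: "('o, 'm, 'k, 'v) cmod"
  assumes B: "cbasis C K F I b e \<chi>" and bS: "b ` I \<subseteq> S" and M: "is_cmod C K M"
    and f: "cmod_epi C K F M f"
    and z: "\<And>c x j. c \<in> Obj C \<Longrightarrow> x \<in> ker_obj F M f c \<Longrightarrow> j \<in> I \<Longrightarrow> b j = c \<Longrightarrow> \<chi> c (j, Ide C c) x = \<zero>\<^bsub>K\<^esub>"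
  shows "superfluous_epi C K F M f"
proof (rule superfluous_epiI[OF f])
  note B' = cbasisD[OF B]
  have fhom: "cmod_hom C K F M f" using f by (simp add: cmod_epi_def)
  fix L :: "('o, 'm, 'k, 'v) cmod" and g assume L: "is_cmod C K L" and g: "cmod_hom C K L F g"
    and fg: "\<And>c y. c \<in> Obj C \<Longrightarrow> y \<in> carrier (Val M c) \<Longrightarrow> \<exists>x\<in>carrier (Val L c). f c (g c x) = y"
  define H where "H c = g c ` carrier (Val L c)" for c
  have H: "submodule (H c) K (Val F c)" if "c \<in> Obj C" for c
    unfolding H_def
    by (rule submodule_image[OF cmod_module[OF L that] cmod_module[OF B'(1) that] hom_lin[OF g that]
          submodule_carrier[OF cmod_module[OF L that]]])
  have Hact: "Act F u x \<in> H d" if "u \<in> Hom C a d" "x \<in> H a" for a d u x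
    using that hom_nat[OF g that(1), symmetric] act_closed[OF L that(1)] by (auto simp: H_def)
  have gens: "e j \<in> H (b j)" if "j \<in> I" for j
    using that
  proof (induction "ht (b j)" arbitrary: j rule: less_induct)
    case less
    let ?c = "b j"
    have c: "?c \<in> Obj C" by (rule B'(2)[OF less.prems])
    note Fc = cmod_module[OF B'(1) c] and Mc = cmod_module[OF M c]
    interpret F: module K "Val F ?c" by (rule Fc)
    interpret M: module K "Val M ?c" by (rule Mc)
    have ej: "e j \<in> carrier (Val F ?c)" by (rule B'(3)[OF less.prems])
    obtain l where l: "l \<in> carrier (Val L ?c)" "f ?c (g ?c l) = f ?c (e j)"
      using fg[OF c hom_closed[OF fhom c ej]] by blast
    have gl: "g ?c l \<in> carrier (Val F ?c)" "g ?c l \<in> H ?c" using hom_closed[OF g c l(1)] l by (auto simp: H_def)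
    let ?x = "e j \<ominus>\<^bsub>Val F ?c\<^esub> g ?c l"
    have x: "?x \<in> carrier (Val F ?c)" using ej gl by simp
    have "f ?c ?x = \<zero>\<^bsub>Val M ?c\<^esub>"
      using lin_map_minus[OF Fc Mc hom_lin[OF fhom c] ej gl(1)] l(2) hom_closed[OF fhom c ej]
      by (simp add: a_minus_def M.r_neg)
    then have xk: "?x \<in> ker_obj F M f ?c" using x by (simp add: ker_obj_def)
    have "?x \<in> H ?c"
    proof (rule mbasis_memI[OF B'(4)[OF c] H[OF c] x])
      fix p assume "p \<in> (SIGMA j:I. Hom C (b j) ?c)" and nz: "\<chi> ?c p ?x \<noteq> \<zero>\<^bsub>K\<^esub>"
      then obtain k w where p: "p = (k, w)" and k: "k \<in> I" and w: "w \<in> Hom C (b k) ?c" by auto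
      have "b k \<noteq> ?c"
      proof
        assume "b k = ?c"
        moreover from this have "w = Ide C ?c" using endo w by simp
        ultimately show False using z[OF c xk k] nz p by simp
      qed
      then have "ht (b k) < ht ?c" using ht[OF w] bS k by auto
      from Hact[OF w less.hyps[OF this k]] show "(case p of (j, w) \<Rightarrow> Act F w (e j)) \<in> H ?c" using p by simp
    qed
    from submodule_add[OF H[OF c] this gl(2)] show ?case
      using ej gl by (simp add: a_minus_def F.a_assoc F.l_neg)
  qed
  have "carrier (Val F c) \<subseteq> H c" if c: "c \<in> Obj C" for c
  proof
    fix x assume x: "x \<in> carrier (Val F c)"
    show "x \<in> H c"
      by (rule mbasis_memI[OF B'(4)[OF c] H[OF c] x]) (use Hact gens in auto)
  qed
  then show "cmod_epi C K L F g"
    using g hom_closed[OF g] by (auto simp: cmod_epi_def H_def)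
qed

text \<open>A generator in a degree where \<open>M\<close> vanishes would be a kernel element with coordinate one at itself.\<close>

lemma free_cover_gens:
  fixes F :: "('o, 'm, 'k, 'v) cmod"
  assumes K: "field K" and F: "free_cover C K F M f" and M: "supported C S M"
    and B: "cbasis C K F I b e \<chi>"
  shows "b ` I \<subseteq> S"
proof clarify
  fix j assume j: "j \<in> I"
  interpret K: field K by fact
  note D = free_coverD[OF F] and B' = cbasisD[OF B]
  show "b j \<in> S"
  proof (rule ccontr)
    assume "b j \<notin> S"
    then have "f (b j) (e j) = \<zero>\<^bsub>Val M (b j)\<^esub>"
      using hom_closed[OF D(6) B'(2,3)[OF j]] M B'(2)[OF j] by (auto simp: supported_def)
    then have "e j \<in> ker_obj F M f (b j)" using B'(3)[OF j] by (simp add: ker_obj_def)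
    from superfluous_imp_coord_zero[OF K B D(3,4) this j refl] coord_elt[OF B j refl] K.one_not_zero
    show False by simp
  qed
qed

lemma cbasis_supported:
  assumes B: "cbasis C K F I b e \<chi>" and bS: "b ` I \<subseteq> S"
  shows "supported C S F"
  unfolding supported_def
proof (intro ballI equalityI subsetI)
  fix c assume c: "c \<in> Obj C - S"
  then have c': "c \<in> Obj C" by simp
  note B' = cbasisD[OF B]
  note Fc = cmod_module[OF B'(1) c']
  interpret F: module K "Val F c" by (rule Fc)
  show "x \<in> carrier (Val F c)" if "x \<in> {\<zero>\<^bsub>Val F c\<^esub>}" for x using that by simp
  fix x assume x: "x \<in> carrier (Val F c)"
  have "Hom C (b j) c = {}" if "j \<in> I" for j using up that c bS by blast
  then show "x \<in> {\<zero>\<^bsub>Val F c\<^esub>}"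
    by (intro mbasis_memI[OF B'(4)[OF c'] submodule_zero_set[OF Fc] x]) auto
qed

lemma free_cover_supported:
  fixes F :: "('o, 'm, 'k, 'v) cmod"
  assumes K: "field K" and F: "free_cover C K F M f" and M: "supported C S M"
  shows "supported C S F" "supported C S (cmod_ker F M f)"
proof -
  interpret K: field K by fact
  note D = free_coverD[OF F]
  obtain I :: "('o \<times> 'v) set" and b e \<chi> where B: "cbasis C K F I b e \<chi>"
    using free_imp_cbasis[OF K.is_cring D(1)] by blast
  show s: "supported C S F" by (rule cbasis_supported[OF B free_cover_gens[OF K F M B]])
  show "supported C S (cmod_ker F M f)"
    unfolding supported_def
  proof
    fix c assume c: "c \<in> Obj C - S"
    have "\<zero>\<^bsub>Val F c\<^esub> \<in> ker_obj F M f c"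
      using submodule_zero[OF submodule_ker[OF D(2,3,6)]] c by blast
    moreover have "ker_obj F M f c \<subseteq> {\<zero>\<^bsub>Val F c\<^esub>}" using s c by (auto simp: supported_def ker_obj_def)
    ultimately show "carrier (Val (cmod_ker F M f) c) = {\<zero>\<^bsub>Val (cmod_ker F M f) c\<^esub>}"
      by (auto simp: cmod_ker_sub)
  qed
qed

lemma cover_chain_supported:
  assumes K: "field K" and X: "cover_chain C K X M \<epsilon>" and M: "supported C S M"
  shows "supported C S (Term X i) \<and> supported C S (syz X M \<epsilon> i)"
proof -
  have X0: "free_cover C K (Term X 0) M \<epsilon>" and XS: "\<And>i. free_cover C K (Term X (Suc i)) (syz X M \<epsilon> i) (Diff X i)"
    using X by (auto simp: cover_chain_def)
  show ?thesis
  proof (induction i)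
    case 0 then show ?case using free_cover_supported[OF K X0 M] by simp
  next
    case (Suc i) then show ?case unfolding syz_Suc using free_cover_supported[OF K XS, of i] by blast
  qed
qed

end

section \<open>Restriction along fully faithful functors\<close>

lemma func_Hom: "is_func D E \<beta> \<Longrightarrow> u \<in> Hom D a b \<Longrightarrow> FArr \<beta> u \<in> Hom E (FObj \<beta> a) (FObj \<beta> b)"
  and func_Obj: "is_func D E \<beta> \<Longrightarrow> c \<in> Obj D \<Longrightarrow> FObj \<beta> c \<in> Obj E"
  and func_Ide: "is_func D E \<beta> \<Longrightarrow> c \<in> Obj D \<Longrightarrow> FArr \<beta> (Ide D c) = Ide E (FObj \<beta> c)"
  and func_Comp: "is_func D E \<beta> \<Longrightarrow> u \<in> Hom D a b \<Longrightarrow> v \<in> Hom D b c \<Longrightarrow>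
    FArr \<beta> (Comp D v u) = Comp E (FArr \<beta> v) (FArr \<beta> u)"
  by (auto simp: is_func_def Hom_def)

lemma res_simps [simp]:
  "Val (res_cmod \<beta> M) c = Val M (FObj \<beta> c)" "Act (res_cmod \<beta> M) u = Act M (FArr \<beta> u)"
  by (auto simp: res_cmod_def)

lemma is_cmod_res:
  assumes "is_func D E \<beta>" "is_cmod E K M" shows "is_cmod D K (res_cmod \<beta> M)"
  by (rule is_cmodI)
    (auto simp: func_Ide[OF assms(1)] func_Comp[OF assms(1)] func_Obj[OF assms(1)]
      intro: cmod_module[OF assms(2)] act_lin[OF assms(2)] act_Ide[OF assms(2)] act_Comp[OF assms(2)]
        func_Hom[OF assms(1)])

lemma cmod_hom_res:
  assumes "is_func D E \<beta>" "cmod_hom E K M N f"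
  shows "cmod_hom D K (res_cmod \<beta> M) (res_cmod \<beta> N) (\<lambda>c. f (FObj \<beta> c))"
  by (rule cmod_homI)
    (auto intro: hom_lin[OF assms(2)] hom_nat[OF assms(2)] func_Obj[OF assms(1)] func_Hom[OF assms(1)])

lemma ker_res: "ker_obj (res_cmod \<beta> F) (res_cmod \<beta> M) (\<lambda>c. f (FObj \<beta> c)) c = ker_obj F M f (FObj \<beta> c)"
  by (simp add: ker_obj_def)

lemma cmod_ker_res:
  "cmod_ker (res_cmod \<beta> F) (res_cmod \<beta> M) (\<lambda>c. f (FObj \<beta> c)) = res_cmod \<beta> (cmod_ker F M f)"
  by (simp add: cmod_ker_def res_cmod_def ker_obj_def)

definition fully_faithful ::
  "('o, 'm) cat \<Rightarrow> ('p, 'n) cat \<Rightarrow> ('o, 'm, 'p, 'n) func \<Rightarrow> bool" where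
  "fully_faithful D E \<beta> \<longleftrightarrow> is_func D E \<beta> \<and>
     (\<forall>a\<in>Obj D. \<forall>b\<in>Obj D. bij_betw (FArr \<beta>) (Hom D a b) (Hom E (FObj \<beta> a) (FObj \<beta> b)))"

text \<open>The functor matches the morphisms from \<open>b' j\<close> to \<open>c\<close> with those from \<open>b j\<close> to the image of \<open>c\<close>; the
  elements and coordinates stay the same.\<close>

lemma cbasis_res:
  assumes \<beta>: "fully_faithful D E \<beta>" and B: "cbasis E K F I b e \<chi>"
    and b': "\<And>j. j \<in> I \<Longrightarrow> b' j \<in> Obj D \<and> FObj \<beta> (b' j) = b j"
  shows "cbasis D K (res_cmod \<beta> F) I b' e (\<lambda>c (j, w). \<chi> (FObj \<beta> c) (j, FArr \<beta> w))"
proof -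
  note B' = cbasisD[OF B]
  have fn: "is_func D E \<beta>" using \<beta> by (simp add: fully_faithful_def)
  have "mbasis K (Val F (FObj \<beta> c)) (SIGMA j:I. Hom D (b' j) c) (\<lambda>(j, w). Act F (FArr \<beta> w) (e j))
      (\<lambda>(j, w). \<chi> (FObj \<beta> c) (j, FArr \<beta> w))" if c: "c \<in> Obj D" for c
  proof (rule mbasis_reindex[OF B'(4)[OF func_Obj[OF fn c]], where h = "\<lambda>(j, w). (j, FArr \<beta> w)"])
    have bij: "bij_betw (FArr \<beta>) (Hom D (b' j) c) (Hom E (b j) (FObj \<beta> c))" if "j \<in> I" for j
      using \<beta> b'[OF that] c by (auto simp: fully_faithful_def)
    show "bij_betw (\<lambda>(j, w). (j, FArr \<beta> w)) (SIGMA j:I. Hom D (b' j) c) (SIGMA j:I. Hom E (b j) (FObj \<beta> c))"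
      unfolding bij_betw_def
    proof
      show "inj_on (\<lambda>(j, w). (j, FArr \<beta> w)) (SIGMA j:I. Hom D (b' j) c)"
        using bij by (auto simp: inj_on_def bij_betw_def)
      show "(\<lambda>(j, w). (j, FArr \<beta> w)) ` (SIGMA j:I. Hom D (b' j) c) = (SIGMA j:I. Hom E (b j) (FObj \<beta> c))"
      proof (intro equalityI subsetI)
        fix p assume "p \<in> (SIGMA j:I. Hom E (b j) (FObj \<beta> c))"
        then obtain j v where p: "p = (j, v)" "j \<in> I" "v \<in> Hom E (b j) (FObj \<beta> c)" by auto
        then obtain w where "w \<in> Hom D (b' j) c" "v = FArr \<beta> w" using bij[of j] by (auto simp: bij_betw_def)
        then show "p \<in> (\<lambda>(j, w). (j, FArr \<beta> w)) ` (SIGMA j:I. Hom D (b' j) c)" using p by force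
      qed (use bij in \<open>auto simp: bij_betw_def\<close>)
    qed
  qed auto
  then show ?thesis using b' B'(3) is_cmod_res[OF fn B'(1)] by (auto simp: cbasis_def)
qed

text \<open>Superfluity quantifies over all submodules and does not obviously pass to a restriction, but the
  coordinate criterion does.\<close>

lemma free_cover_res:
  fixes F :: "('p, 'n, 'k, 'v) cmod"
  assumes K: "field K" and D: "graded_category D (Obj D) h" and E: "graded_category E S h'"
    and \<beta>: "fully_faithful D E \<beta>" and F: "free_cover E K F M f"
    and gens: "\<And>(I :: ('p \<times> 'v) set) b e \<chi>. cbasis E K F I b e \<chi> \<Longrightarrow> b ` I \<subseteq> FObj \<beta> ` Obj D"
  shows "free_cover D K (res_cmod \<beta> F) (res_cmod \<beta> M) (\<lambda>c. f (FObj \<beta> c))"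
proof -
  interpret K: field K by fact
  interpret D: graded_category D "Obj D" h by fact
  interpret E: graded_category E S h' by fact
  have fn: "is_func D E \<beta>" using \<beta> by (simp add: fully_faithful_def)
  note FD = free_coverD[OF F]
  obtain I :: "('p \<times> 'v) set" and b e \<chi> where B: "cbasis E K F I b e \<chi>"
    using E.free_imp_cbasis[OF K.is_cring FD(1)] by blast
  have "\<exists>c. c \<in> Obj D \<and> FObj \<beta> c = b j" if "j \<in> I" for j using gens[OF B] that by force
  then obtain b' where b': "\<And>j. j \<in> I \<Longrightarrow> b' j \<in> Obj D \<and> FObj \<beta> (b' j) = b j" by metis
  note R = cbasis_res[OF \<beta> B b']
  have M: "is_cmod D K (res_cmod \<beta> M)" by (rule is_cmod_res[OF fn FD(3)])
  have epi: "cmod_epi D K (res_cmod \<beta> F) (res_cmod \<beta> M) (\<lambda>c. f (FObj \<beta> c))"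
    using cmod_hom_res[OF fn FD(6)] FD(5) func_Obj[OF fn] by (auto simp: cmod_epi_def)
  have "superfluous_epi D K (res_cmod \<beta> F) (res_cmod \<beta> M) (\<lambda>c. f (FObj \<beta> c))"
  proof (rule D.coord_zero_imp_superfluous[OF R _ M epi])
    show "b' ` I \<subseteq> Obj D" using b' by auto
    fix c x j assume c: "c \<in> Obj D" and x: "x \<in> ker_obj (res_cmod \<beta> F) (res_cmod \<beta> M) (\<lambda>c. f (FObj \<beta> c)) c"
      and j: "j \<in> I" "b' j = c"
    have "\<chi> (FObj \<beta> c) (j, Ide E (FObj \<beta> c)) x = \<zero>\<^bsub>K\<^esub>"
      using E.superfluous_imp_coord_zero[OF K B FD(3,4) x[unfolded ker_res] j(1)] b'[OF j(1)] j(2) by simp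
    then show "(case (j, Ide D c) of (j, w) \<Rightarrow> \<chi> (FObj \<beta> c) (j, FArr \<beta> w)) x = \<zero>\<^bsub>K\<^esub>"
      by (simp add: func_Ide[OF fn c])
  qed
  then show ?thesis using D.cbasis_imp_free[OF K R] M by (simp add: free_cover_def)
qed

lemma syz_res:
  "syz (res_ccomplex \<beta> X) (res_cmod \<beta> M) (\<lambda>c. \<epsilon> (FObj \<beta> c)) i = res_cmod \<beta> (syz X M \<epsilon> i)"
  by (cases i) (auto simp: res_ccomplex_def cmod_ker_res)

lemma cover_chain_res:
  fixes X :: "('p, 'n, 'k, 'v) ccomplex"
  assumes K: "field K" and D: "graded_category D (Obj D) h" and E: "graded_category E S h'"
    and \<beta>: "fully_faithful D E \<beta>" and X: "cover_chain E K X M \<epsilon>"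
    and gens: "\<And>i (I :: ('p \<times> 'v) set) b e \<chi>. cbasis E K (Term X i) I b e \<chi> \<Longrightarrow> b ` I \<subseteq> FObj \<beta> ` Obj D"
  shows "cover_chain D K (res_ccomplex \<beta> X) (res_cmod \<beta> M) (\<lambda>c. \<epsilon> (FObj \<beta> c))"
proof -
  have X0: "free_cover E K (Term X 0) M \<epsilon>" and XS: "\<And>i. free_cover E K (Term X (Suc i)) (syz X M \<epsilon> i) (Diff X i)"
    using X by (auto simp: cover_chain_def)
  show ?thesis
    unfolding cover_chain_def syz_res
    using free_cover_res[OF K D E \<beta> X0 gens] free_cover_res[OF K D E \<beta> XS gens]
    by (simp add: res_ccomplex_def)
qed

section \<open>Existence of minimal resolutions and Betti degrees\<close>

text \<open>Countability of \<open>S\<close> lets minimal resolutions be indexed by natural numbers, as the value type in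
  \<^const>\<open>betti_obj\<close> demands; finiteness of incoming morphisms keeps their terms finite-dimensional in each
  degree.\<close>

locale locally_finite_graded_category = graded_category +
  assumes countable_S: "countable S"
    and finite_incoming: "c \<in> Obj C \<Longrightarrow> finite {u \<in> Arr C. Cod C u = c \<and> Dom C u \<in> S}"

lemma lin_map_diff:
  assumes "module K W" "lin_map K V W f" "lin_map K V W g"
  shows "lin_map K V W (\<lambda>x. f x \<ominus>\<^bsub>W\<^esub> g x)"
proof -
  interpret W: module K W by fact
  note f = lin_map_closed[OF assms(2)] lin_map_add[OF assms(2)] lin_map_smult[OF assms(2)]
  note g = lin_map_closed[OF assms(3)] lin_map_add[OF assms(3)] lin_map_smult[OF assms(3)]
  show ?thesis
    by (rule lin_mapI)
      (simp_all add: f g a_minus_def W.minus_add W.a_ac W.smult_r_distr W.smult_r_minus)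
qed

context locally_finite_graded_category
begin

text \<open>Choose in every degree a minimal set of generators modulo the elements coming from smaller
  degrees.  There are countably many in total, so natural numbers can serve as their indices.\<close>

lemma free_cover_exists:
  fixes M :: "('a, 'b, 'k, 'w) cmod"
  assumes K: "field K" and M: "is_cmod C K M" and sup: "supported C S M"
    and fs: "\<And>c. c \<in> Obj C \<Longrightarrow> finitely_spanned K (Val M c)"
  shows "\<exists>(F :: ('a, 'b, 'k, nat \<Rightarrow> 'b \<Rightarrow> 'k) cmod) f. free_cover C K F M f \<and>
    (\<forall>c\<in>Obj C. finitely_spanned K (Val F c))"
proof -
  interpret K: field K by fact
  have Kc: "cring K" by (rule K.is_cring)
  note sm = module_self[OF Kc]
  define rad where "rad c = (\<Union>u\<in>{u \<in> Arr C. Cod C u = c \<and> Dom C u \<noteq> c}. Act M u ` carrier (Val M (Dom C u)))" for c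
  have rad_sub: "rad c \<subseteq> carrier (Val M c)" for c
    using act_closed[OF M Arr_Hom] by (auto simp: rad_def)
  have radI: "Act M u x \<in> rad c" if "u \<in> Hom C a c" "a \<noteq> c" "x \<in> carrier (Val M a)" for u a c x
    using that by (auto simp: rad_def Hom_def)
  have "\<exists>T. finite T \<and> T \<subseteq> carrier (Val M c) \<and> submod_span K (Val M c) (rad c \<union> T) = carrier (Val M c) \<and>
    (\<forall>s\<in>T. submod_span K (Val M c) (rad c \<union> (T - {s})) \<noteq> carrier (Val M c))" if "c \<in> Obj C" for c
    by (rule exists_relative_basis[OF cmod_module[OF M that] fs[OF that] rad_sub])
  then obtain T where Tfin: "\<And>c. c \<in> Obj C \<Longrightarrow> finite (T c)"
    and Tsub: "\<And>c. c \<in> Obj C \<Longrightarrow> T c \<subseteq> carrier (Val M c)"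
    and Tspan: "\<And>c. c \<in> Obj C \<Longrightarrow> submod_span K (Val M c) (rad c \<union> T c) = carrier (Val M c)"
    and Tmin: "\<And>c s. c \<in> Obj C \<Longrightarrow> s \<in> T c \<Longrightarrow> submod_span K (Val M c) (rad c \<union> (T c - {s})) \<noteq> carrier (Val M c)"
    by metis
  define J where "J = (SIGMA c:S. T c)"
  have cJ: "countable J"
    unfolding J_def using countable_S Tfin S_Obj by (intro countable_SIGMA) (auto intro: countable_finite)
  define I where "I = to_nat_on J ` J"
  define p where "p = inv_into J (to_nat_on J)"
  have inj: "inj_on (to_nat_on J) J" using cJ by (rule inj_on_to_nat_on)
  have pb: "bij_betw p I J" unfolding I_def p_def by (rule bij_betw_inv_into[OF inj_on_imp_bij_betw[OF inj]])
  define b where "b i = fst (p i)" for i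
  define m where "m i = snd (p i)" for i
  have pJ: "p i \<in> J" if "i \<in> I" for i using pb that by (auto simp: bij_betw_def)
  have bm: "b i \<in> S" "m i \<in> T (b i)" if "i \<in> I" for i
    using pJ[OF that] by (auto simp: b_def m_def J_def)
  have bObj: "b i \<in> Obj C" if "i \<in> I" for i using bm S_Obj that by auto
  have bm_surj: "\<exists>i\<in>I. b i = c \<and> m i = s" if "c \<in> S" "s \<in> T c" for c s
  proof -
    have "(c, s) \<in> p ` I" using pb that by (auto simp: bij_betw_def J_def)
    then obtain i where i: "i \<in> I" "(c, s) = p i" by blast
    then have "b i = c" "m i = s" by (auto simp: b_def m_def i(2)[symmetric])
    then show ?thesis using i(1) by blast
  qed
  have bm_inj: "i = k" if "i \<in> I" "k \<in> I" "b i = b k" "m i = m k" for i k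
    by (rule inj_onD[OF bij_betw_imp_inj_on[OF pb]])
      (use that in \<open>auto simp: b_def m_def prod_eq_iff\<close>)
  define F where "F = cmod_dsum C I (\<lambda>i. rep_mod C K (b i))"
  obtain e \<chi> where B: "cbasis C K F I b e \<chi>" unfolding F_def using cbasis_dsum_rep[where I = I and b = b, OF Kc bObj] by blast
  note B' = cbasisD[OF B]
  have mM: "m i \<in> carrier (Val M (b i))" if "i \<in> I" for i using bm Tsub bObj that by blast
  obtain f where f: "cmod_hom C K F M f" "\<And>i. i \<in> I \<Longrightarrow> f (b i) (e i) = m i"
    using cbasis_lift[where m = m, OF B M mM] by blast
  have img: "submodule (f c ` carrier (Val F c)) K (Val M c)" if "c \<in> Obj C" for c
    by (rule submodule_image[OF cmod_module[OF B'(1) that] cmod_module[OF M that] hom_lin[OF f(1) that]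
          submodule_carrier[OF cmod_module[OF B'(1) that]]])
  have zero: "carrier (Val M c) \<subseteq> f c ` carrier (Val F c)" if "c \<in> Obj C" "c \<notin> S" for c
    using sup that submodule_zero[OF img[OF that(1)]] by (auto simp: supported_def)
  have surj: "carrier (Val M c) \<subseteq> f c ` carrier (Val F c)" if "c \<in> Obj C" "c \<in> S" for c
    using that
  proof (induction "ht c" arbitrary: c rule: less_induct)
    case less
    note c = less.prems(1)
    have "rad c \<subseteq> f c ` carrier (Val F c)"
    proof
      fix y assume "y \<in> rad c"
      then obtain u x where u: "u \<in> Hom C (Dom C u) c" "Dom C u \<noteq> c" and x: "x \<in> carrier (Val M (Dom C u))"
        and y: "y = Act M u x" by (auto simp: rad_def Hom_def)
      note a = Hom_objD(1)[OF u(1)]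
      have "carrier (Val M (Dom C u)) \<subseteq> f (Dom C u) ` carrier (Val F (Dom C u))"
        using less.hyps[OF ht[OF u(1) _ u(2)] a] zero[OF a] by blast
      then obtain z where z: "z \<in> carrier (Val F (Dom C u))" "x = f (Dom C u) z" using x by blast
      have "y = f c (Act F u z)" using hom_nat[OF f(1) u(1) z(1)] y z(2) by simp
      then show "y \<in> f c ` carrier (Val F c)" using act_closed[OF B'(1) u(1) z(1)] by blast
    qed
    moreover have "T c \<subseteq> f c ` carrier (Val F c)"
    proof
      fix s assume "s \<in> T c"
      then obtain i where i: "i \<in> I" "b i = c" "m i = s" using bm_surj[OF less.prems(2)] by blast
      then show "s \<in> f c ` carrier (Val F c)" using f(2)[OF i(1)] B'(3)[OF i(1)] by (metis imageI)
    qed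
    ultimately show ?case using span_minimal[OF img[OF c], of "rad c \<union> T c"] Tspan[OF c] by auto
  qed
  have epi: "cmod_epi C K F M f"
    unfolding cmod_epi_def
  proof (intro conjI ballI f(1) equalityI)
    fix c assume c: "c \<in> Obj C"
    show "f c ` carrier (Val F c) \<subseteq> carrier (Val M c)" using hom_closed[OF f(1) c] by blast
    show "carrier (Val M c) \<subseteq> f c ` carrier (Val F c)" using surj[OF c] zero[OF c] by blast
  qed
  have "superfluous_epi C K F M f"
  proof (rule coord_zero_imp_superfluous[OF B _ M epi])
    show "b ` I \<subseteq> S" using bm by auto
    fix c x i assume c: "c \<in> Obj C" and x: "x \<in> ker_obj F M f c" and i: "i \<in> I" "b i = c"
    note Fc = cmod_module[OF B'(1) c] and Mc = cmod_module[OF M c]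
    interpret Mc: module K "Val M c" by (rule Mc)
    let ?\<chi> = "\<chi> c (i, Ide C c)"
    have id: "Ide C c \<in> Hom C (b i) c" using Ide_in_Hom[OF c] i by simp
    have s: "m i \<in> T c" "m i \<in> carrier (Val M c)" using bm(2)[OF i(1)] mM[OF i(1)] i(2) by auto
    have sub: "rad c \<union> (T c - {m i}) \<subseteq> carrier (Val M c)" using rad_sub Tsub[OF c] by blast
    let ?W = "submod_span K (Val M c) (rad c \<union> (T c - {m i}))"
    have W: "submodule ?W K (Val M c)" by (rule submodule_span[OF Mc sub])
    note Wsup = span_superset[of "rad c \<union> (T c - {m i})" K "Val M c"]
    \<comment> \<open>Apart from its multiple of \<open>m i\<close>, the image of every element lies in \<open>?W\<close>.  For a kernel element
      with nonzero coordinate this puts \<open>m i\<close> itself into \<open>?W\<close>, against the minimality of \<open>T c\<close>.\<close>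
    let ?g = "\<lambda>y. f c y \<ominus>\<^bsub>Val M c\<^esub> ?\<chi> y \<odot>\<^bsub>Val M c\<^esub> m i"
    have glin: "lin_map K (Val F c) (Val M c) ?g"
      by (intro lin_map_diff[OF Mc] hom_lin[OF f(1) c] lin_map_functional_smult[OF Fc Mc s(2)] cbasis_coord[OF B c i(1) id])
    have gW: "?g y \<in> ?W" if y: "y \<in> carrier (Val F c)" for y
    proof (rule span_image_subset[OF Fc Mc glin W, of "(\<lambda>(j, w). Act F w (e j)) ` (SIGMA j:I. Hom C (b j) c)"])
      show "(\<lambda>(j, w). Act F w (e j)) ` (SIGMA j:I. Hom C (b j) c) \<subseteq> carrier (Val F c)"
        using mbasis_elt[OF B'(4)[OF c]] by blast
      show "y \<in> submod_span K (Val F c) ((\<lambda>(j, w). Act F w (e j)) ` (SIGMA j:I. Hom C (b j) c))"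
        using mbasis_span[OF B'(4)[OF c]] y by simp
      fix z assume "z \<in> (\<lambda>(j, w). Act F w (e j)) ` (SIGMA j:I. Hom C (b j) c)"
      then obtain k w where k: "k \<in> I" and w: "w \<in> Hom C (b k) c" and z: "z = Act F w (e k)" by auto
      have fz: "f c z = Act M w (m k)" using hom_nat[OF f(1) w B'(3)[OF k]] f(2)[OF k] z by simp
      have \<chi>z: "?\<chi> z = (if k = i \<and> w = Ide C c then \<one>\<^bsub>K\<^esub> else \<zero>\<^bsub>K\<^esub>)"
        using cbasis_dual[OF B c i(1) id k w] z by simp
      show "?g z \<in> ?W"
      proof (cases "k = i \<and> w = Ide C c")
        case True
        then have "f c z = m i" using fz act_Ide[OF M c s(2)] by simp
        then have "?g z = \<zero>\<^bsub>Val M c\<^esub>" using \<chi>z True s(2) by (simp add: a_minus_def Mc.r_neg)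
        then show ?thesis using submodule_zero[OF W] by simp
      next
        case False
        have Mw: "Act M w (m k) \<in> carrier (Val M c)" using act_closed[OF M w mM[OF k]] .
        have "?\<chi> z = \<zero>\<^bsub>K\<^esub>" using False \<chi>z by simp
        then have "?g z = Act M w (m k)" using fz s(2) Mw by (simp add: a_minus_def module_neg[OF Mc])
        moreover have "Act M w (m k) \<in> rad c \<union> (T c - {m i})"
        proof (cases "b k = c")
          case True
          then have wi: "w = Ide C c" using endo w by simp
          then have "m k \<noteq> m i" using False bm_inj[OF k i(1)] True i(2) by auto
          moreover have "m k \<in> T c" using bm(2)[OF k] True by simp
          moreover have "Act M w (m k) = m k" using act_Ide[OF M c] mM[OF k] True wi by simp
          ultimately show ?thesis by simp
        next
          case False
          then show ?thesis using radI[OF w _ mM[OF k]] by blast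
        qed
        ultimately show ?thesis using Wsup by auto
      qed
    qed
    show "?\<chi> x = \<zero>\<^bsub>K\<^esub>"
    proof (rule ccontr)
      assume nz: "?\<chi> x \<noteq> \<zero>\<^bsub>K\<^esub>"
      have xF: "x \<in> carrier (Val F c)" "f c x = \<zero>\<^bsub>Val M c\<^esub>" using x by (auto simp: ker_obj_def)
      have \<chi>x: "?\<chi> x \<in> carrier K" using lin_map_closed[OF cbasis_coord[OF B c i(1) id] xF(1)] by simp
      have inv: "inv\<^bsub>K\<^esub> ?\<chi> x \<in> carrier K" "inv\<^bsub>K\<^esub> ?\<chi> x \<otimes>\<^bsub>K\<^esub> ?\<chi> x = \<one>\<^bsub>K\<^esub>"
        using nz \<chi>x K.field_Units by auto
      have 1: "\<ominus>\<^bsub>Val M c\<^esub> (?\<chi> x \<odot>\<^bsub>Val M c\<^esub> m i) \<in> ?W"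
        using gW[OF xF(1)] xF(2) \<chi>x s(2) by (simp add: a_minus_def)
      have 2: "?\<chi> x \<odot>\<^bsub>Val M c\<^esub> m i \<in> ?W"
        using submodule_minus[OF Mc W submodule_zero[OF W] 1] \<chi>x s(2) by (simp add: a_minus_def)
      have "(inv\<^bsub>K\<^esub> ?\<chi> x) \<odot>\<^bsub>Val M c\<^esub> (?\<chi> x \<odot>\<^bsub>Val M c\<^esub> m i) = m i"
        using inv \<chi>x s(2) by (simp add: Mc.smult_assoc1[symmetric])
      then have "m i \<in> ?W" using submodule_smult[OF W inv(1) 2] by simp
      then have "rad c \<union> T c \<subseteq> ?W" using Wsup by blast
      then have "carrier (Val M c) \<subseteq> ?W" using span_minimal[OF W] Tspan[OF c] by blast
      then show False using Tmin[OF c s(1)] submodule_subset[OF W] by blast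
    qed
  qed
  moreover have "finitely_spanned K (Val F c)" if c: "c \<in> Obj C" for c
  proof (rule finitely_spanned_mbasis[OF B'(4)[OF c]])
    let ?A = "SIGMA i:I. Hom C (b i) c" and ?U = "{u \<in> Arr C. Cod C u = c \<and> Dom C u \<in> S}"
    let ?h = "\<lambda>(i, w). (w, m i)"
    have "?h ` ?A \<subseteq> (SIGMA u:?U. T (Dom C u))" using bm by (auto simp: Hom_def)
    moreover have "finite (SIGMA u:?U. T (Dom C u))"
      using finite_incoming[OF c] Tfin S_Obj by (intro finite_SigmaI) auto
    ultimately have "finite (?h ` ?A)" by (rule finite_subset)
    moreover have "inj_on ?h ?A"
      using bm_inj by (auto simp: inj_on_def Hom_def)
    ultimately show "finite ?A" by (rule finite_imageD)
  qed
  ultimately show ?thesis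
    using cbasis_imp_free[OF K B] M unfolding free_cover_def by blast
qed

lemma cover_chain_exists:
  fixes M :: "('a, 'b, 'k, 'w) cmod"
  assumes K: "field K" and M: "is_cmod C K M" and sup: "supported C S M"
    and fs: "\<And>c. c \<in> Obj C \<Longrightarrow> finitely_spanned K (Val M c)"
  shows "\<exists>(X :: ('a, 'b, 'k, nat \<Rightarrow> 'b \<Rightarrow> 'k) ccomplex) \<epsilon>. cover_chain C K X M \<epsilon>"
proof -
  have ker: "is_cmod C K (cmod_ker F N f)" "supported C S (cmod_ker F N f)"
    "\<forall>c\<in>Obj C. finitely_spanned K (Val (cmod_ker F N f) c)"
    if F: "free_cover C K F N f" and N: "supported C S N" and Ffs: "\<forall>c\<in>Obj C. finitely_spanned K (Val F c)"
    for F :: "('a, 'b, 'k, nat \<Rightarrow> 'b \<Rightarrow> 'k) cmod" and N :: "('a, 'b, 'k, 'u) cmod" and f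
  proof -
    note D = free_coverD[OF F]
    show "is_cmod C K (cmod_ker F N f)" by (rule is_cmod_ker[OF D(2,3,6)])
    show "supported C S (cmod_ker F N f)" by (rule free_cover_supported(2)[OF K F N])
    show "\<forall>c\<in>Obj C. finitely_spanned K (Val (cmod_ker F N f) c)"
    proof
      fix c assume c: "c \<in> Obj C"
      show "finitely_spanned K (Val (cmod_ker F N f) c)"
        using finitely_spanned_submodule[OF K cmod_module[OF D(2) c] _ submodule_ker[OF D(2,3,6) c]] Ffs c
        by (simp add: cmod_ker_def)
    qed
  qed
  obtain F0 :: "('a, 'b, 'k, nat \<Rightarrow> 'b \<Rightarrow> 'k) cmod" and \<epsilon> where
    F0: "free_cover C K F0 M \<epsilon>" "\<forall>c\<in>Obj C. finitely_spanned K (Val F0 c)"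
    using free_cover_exists[OF K M sup fs] by blast
  define t0 :: "('a, 'b, 'k, nat \<Rightarrow> 'b \<Rightarrow> 'k) cmod \<times> ('a, 'b, 'k, nat \<Rightarrow> 'b \<Rightarrow> 'k) cmod
      \<times> ('a \<Rightarrow> (nat \<Rightarrow> 'b \<Rightarrow> 'k) \<Rightarrow> (nat \<Rightarrow> 'b \<Rightarrow> 'k))"
    where "t0 = (F0, cmod_ker F0 M \<epsilon>, undefined)"
  \<comment> \<open>A state consists of a term, its kernel, and the map out of the term; the last component of
    the initial state is a dummy, since \<open>\<epsilon>\<close> has another codomain.\<close>
  define P where "P i t \<longleftrightarrow> is_cmod C K (fst (snd t)) \<and> supported C S (fst (snd t)) \<and>
      (\<forall>c\<in>Obj C. finitely_spanned K (Val (fst (snd t)) c)) \<and> (i = 0 \<longrightarrow> t = t0)"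
    for i :: nat and t :: "('a, 'b, 'k, nat \<Rightarrow> 'b \<Rightarrow> 'k) cmod \<times> ('a, 'b, 'k, nat \<Rightarrow> 'b \<Rightarrow> 'k) cmod
      \<times> ('a \<Rightarrow> (nat \<Rightarrow> 'b \<Rightarrow> 'k) \<Rightarrow> (nat \<Rightarrow> 'b \<Rightarrow> 'k))"
  define Q where "Q i t t' \<longleftrightarrow> free_cover C K (fst t') (fst (snd t)) (snd (snd t')) \<and>
      fst (snd t') = cmod_ker (fst t') (fst (snd t)) (snd (snd t'))"
    for i :: nat and t t' :: "('a, 'b, 'k, nat \<Rightarrow> 'b \<Rightarrow> 'k) cmod \<times> ('a, 'b, 'k, nat \<Rightarrow> 'b \<Rightarrow> 'k) cmod
      \<times> ('a \<Rightarrow> (nat \<Rightarrow> 'b \<Rightarrow> 'k) \<Rightarrow> (nat \<Rightarrow> 'b \<Rightarrow> 'k))"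
  have "P 0 t0" using ker[OF F0(1) sup F0(2)] by (simp add: P_def t0_def)
  then have "\<exists>t. P 0 t" ..
  moreover have "\<exists>t'. P (Suc i) t' \<and> Q i t t'" if "P i t" for i t
  proof -
    have N: "is_cmod C K (fst (snd t))" "supported C S (fst (snd t))"
      "\<And>c. c \<in> Obj C \<Longrightarrow> finitely_spanned K (Val (fst (snd t)) c)"
      using that by (auto simp: P_def)
    obtain F' :: "('a, 'b, 'k, nat \<Rightarrow> 'b \<Rightarrow> 'k) cmod" and d' where
      F': "free_cover C K F' (fst (snd t)) d'" "\<forall>c\<in>Obj C. finitely_spanned K (Val F' c)"
      using free_cover_exists[OF K N] by blast
    show ?thesis
      using ker[OF F'(1) N(2) F'(2)] F'(1)
      by (intro exI[of _ "(F', cmod_ker F' (fst (snd t)) d', d')"]) (simp add: P_def Q_def)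
  qed
  ultimately have "\<exists>t. \<forall>i. P i (t i) \<and> Q i (t i) (t (Suc i))"
    by (rule dependent_nat_choice)
  then obtain t where t: "\<And>i. P i (t i)" "\<And>i. Q i (t i) (t (Suc i))" by blast
  have t0: "t 0 = (F0, cmod_ker F0 M \<epsilon>, undefined)" using t(1)[of 0] by (simp add: P_def t0_def)
  define X where "X = \<lparr>Term = (\<lambda>i. fst (t i)), Diff = (\<lambda>i. snd (snd (t (Suc i))))\<rparr>"
  have Q: "free_cover C K (Term X (Suc i)) (fst (snd (t i))) (Diff X i)"
    "fst (snd (t (Suc i))) = cmod_ker (Term X (Suc i)) (fst (snd (t i))) (Diff X i)" for i
    using t(2)[of i] by (simp_all add: X_def Q_def)
  have s: "syz X M \<epsilon> i = fst (snd (t i))" for i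
  proof (induction i)
    case 0 then show ?case by (simp add: t0 X_def)
  next
    case (Suc i) then show ?case unfolding syz_Suc Q(2) by simp
  qed
  have "cover_chain C K X M \<epsilon>" unfolding cover_chain_def s using Q(1) F0(1) by (simp add: X_def t0)
  then show ?thesis by blast
qed

end

context graded_category
begin

text \<open>Elements coming from other objects have coordinate zero at \<open>e j\<close>, so \<open>e j\<close> is not a combination of
  them.\<close>

lemma SP_nonzero:
  assumes K: "field K" and B: "cbasis C K P I b e \<chi>" and j: "j \<in> I"
  shows "carrier (SP C K P (b j)) \<noteq> {\<zero>\<^bsub>SP C K P (b j)\<^esub>}"
proof
  let ?c = "b j"
  interpret K: field K by fact
  have Kc: "cring K" by (rule K.is_cring)
  note B' = cbasisD[OF B]
  have c: "?c \<in> Obj C" by (rule B'(2)[OF j])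
  note Pc = cmod_module[OF B'(1) c]
  interpret P: module K "Val P ?c" by (rule Pc)
  let ?R = "\<Union>u\<in>{u \<in> Arr C. Cod C u = ?c \<and> \<not> cat_iso C u}. Act P u ` carrier (Val P (Dom C u))"
  let ?H = "submod_span K (Val P ?c) ?R"
  let ?Z = "{y \<in> carrier (Val P ?c). \<chi> ?c (j, Ide C ?c) y = \<zero>\<^bsub>self_mod K\<^esub>}"
  have Rsub: "?R \<subseteq> carrier (Val P ?c)" using act_closed[OF B'(1)] by (fastforce simp: Hom_def)
  note H = submodule_span[OF Pc Rsub]
  have Z: "submodule ?Z K (Val P ?c)"
    by (rule submodule_kernel[OF Pc module_self[OF Kc] cbasis_coord[OF B c j Ide_in_Hom[OF c]]])
  have "?R \<subseteq> ?Z"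
  proof clarify
    fix u x assume u: "u \<in> Arr C" "Cod C u = ?c" "\<not> cat_iso C u" and x: "x \<in> carrier (Val P (Dom C u))"
    have uh: "u \<in> Hom C (Dom C u) ?c" using u by (simp add: Hom_def)
    then have "Dom C u \<noteq> ?c" using noniso_iff[OF uh] u(3) by simp
    then show "Act P u x \<in> carrier (Val P ?c) \<and> \<chi> ?c (j, Ide C ?c) (Act P u x) = \<zero>\<^bsub>self_mod K\<^esub>"
      using coord_act_zero[OF Kc B j refl uh _ x] act_closed[OF B'(1) uh x] by simp
  qed
  then have HZ: "?H \<subseteq> ?Z" by (rule span_minimal[OF Z])
  assume "carrier (SP C K P ?c) = {\<zero>\<^bsub>SP C K P ?c\<^esub>}"
  then have "?H +>\<^bsub>Val P ?c\<^esub> e j = ?H"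
    using B'(3)[OF j] by (auto simp: SP_def quot_carrier quot_zero)
  then have "e j \<in> ?Z" using coset_self[OF Pc H B'(3)[OF j]] HZ by blast
  then show False using coord_elt[OF B j refl] K.one_not_zero by simp
qed

lemma betti_obj_subset:
  fixes K :: "('k, 'z) ring_scheme"
  assumes K: "field K" and M: "supported C S M"
  shows "betti_obj C K M \<subseteq> S"
proof
  fix c assume "c \<in> betti_obj C K M"
  then obtain X :: "('o, 'm, 'k, nat \<Rightarrow> 'm \<Rightarrow> 'k) ccomplex" and i where c: "c \<in> Obj C"
    and X: "minimal_free_resolution C K X M" and SP: "carrier (SP C K (Term X i) c) \<noteq> {\<zero>\<^bsub>SP C K (Term X i) c\<^esub>}"
    by (auto simp: betti_obj_def)
  obtain \<epsilon> where \<epsilon>: "cover_chain C K X M \<epsilon>" using minimal_free_resolution_imp_cover_chain[OF X] by blast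
  show "c \<in> S"
  proof (rule ccontr)
    assume "c \<notin> S"
    then have P0: "carrier (Val (Term X i) c) = {\<zero>\<^bsub>Val (Term X i) c\<^esub>}"
      using cover_chain_supported[OF K \<epsilon> M, of i] c by (auto simp: supported_def)
    have P: "is_cmod C K (Term X i)" by (rule cover_chain_cmod[OF \<epsilon>])
    note Pc = cmod_module[OF P c]
    interpret P: module K "Val (Term X i) c" by (rule Pc)
    let ?R = "\<Union>u\<in>{u \<in> Arr C. Cod C u = c \<and> \<not> cat_iso C u}. Act (Term X i) u ` carrier (Val (Term X i) (Dom C u))"
    have "?R \<subseteq> carrier (Val (Term X i) c)" using act_closed[OF P Arr_Hom] by auto
    from P.a_coset_add_zero[OF submodule_subset[OF submodule_span[OF Pc this]]]
    show False using SP P0 by (auto simp: SP_def quot_carrier quot_zero)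
  qed
qed

end

context locally_finite_graded_category
begin

text \<open>The Betti degrees refer to resolutions with values in one particular type; an arbitrary resolution is
  isomorphic to one of those.\<close>

lemma gens_in_betti_obj:
  fixes M :: "('a, 'b, 'k, 'w) cmod"
  assumes K: "field K" and M: "is_cmod C K M" and sup: "supported C S M"
    and fs: "\<And>c. c \<in> Obj C \<Longrightarrow> finitely_spanned K (Val M c)"
    and Y: "cover_chain C K Y M \<delta>" and B: "cbasis C K (Term Y i) I b e \<chi>"
  shows "b ` I \<subseteq> betti_obj C K M"
proof clarify
  fix j assume j: "j \<in> I"
  interpret K: field K by fact
  have Kc: "cring K" by (rule K.is_cring)
  obtain X :: "('a, 'b, 'k, nat \<Rightarrow> 'b \<Rightarrow> 'k) ccomplex" and \<epsilon> where X: "cover_chain C K X M \<epsilon>"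
    using cover_chain_exists[OF K M sup fs] by blast
  have "cmod_iso C K M M (\<lambda>c x. x)" by (rule cmod_isoI[OF cmod_hom_id cmod_hom_id]) auto
  from cover_chain_unique[OF Kc Y X this]
  obtain \<phi> where "cmod_iso C K (Term Y i) (Term X i) (\<phi> i)" by blast
  from SP_nonzero[OF K cbasis_iso[OF B cover_chain_cmod[OF X] this] j]
  show "b j \<in> betti_obj C K M"
    unfolding betti_obj_def
    using cover_chain_imp_minimal_free_resolution[OF Kc X] cbasis_obj[OF B j] by blast
qed

end

section \<open>Induction along a functor\<close>

text \<open>The element \<open>u \<otimes> x\<close> of the colimit, for \<open>p = (b, u)\<close> and \<open>x\<close> in \<open>N b\<close>.\<close>

definition ind_class ::
  "('o, 'm) cat \<Rightarrow> ('p, 'n) cat \<Rightarrow> ('k, 'z) ring_scheme \<Rightarrow> ('o, 'm, 'p, 'n) func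
     \<Rightarrow> ('o, 'm, 'k, 'v) cmod \<Rightarrow> 'p \<Rightarrow> 'o \<times> 'n \<Rightarrow> 'v \<Rightarrow> ('o \<times> 'n \<Rightarrow> 'v) set" where
  "ind_class B C K F N d p x = ind_rel B C K F N d +>\<^bsub>ind_sum B C F N d\<^esub> ind_single B C F N d p x"

locale induction_along = B: category B + C: category C + K: cring K
  for B :: "('o, 'm) cat" and C :: "('p, 'n) cat" and K :: "('k, 'z) ring_scheme" +
  fixes F :: "('o, 'm, 'p, 'n) func"
  assumes F: "is_func B C F"
begin

abbreviation "comma \<equiv> comma_obj B C F"
abbreviation "isum N \<equiv> ind_sum B C F N"
abbreviation "isingle N \<equiv> ind_single B C F N"
abbreviation "irel N \<equiv> ind_rel B C K F N"
abbreviation "icls N \<equiv> ind_class B C K F N"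
abbreviation "ind N \<equiv> ind_cmod B C K F N"

lemma comma_iff: "(b, u) \<in> comma d \<longleftrightarrow> b \<in> Obj B \<and> u \<in> Hom C (FObj F b) d"
  by (auto simp: comma_obj_def)

lemma comma_step:
  assumes "v \<in> Hom B b b'" "u \<in> Hom C (FObj F b') d"
  shows "(b, Comp C u (FArr F v)) \<in> comma d" "(b', u) \<in> comma d"
  using assms B.Hom_objD[OF assms(1)] C.Comp_in_Hom[OF func_Hom[OF F assms(1)] assms(2)]
  by (auto simp: comma_iff)

lemma comma_post:
  assumes "w \<in> Hom C d d'" "(b, u) \<in> comma d" shows "(b, Comp C w u) \<in> comma d'"
  using assms C.Comp_in_Hom by (auto simp: comma_iff)

lemma module_summand:
  assumes "is_cmod B K N" "p \<in> comma d" shows "module K (case p of (b, u) \<Rightarrow> Val N b)"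
  using assms by (auto simp: comma_obj_def intro: cmod_module)

lemma module_isum: "is_cmod B K N \<Longrightarrow> module K (isum N d)"
  unfolding ind_sum_def by (rule module_dsum[OF K.is_cring module_summand])

lemma lin_map_isingle:
  assumes N: "is_cmod B K N" and p: "(b, u) \<in> comma d"
  shows "lin_map K (Val N b) (isum N d) (isingle N d (b, u))"
  unfolding ind_sum_def ind_single_def
  using lin_map_dsum_single[of K "comma d" "\<lambda>(b, u). Val N b", OF K.is_cring module_summand[OF N] p] by simp

text \<open>A map out of the direct sum descends to the colimit once it respects these generators of the
  submodule of relations (\<open>ind_descend\<close> below).\<close>

definition irel_gens :: "('o, 'm, 'k, 'v) cmod \<Rightarrow> 'p \<Rightarrow> ('o \<times> 'n \<Rightarrow> 'v) set" where
  "irel_gens N d = {isingle N d (Dom B v, Comp C u (FArr F v)) x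
        \<ominus>\<^bsub>isum N d\<^esub> isingle N d (Cod B v, u) (Act N v x) | u v x.
        v \<in> Arr B \<and> u \<in> Hom C (FObj F (Cod B v)) d \<and> x \<in> carrier (Val N (Dom B v))}"

lemma irel_span: "irel N d = submod_span K (isum N d) (irel_gens N d)"
  by (simp add: ind_rel_def irel_gens_def)

lemma irel_gensI:
  assumes "v \<in> Hom B b b'" "u \<in> Hom C (FObj F b') d" "x \<in> carrier (Val N b)"
  shows "isingle N d (b, Comp C u (FArr F v)) x \<ominus>\<^bsub>isum N d\<^esub> isingle N d (b', u) (Act N v x) \<in> irel_gens N d"
proof -
  have "v \<in> Arr B" "Dom B v = b" "Cod B v = b'" using assms(1) by (auto simp: Hom_def)
  then show ?thesis using assms(2,3) unfolding irel_gens_def by blast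
qed

lemma irel_gensE:
  assumes "y \<in> irel_gens N d"
  obtains b b' v u x where "v \<in> Hom B b b'" "u \<in> Hom C (FObj F b') d" "x \<in> carrier (Val N b)"
    "y = isingle N d (b, Comp C u (FArr F v)) x \<ominus>\<^bsub>isum N d\<^esub> isingle N d (b', u) (Act N v x)"
  using assms unfolding irel_gens_def by (auto dest: Arr_Hom)

lemma isingle_step:
  assumes N: "is_cmod B K N" and v: "v \<in> Hom B b b'" and u: "u \<in> Hom C (FObj F b') d" and x: "x \<in> carrier (Val N b)"
  shows "isingle N d (b, Comp C u (FArr F v)) x \<in> carrier (isum N d)"
    and "isingle N d (b', u) (Act N v x) \<in> carrier (isum N d)"
  using lin_map_closed[OF lin_map_isingle[OF N comma_step(1)[OF v u]] x]
    lin_map_closed[OF lin_map_isingle[OF N comma_step(2)[OF v u]] act_closed[OF N v x]] by auto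

lemma irel_gens_sub:
  assumes N: "is_cmod B K N" shows "irel_gens N d \<subseteq> carrier (isum N d)"
proof
  interpret S: module K "isum N d" by (rule module_isum[OF N])
  fix y assume "y \<in> irel_gens N d"
  then show "y \<in> carrier (isum N d)"
    by (rule irel_gensE) (use isingle_step[OF N] in auto)
qed

lemma submodule_irel: "is_cmod B K N \<Longrightarrow> submodule (irel N d) K (isum N d)"
  unfolding irel_span by (rule submodule_span[OF module_isum irel_gens_sub])

lemma Val_ind: "Val (ind N) d = quot_mod (isum N d) (irel N d)"
  by (simp add: ind_cmod_def)

lemma module_ind: "is_cmod B K N \<Longrightarrow> module K (Val (ind N) d)"
  unfolding Val_ind by (rule module_quot[OF module_isum submodule_irel])

lemma lin_map_icls:
  assumes N: "is_cmod B K N" and p: "(b, u) \<in> comma d"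
  shows "lin_map K (Val N b) (Val (ind N) d) (icls N d (b, u))"
  unfolding Val_ind ind_class_def
  by (rule lin_map_comp[OF lin_map_isingle[OF N p] lin_map_coset[OF module_isum[OF N] submodule_irel[OF N]]])

lemma icls_rel:
  assumes N: "is_cmod B K N" and v: "v \<in> Hom B b b'" and u: "u \<in> Hom C (FObj F b') d" and x: "x \<in> carrier (Val N b)"
  shows "icls N d (b, Comp C u (FArr F v)) x = icls N d (b', u) (Act N v x)"
  unfolding ind_class_def
  using coset_eq_iff[OF module_isum[OF N] submodule_irel[OF N] isingle_step[OF N v u x]]
    irel_gensI[OF v u x] span_superset[of "irel_gens N d" K "isum N d"] irel_span[of N d] by auto

lemma span_icls:
  assumes N: "is_cmod B K N"
  shows "submod_span K (Val (ind N) d) (\<Union>(b, u)\<in>comma d. icls N d (b, u) ` carrier (Val N b))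
      = carrier (Val (ind N) d)"
    and "(\<Union>(b, u)\<in>comma d. icls N d (b, u) ` carrier (Val N b)) \<subseteq> carrier (Val (ind N) d)"
proof -
  let ?S = "\<Union>p\<in>comma d. dsum_single (comma d) (\<lambda>(b, u). Val N b) p ` carrier (case p of (b, u) \<Rightarrow> Val N b)"
  have S: "?S \<subseteq> carrier (isum N d)"
    unfolding ind_sum_def
    using dsum_single_carrier[of "comma d" K "\<lambda>(b, u). Val N b", OF module_summand[where d = d, OF N]] by blast
  have "submod_span K (isum N d) ?S = carrier (isum N d)"
    unfolding ind_sum_def
    by (rule span_dsum[OF K.is_cring module_summand[OF N] order_refl span_carrier[OF module_summand[OF N]]])
  from span_quot[OF module_isum[OF N] submodule_irel[OF N] S this]
  have 1: "submod_span K (Val (ind N) d) ((\<lambda>x. irel N d +>\<^bsub>isum N d\<^esub> x) ` ?S) = carrier (Val (ind N) d)"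
    by (simp add: Val_ind)
  have 2: "(\<lambda>x. irel N d +>\<^bsub>isum N d\<^esub> x) ` ?S = (\<Union>(b, u)\<in>comma d. icls N d (b, u) ` carrier (Val N b))"
    by (auto simp: ind_class_def ind_single_def image_UN image_image)
  show "submod_span K (Val (ind N) d) (\<Union>(b, u)\<in>comma d. icls N d (b, u) ` carrier (Val N b))
      = carrier (Val (ind N) d)" using 1 unfolding 2 .
  show "(\<Union>(b, u)\<in>comma d. icls N d (b, u) ` carrier (Val N b)) \<subseteq> carrier (Val (ind N) d)"
    using lin_map_closed[OF lin_map_icls[OF N]] by fastforce
qed

lemma ind_ext:
  assumes N: "is_cmod B K N" and W: "module K W" and f: "lin_map K (Val (ind N) d) W f"
    and g: "lin_map K (Val (ind N) d) W g"
    and eq: "\<And>b u x. (b, u) \<in> comma d \<Longrightarrow> x \<in> carrier (Val N b) \<Longrightarrow> f (icls N d (b, u) x) = g (icls N d (b, u) x)"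
    and X: "X \<in> carrier (Val (ind N) d)"
  shows "f X = g X"
  by (rule lin_map_ext[OF module_ind[OF N] W f g span_icls(2,1)[OF N] _ X]) (use eq in auto)

lemma ind_descend:
  assumes N: "is_cmod B K N" and W: "module K W" "submodule H K W" and f: "lin_map K (isum N d) W f"
    and eq: "\<And>b b' v u x. v \<in> Hom B b b' \<Longrightarrow> u \<in> Hom C (FObj F b') d \<Longrightarrow> x \<in> carrier (Val N b) \<Longrightarrow>
      f (isingle N d (b, Comp C u (FArr F v)) x) \<ominus>\<^bsub>W\<^esub> f (isingle N d (b', u) (Act N v x)) \<in> H"
    and y: "y \<in> irel N d"
  shows "f y \<in> H"
proof (rule span_image_subset[OF module_isum[OF N] W(1) f W(2) irel_gens_sub[OF N] _ y[unfolded irel_span]])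
  fix z assume "z \<in> irel_gens N d"
  then show "f z \<in> H"
  proof (rule irel_gensE)
    fix b b' v u x assume h: "v \<in> Hom B b b'" "u \<in> Hom C (FObj F b') d" "x \<in> carrier (Val N b)"
      and z: "z = isingle N d (b, Comp C u (FArr F v)) x \<ominus>\<^bsub>isum N d\<^esub> isingle N d (b', u) (Act N v x)"
    show "f z \<in> H"
      unfolding z lin_map_minus[OF module_isum[OF N] W(1) f isingle_step[OF N h]] by (rule eq[OF h])
  qed
qed

lemma ind_act:
  assumes N: "is_cmod B K N" and w: "w \<in> Hom C d d'"
  shows "lin_map K (Val (ind N) d) (Val (ind N) d') (Act (ind N) w)"
    and "\<And>b u x. (b, u) \<in> comma d \<Longrightarrow> x \<in> carrier (Val N b) \<Longrightarrow>
      Act (ind N) w (icls N d (b, u) x) = icls N d' (b, Comp C w u) x"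
proof -
  let ?V = "\<lambda>(b, u). Val N b" and ?h = "\<lambda>(b, u). (b, Comp C w u)"
  let ?p = "dsum_push (comma d) (comma d') ?V ?V ?h"
  have dw: "Dom C w = d" "Cod C w = d'" using w by (auto simp: Hom_def)
  have h: "?h p \<in> comma d'" "?V (?h p) = ?V p" if "p \<in> comma d" for p
    using comma_post[OF w] that by (cases p, auto)+
  have plin: "lin_map K (isum N d) (isum N d') ?p"
    unfolding ind_sum_def
    by (rule lin_map_dsum_push[where V = ?V and W = ?V, OF K.is_cring module_summand[where d = d, OF N] module_summand[where d = d', OF N] h])
  have psingle: "?p (isingle N d (b, u) x) = isingle N d' (b, Comp C w u) x"
    if "(b, u) \<in> comma d" "x \<in> carrier (Val N b)" for b u x
    unfolding ind_single_def
    using dsum_push_single[of K "comma d" ?V "comma d'" ?V ?h "(b, u)" x, OF K.is_cring module_summand[where d = d, OF N] module_summand[where d = d', OF N] h] that by simp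
  have prel: "?p y \<in> irel N d'" if y: "y \<in> irel N d" for y
  proof (rule ind_descend[OF N module_isum[OF N] submodule_irel[OF N] plin _ y])
    fix b b' v u x assume v: "v \<in> Hom B b b'" and u: "u \<in> Hom C (FObj F b') d" and x: "x \<in> carrier (Val N b)"
    have "Comp C w (Comp C u (FArr F v)) = Comp C (Comp C w u) (FArr F v)"
      by (rule C.Comp_assoc[OF func_Hom[OF F v] u w])
    then show "?p (isingle N d (b, Comp C u (FArr F v)) x) \<ominus>\<^bsub>isum N d'\<^esub> ?p (isingle N d (b', u) (Act N v x)) \<in> irel N d'"
      using irel_gensI[OF v C.Comp_in_Hom[OF u w] x] span_superset[of "irel_gens N d'" K "isum N d'"]
      by (auto simp: psingle[OF comma_step(1)[OF v u] x] psingle[OF comma_step(2)[OF v u] act_closed[OF N v x]] irel_span)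
  qed
  have A: "Act (ind N) w = (\<lambda>X. \<Union>g\<in>X. irel N d' +>\<^bsub>isum N d'\<^esub> ?p g)"
    by (simp add: ind_cmod_def dw)
  show "lin_map K (Val (ind N) d) (Val (ind N) d') (Act (ind N) w)"
    unfolding A Val_ind
    by (rule lin_map_quot[OF module_isum[OF N] submodule_irel[OF N] module_isum[OF N] submodule_irel[OF N] plin prel])
  show "Act (ind N) w (icls N d (b, u) x) = icls N d' (b, Comp C w u) x"
    if p: "(b, u) \<in> comma d" "x \<in> carrier (Val N b)" for b u x
    unfolding A ind_class_def psingle[OF p, symmetric]
    by (rule coset_UN[OF module_isum[OF N] submodule_irel[OF N] module_isum[OF N] submodule_irel[OF N] plin prel
          lin_map_closed[OF lin_map_isingle[OF N p(1)] p(2)]])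
qed

lemma is_cmod_ind:
  assumes N: "is_cmod B K N" shows "is_cmod C K (ind N)"
proof (rule is_cmodI[OF module_ind[OF N] ind_act(1)[OF N]])
  fix d X assume d: "d \<in> Obj C" and X: "X \<in> carrier (Val (ind N) d)"
  show "Act (ind N) (Ide C d) X = X"
    by (rule ind_ext[OF N module_ind[OF N] ind_act(1)[OF N C.Ide_in_Hom[OF d]] lin_map_id _ X])
      (auto simp: ind_act(2)[OF N C.Ide_in_Hom[OF d]] comma_iff C.Ide_Comp)
next
  fix d d' d'' w w' X assume w: "w \<in> Hom C d d'" "w' \<in> Hom C d' d''" and X: "X \<in> carrier (Val (ind N) d)"
  note ww = C.Comp_in_Hom[OF w]
  show "Act (ind N) (Comp C w' w) X = Act (ind N) w' (Act (ind N) w X)"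
  proof (rule ind_ext[OF N module_ind[OF N] ind_act(1)[OF N ww] lin_map_comp[OF ind_act(1)[OF N w(1)] ind_act(1)[OF N w(2)]] _ X])
    fix b u x assume p: "(b, u) \<in> comma d" and x: "x \<in> carrier (Val N b)"
    have "Comp C w' (Comp C w u) = Comp C (Comp C w' w) u"
      using p w by (intro C.Comp_assoc) (auto simp: comma_iff)
    then show "Act (ind N) (Comp C w' w) (icls N d (b, u) x) = Act (ind N) w' (Act (ind N) w (icls N d (b, u) x))"
      using ind_act(2)[OF N ww p x] ind_act(2)[OF N w(1) p x] ind_act(2)[OF N w(2) comma_post[OF w(1) p] x] by simp
  qed
qed (use ind_act(1)[OF N] in auto)

text \<open>The half of the adjunction between induction and restriction that constructs homomorphisms out of
  an induced module; by \<open>ind_ext\<close> the formula determines them.\<close>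

lemma ind_lift:
  assumes N: "is_cmod B K N" and X: "is_cmod C K X" and f: "cmod_hom B K N (res_cmod F X) f"
  shows "\<exists>\<Psi>. cmod_hom C K (ind N) X \<Psi> \<and> (\<forall>d\<in>Obj C. \<forall>(b, u)\<in>comma d. \<forall>x\<in>carrier (Val N b).
    \<Psi> d (icls N d (b, u) x) = Act X u (f b x))"
proof -
  have fl: "lin_map K (Val N b) (Val X (FObj F b)) (f b)" if "b \<in> Obj B" for b
    using hom_lin[OF f that] by simp
  have fn: "f b' (Act N v x) = Act X (FArr F v) (f b x)" if "v \<in> Hom B b b'" "x \<in> carrier (Val N b)" for v b b' x
    using hom_nat[OF f that] by simp
  have "\<exists>G. lin_map K (Val (ind N) d) (Val X d) G \<and> (\<forall>(b, u)\<in>comma d. \<forall>x\<in>carrier (Val N b).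
    G (icls N d (b, u) x) = Act X u (f b x))" if d: "d \<in> Obj C" for d
  proof -
    note Xd = cmod_module[OF X d]
    interpret Xd: module K "Val X d" by (rule Xd)
    let ?V = "\<lambda>(b, u). Val N b" and ?g = "\<lambda>(b, u) x. Act X u (f b x)"
    have g: "lin_map K (?V p) (Val X d) (?g p)" if "p \<in> comma d" for p
    proof -
      obtain b u where p: "p = (b, u)" by (cases p)
      with that have "b \<in> Obj B" "u \<in> Hom C (FObj F b) d" by (auto simp: comma_iff)
      from lin_map_comp[OF fl[OF this(1)] act_lin[OF X this(2)]] show ?thesis using p by simp
    qed
    obtain G0 where G0: "lin_map K (isum N d) (Val X d) G0"
      "\<forall>p\<in>comma d. \<forall>x\<in>carrier (?V p). G0 (dsum_single (comma d) ?V p x) = ?g p x"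
      using dsum_copair[of K "comma d" ?V "Val X d" ?g, OF K.is_cring module_summand[where d = d, OF N] Xd g]
      unfolding ind_sum_def by blast
    have Gs: "G0 (isingle N d (b, u) x) = Act X u (f b x)" if "(b, u) \<in> comma d" "x \<in> carrier (Val N b)" for b u x
      using G0(2) that unfolding ind_single_def by fastforce
    have "G0 y \<in> {\<zero>\<^bsub>Val X d\<^esub>}" if y: "y \<in> irel N d" for y
    proof (rule ind_descend[OF N Xd submodule_zero_set[OF Xd] G0(1) _ y])
      fix b b' v u x assume v: "v \<in> Hom B b b'" and u: "u \<in> Hom C (FObj F b') d" and x: "x \<in> carrier (Val N b)"
      have fx: "f b x \<in> carrier (Val X (FObj F b))" using lin_map_closed[OF fl x] B.Hom_objD[OF v] by simp
      have "Act X (Comp C u (FArr F v)) (f b x) = Act X u (f b' (Act N v x))"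
        using act_Comp[OF X func_Hom[OF F v] u fx] fn[OF v x] by simp
      moreover have "Act X (Comp C u (FArr F v)) (f b x) \<in> carrier (Val X d)"
        using act_closed[OF X C.Comp_in_Hom[OF func_Hom[OF F v] u] fx] .
      ultimately show "G0 (isingle N d (b, Comp C u (FArr F v)) x) \<ominus>\<^bsub>Val X d\<^esub> G0 (isingle N d (b', u) (Act N v x)) \<in> {\<zero>\<^bsub>Val X d\<^esub>}"
        using Gs[OF comma_step(1)[OF v u] x] Gs[OF comma_step(2)[OF v u] act_closed[OF N v x]]
        by (simp add: a_minus_def Xd.r_neg)
    qed
    then have "\<And>y. y \<in> irel N d \<Longrightarrow> G0 y = \<zero>\<^bsub>Val X d\<^esub>" by simp
    from quot_lift[OF module_isum[OF N] submodule_irel[OF N] Xd G0(1) this]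
    obtain G where G: "lin_map K (Val (ind N) d) (Val X d) G"
      "\<And>y. y \<in> carrier (isum N d) \<Longrightarrow> G (irel N d +>\<^bsub>isum N d\<^esub> y) = G0 y"
      unfolding Val_ind by blast
    have "G (icls N d (b, u) x) = Act X u (f b x)" if "(b, u) \<in> comma d" "x \<in> carrier (Val N b)" for b u x
      unfolding ind_class_def using G(2)[OF lin_map_closed[OF lin_map_isingle[OF N that(1)] that(2)]] Gs[OF that] by simp
    then show ?thesis using G(1) by blast
  qed
  then obtain \<Psi> where \<Psi>: "\<And>d. d \<in> Obj C \<Longrightarrow> lin_map K (Val (ind N) d) (Val X d) (\<Psi> d)"
    "\<And>d b u x. d \<in> Obj C \<Longrightarrow> (b, u) \<in> comma d \<Longrightarrow> x \<in> carrier (Val N b) \<Longrightarrow> \<Psi> d (icls N d (b, u) x) = Act X u (f b x)"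
    by (simp add: split_beta Ball_def) metis
  have "cmod_hom C K (ind N) X \<Psi>"
  proof (rule cmod_homI[OF \<Psi>(1)])
    fix d d' w Y assume w: "w \<in> Hom C d d'" and Y: "Y \<in> carrier (Val (ind N) d)"
    note dd = C.Hom_objD[OF w]
    show "\<Psi> d' (Act (ind N) w Y) = Act X w (\<Psi> d Y)"
    proof (rule ind_ext[OF N cmod_module[OF X dd(2)] lin_map_comp[OF ind_act(1)[OF N w] \<Psi>(1)[OF dd(2)]]
          lin_map_comp[OF \<Psi>(1)[OF dd(1)] act_lin[OF X w]] _ Y])
      fix b u x assume p: "(b, u) \<in> comma d" and x: "x \<in> carrier (Val N b)"
      have bu: "b \<in> Obj B" "u \<in> Hom C (FObj F b) d" using p by (auto simp: comma_iff)
      show "\<Psi> d' (Act (ind N) w (icls N d (b, u) x)) = Act X w (\<Psi> d (icls N d (b, u) x))"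
        using ind_act(2)[OF N w p x] \<Psi>(2)[OF dd(2) comma_post[OF w p] x] \<Psi>(2)[OF dd(1) p x]
          act_Comp[OF X bu(2) w lin_map_closed[OF fl[OF bu(1)] x]] by simp
    qed
  qed auto
  then show ?thesis using \<Psi>(2) by blast
qed

lemma ind_map:
  assumes N: "is_cmod B K N" and N': "is_cmod B K N'" and f: "cmod_hom B K N N' f"
  shows ind_map_icls: "\<And>d b u x. (b, u) \<in> comma d \<Longrightarrow> x \<in> carrier (Val N b) \<Longrightarrow>
      ind_map B C K F N' f d (icls N d (b, u) x) = icls N' d (b, u) (f b x)"
    and cmod_hom_ind_map: "cmod_hom C K (ind N) (ind N') (ind_map B C K F N' f)"
proof -
  let ?m = "ind_map B C K F N' f"
  have both: "lin_map K (Val (ind N) d) (Val (ind N') d) (?m d) \<and>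
      (\<forall>b u x. (b, u) \<in> comma d \<longrightarrow> x \<in> carrier (Val N b) \<longrightarrow> ?m d (icls N d (b, u) x) = icls N' d (b, u) (f b x))" for d
  proof -
    let ?V = "\<lambda>(b, u). Val N b" and ?V' = "\<lambda>(b, u). Val N' b"
    let ?q = "\<lambda>g. \<lambda>p\<in>comma d. f (fst p) (g p)"
    have fl: "lin_map K (?V p) (?V' p) (f (fst p))" if "p \<in> comma d" for p
      using that hom_lin[OF f] by (auto simp: comma_obj_def)
    note dm = lin_map_dsum_map[of "comma d" K ?V ?V' "\<lambda>p. f (fst p)", OF module_summand[where d = d, OF N] module_summand[where d = d, OF N'] fl]
    have qlin: "lin_map K (isum N d) (isum N' d) ?q" unfolding ind_sum_def by (rule dm(1))
    have qs: "?q (isingle N d (b, u) x) = isingle N' d (b, u) (f b x)" if "(b, u) \<in> comma d" "x \<in> carrier (Val N b)" for b u x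
      using dm(2)[where i = "(b, u)" and x = x] that unfolding ind_single_def by simp
    have qrel: "?q y \<in> irel N' d" if y: "y \<in> irel N d" for y
    proof (rule ind_descend[OF N module_isum[OF N'] submodule_irel[OF N'] qlin _ y])
      fix b b' v u x assume v: "v \<in> Hom B b b'" and u: "u \<in> Hom C (FObj F b') d" and x: "x \<in> carrier (Val N b)"
      have "f b x \<in> carrier (Val N' b)" using hom_closed[OF f] B.Hom_objD[OF v] x by blast
      from irel_gensI[OF v u this]
      show "?q (isingle N d (b, Comp C u (FArr F v)) x) \<ominus>\<^bsub>isum N' d\<^esub> ?q (isingle N d (b', u) (Act N v x)) \<in> irel N' d"
        unfolding qs[OF comma_step(1)[OF v u] x] qs[OF comma_step(2)[OF v u] act_closed[OF N v x]] hom_nat[OF f v x] irel_span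
        using span_superset[of "irel_gens N' d" K "isum N' d"] by blast
    qed
    have m: "?m d = (\<lambda>X. \<Union>g\<in>X. irel N' d +>\<^bsub>isum N' d\<^esub> ?q g)"
      by (simp add: ind_map_def split_beta')
    have "lin_map K (Val (ind N) d) (Val (ind N') d) (?m d)"
      unfolding m Val_ind
      by (rule lin_map_quot[OF module_isum[OF N] submodule_irel[OF N] module_isum[OF N'] submodule_irel[OF N'] qlin qrel])
    moreover have "?m d (icls N d (b, u) x) = icls N' d (b, u) (f b x)"
      if p: "(b, u) \<in> comma d" "x \<in> carrier (Val N b)" for b u x
      unfolding m ind_class_def qs[OF p, symmetric]
      by (rule coset_UN[OF module_isum[OF N] submodule_irel[OF N] module_isum[OF N'] submodule_irel[OF N'] qlin qrel
            lin_map_closed[OF lin_map_isingle[OF N p(1)] p(2)]])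
    ultimately show ?thesis by blast
  qed
  show *: "?m d (icls N d (b, u) x) = icls N' d (b, u) (f b x)"
    if "(b, u) \<in> comma d" "x \<in> carrier (Val N b)" for d b u x using both that by blast
  show "cmod_hom C K (ind N) (ind N') ?m"
  proof (rule cmod_homI)
    show "lin_map K (Val (ind N) d) (Val (ind N') d) (?m d)" for d using both by blast
    fix d d' w Y assume w: "w \<in> Hom C d d'" and Y: "Y \<in> carrier (Val (ind N) d)"
    show "?m d' (Act (ind N) w Y) = Act (ind N') w (?m d Y)"
    proof (rule ind_ext[OF N module_ind[OF N'] lin_map_comp[OF ind_act(1)[OF N w] conjunct1[OF both]]
          lin_map_comp[OF conjunct1[OF both] ind_act(1)[OF N' w]] _ Y])
      fix b u x assume p: "(b, u) \<in> comma d" and x: "x \<in> carrier (Val N b)"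
      have "f b x \<in> carrier (Val N' b)" using hom_closed[OF f] p x by (auto simp: comma_iff)
      then show "?m d' (Act (ind N) w (icls N d (b, u) x)) = Act (ind N') w (?m d (icls N d (b, u) x))"
        using ind_act(2)[OF N w p x] *[OF comma_post[OF w p] x] *[OF p x] ind_act(2)[OF N' w p] by simp
    qed
  qed
qed

text \<open>Restriction followed by induction does nothing to a free module whose generators lie over objects
  in the image of a fully faithful functor: the inverse of the counit sends a generator to its own
  class.\<close>

lemma ind_iso:
  assumes ff: "fully_faithful B C F" and N: "is_cmod B K N" and Bs: "cbasis C K X I b e \<chi>"
    and b': "\<And>j. j \<in> I \<Longrightarrow> b' j \<in> Obj B \<and> FObj F (b' j) = b j"
    and f: "cmod_iso B K N (res_cmod F X) f"
  shows "\<exists>\<Psi>. cmod_iso C K (ind N) X \<Psi> \<and> (\<forall>d\<in>Obj C. \<forall>(b, u)\<in>comma d. \<forall>x\<in>carrier (Val N b).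
    \<Psi> d (icls N d (b, u) x) = Act X u (f b x))"
proof -
  note B' = cbasisD[OF Bs]
  note X = B'(1)
  have fhom: "cmod_hom B K N (res_cmod F X) f" using f by (simp add: cmod_iso_def)
  obtain g where g: "cmod_iso B K (res_cmod F X) N g"
    "\<And>c x. c \<in> Obj B \<Longrightarrow> x \<in> carrier (Val N c) \<Longrightarrow> g c (f c x) = x"
    "\<And>c y. c \<in> Obj B \<Longrightarrow> y \<in> carrier (Val (res_cmod F X) c) \<Longrightarrow> f c (g c y) = y"
    using B.cmod_iso_inv[OF N f] by blast
  have ghom: "cmod_hom B K (res_cmod F X) N g" using g(1) by (simp add: cmod_iso_def)
  obtain \<Psi> where \<Psi>: "cmod_hom C K (ind N) X \<Psi>"
    "\<And>d b u x. d \<in> Obj C \<Longrightarrow> (b, u) \<in> comma d \<Longrightarrow> x \<in> carrier (Val N b) \<Longrightarrow> \<Psi> d (icls N d (b, u) x) = Act X u (f b x)"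
    using ind_lift[OF N X fhom] by (fastforce simp: split_beta)
  define m where "m j = icls N (b j) (b' j, Ide C (b j)) (g (b' j) (e j))" for j
  have comma_id: "(c, Ide C (FObj F c)) \<in> comma (FObj F c)" if "c \<in> Obj B" for c
    using C.Ide_in_Hom[OF func_Obj[OF F that]] that by (simp add: comma_iff)
  have ej: "e j \<in> carrier (Val X (FObj F (b' j)))" and gej: "g (b' j) (e j) \<in> carrier (Val N (b' j))" if "j \<in> I" for j
  proof -
    show 1: "e j \<in> carrier (Val X (FObj F (b' j)))" using B'(3)[OF that] b'[OF that] by simp
    show "g (b' j) (e j) \<in> carrier (Val N (b' j))"
      using hom_closed[OF ghom, of "b' j" "e j"] 1 b'[OF that] by simp
  qed
  have cid: "(b' j, Ide C (b j)) \<in> comma (b j)" if "j \<in> I" for j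
    using comma_id[of "b' j"] b'[OF that] by simp
  have mc: "m j \<in> carrier (Val (ind N) (b j))" if "j \<in> I" for j
    unfolding m_def by (rule lin_map_closed[OF lin_map_icls[OF N cid[OF that]] gej[OF that]])
  obtain \<theta> where \<theta>: "cmod_hom C K X (ind N) \<theta>" "\<And>j. j \<in> I \<Longrightarrow> \<theta> (b j) (e j) = m j"
    using C.cbasis_lift[where m = m, OF Bs is_cmod_ind[OF N] mc] by blast
  have \<Psi>\<theta>: "\<Psi> d (\<theta> d y) = y" if d: "d \<in> Obj C" and y: "y \<in> carrier (Val X d)" for d y
  proof (rule C.cbasis_hom_ext[OF Bs X C.cmod_hom_comp[OF \<theta>(1) \<Psi>(1)] cmod_hom_id _ d y])
    fix j assume j: "j \<in> I"
    have "\<Psi> (b j) (m j) = Act X (Ide C (b j)) (f (b' j) (g (b' j) (e j)))"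
      unfolding m_def by (rule \<Psi>(2)[OF B'(2)[OF j] cid[OF j] gej[OF j]])
    also have "\<dots> = e j" using g(3)[of "b' j" "e j"] b'[OF j] ej[OF j] act_Ide[OF X B'(2)[OF j] B'(3)[OF j]] by simp
    finally show "\<Psi> (b j) (\<theta> (b j) (e j)) = e j" using \<theta>(2)[OF j] by simp
  qed
  have key: "\<theta> (FObj F c) y = icls N (FObj F c) (c, Ide C (FObj F c)) (g c y)"
    if c: "c \<in> Obj B" and y: "y \<in> carrier (Val X (FObj F c))" for c y
  proof -
    let ?d = "FObj F c"
    have d: "?d \<in> Obj C" by (rule func_Obj[OF F c])
    have glin: "lin_map K (Val X ?d) (Val N c) (g c)" using hom_lin[OF ghom c] by simp
    show ?thesis
    proof (rule mbasis_ext[OF B'(4)[OF d] module_ind[OF N] hom_lin[OF \<theta>(1) d] lin_map_comp[OF glin lin_map_icls[OF N comma_id[OF c]]] _ y])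
      fix p assume "p \<in> (SIGMA j:I. Hom C (b j) ?d)"
      then obtain j w where p: "p = (j, w)" and j: "j \<in> I" and w: "w \<in> Hom C (b j) ?d" by auto
      have bj: "b' j \<in> Obj B" "FObj F (b' j) = b j" using b'[OF j] by auto
      have "FArr F ` Hom B (b' j) c = Hom C (b j) ?d"
        using ff bj c by (auto simp: fully_faithful_def bij_betw_def)
      then obtain v where v: "v \<in> Hom B (b' j) c" "w = FArr F v" using w by blast
      have "\<theta> ?d (Act X w (e j)) = Act (ind N) w (m j)"
        using hom_nat[OF \<theta>(1) w B'(3)[OF j]] \<theta>(2)[OF j] by simp
      also have "\<dots> = icls N ?d (b' j, Comp C w (Ide C (b j))) (g (b' j) (e j))"
        unfolding m_def by (rule ind_act(2)[OF N w cid[OF j] gej[OF j]])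
      also have "Comp C w (Ide C (b j)) = Comp C (Ide C ?d) (FArr F v)"
        using C.Comp_Ide[OF w] C.Ide_Comp[OF w] v(2) by simp
      also have "icls N ?d (b' j, Comp C (Ide C ?d) (FArr F v)) (g (b' j) (e j))
          = icls N ?d (c, Ide C ?d) (Act N v (g (b' j) (e j)))"
        by (rule icls_rel[OF N v(1) C.Ide_in_Hom[OF d] gej[OF j]])
      also have "Act N v (g (b' j) (e j)) = g c (Act X w (e j))"
        using hom_nat[OF ghom v(1), of "e j"] ej[OF j] v(2) by simp
      finally show "\<theta> ?d (case p of (j, w) \<Rightarrow> Act X w (e j))
          = icls N ?d (c, Ide C ?d) (g c (case p of (j, w) \<Rightarrow> Act X w (e j)))" using p by simp
    qed
  qed
  have "cmod_iso C K (ind N) X \<Psi>"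
  proof (rule C.cmod_isoI[OF \<Psi>(1) \<theta>(1) _ \<Psi>\<theta>])
    fix d Y assume d: "d \<in> Obj C" and Y: "Y \<in> carrier (Val (ind N) d)"
    show "\<theta> d (\<Psi> d Y) = Y"
    proof (rule ind_ext[OF N module_ind[OF N] lin_map_comp[OF hom_lin[OF \<Psi>(1) d] hom_lin[OF \<theta>(1) d]] lin_map_id _ Y])
      fix c u x assume p: "(c, u) \<in> comma d" and x: "x \<in> carrier (Val N c)"
      have cu: "c \<in> Obj B" "u \<in> Hom C (FObj F c) d" using p by (auto simp: comma_iff)
      have fx: "f c x \<in> carrier (Val X (FObj F c))" using hom_closed[OF fhom cu(1) x] by simp
      have "\<theta> d (\<Psi> d (icls N d (c, u) x)) = \<theta> d (Act X u (f c x))" using \<Psi>(2)[OF d p x] by simp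
      also have "\<dots> = Act (ind N) u (\<theta> (FObj F c) (f c x))" by (rule hom_nat[OF \<theta>(1) cu(2) fx])
      also have "\<dots> = Act (ind N) u (icls N (FObj F c) (c, Ide C (FObj F c)) x)"
        using key[OF cu(1) fx] g(2)[OF cu(1) x] by simp
      also have "\<dots> = icls N d (c, u) x"
        using ind_act(2)[OF N cu(2) comma_id[OF cu(1)] x] C.Comp_Ide[OF cu(2)] by simp
      finally show "\<theta> d (\<Psi> d (icls N d (c, u) x)) = icls N d (c, u) x" .
    qed
  qed
  then show ?thesis using \<Psi>(2) by blast
qed

text \<open>The isomorphisms of \<open>ind_iso\<close> commute with the differentials, so the induced complex inherits
  exactness and minimality from \<open>X\<close>.\<close>

lemma cover_chain_ind:
  fixes X :: "('p, 'n, 'k, 'w) ccomplex"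
  assumes Kf: "field K" and ff: "fully_faithful B C F" and X: "cover_chain C K X M \<epsilon>"
    and gens: "\<And>i (I :: ('p \<times> 'w) set) b e \<chi>. cbasis C K (Term X i) I b e \<chi> \<Longrightarrow> b ` I \<subseteq> FObj F ` Obj B"
    and N: "\<And>i. is_cmod B K (Term N i)"
    and d: "\<And>i. cmod_hom B K (Term N (Suc i)) (Term N i) (Diff N i)"
    and f: "\<And>i. cmod_iso B K (Term N i) (res_cmod F (Term X i)) (f i)"
    and comm: "\<And>i c x. c \<in> Obj B \<Longrightarrow> x \<in> carrier (Val (Term N (Suc i)) c) \<Longrightarrow>
      Diff X i (FObj F c) (f (Suc i) c x) = f i c (Diff N i c x)"
  shows "\<exists>\<delta>. cover_chain C K (ind_ccomplex B C K F N) M \<delta>"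
proof -
  let ?Y = "ind_ccomplex B C K F N"
  have T: "Term ?Y i = ind (Term N i)" and D: "Diff ?Y i = ind_map B C K F (Term N i) (Diff N i)" for i
    by (auto simp: ind_ccomplex_def)
  have free: "free_cmod C K (Term X i)" for i
    using X by (cases i) (auto simp: cover_chain_def dest: free_coverD)
  have "\<exists>\<Psi>. cmod_iso C K (ind (Term N i)) (Term X i) \<Psi> \<and> (\<forall>d\<in>Obj C. \<forall>(b, u)\<in>comma d. \<forall>x\<in>carrier (Val (Term N i) b).
    \<Psi> d (icls (Term N i) d (b, u) x) = Act (Term X i) u (f i b x))" for i
  proof -
    obtain I :: "('p \<times> 'w) set" and b e \<chi> where Bs: "cbasis C K (Term X i) I b e \<chi>"
      using C.free_imp_cbasis[OF K.is_cring free] by blast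
    have "\<exists>c. c \<in> Obj B \<and> FObj F c = b j" if "j \<in> I" for j using gens[OF Bs] that by force
    then obtain b' where b': "\<And>j. j \<in> I \<Longrightarrow> b' j \<in> Obj B \<and> FObj F (b' j) = b j" by metis
    show ?thesis by (rule ind_iso[OF ff N Bs b' f])
  qed
  then have "\<exists>\<Psi>. \<forall>i. cmod_iso C K (ind (Term N i)) (Term X i) (\<Psi> i) \<and> (\<forall>d\<in>Obj C. \<forall>(b, u)\<in>comma d. \<forall>x\<in>carrier (Val (Term N i) b).
    \<Psi> i d (icls (Term N i) d (b, u) x) = Act (Term X i) u (f i b x))" by (intro choice) blast
  then obtain \<Psi> where iso: "\<And>i. cmod_iso C K (ind (Term N i)) (Term X i) (\<Psi> i)"
    and \<Psi>: "\<And>i d b u x. d \<in> Obj C \<Longrightarrow> (b, u) \<in> comma d \<Longrightarrow> x \<in> carrier (Val (Term N i) b) \<Longrightarrow>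
      \<Psi> i d (icls (Term N i) d (b, u) x) = Act (Term X i) u (f i b x)"
    by (fastforce simp: split_beta)
  have \<Psi>hom: "cmod_hom C K (ind (Term N i)) (Term X i) (\<Psi> i)" for i using iso by (simp add: cmod_iso_def)
  have dhom: "cmod_hom C K (ind (Term N (Suc i))) (ind (Term N i)) (ind_map B C K F (Term N i) (Diff N i))" for i
    by (rule cmod_hom_ind_map[OF N N d])
  have "cover_chain C K ?Y M (\<lambda>c x. \<epsilon> c (\<Psi> 0 c x))"
  proof (rule C.cover_chain_transfer[OF Kf X])
    show "is_cmod C K (Term ?Y i)" for i unfolding T by (rule is_cmod_ind[OF N])
    show "cmod_hom C K (Term ?Y (Suc i)) (Term ?Y i) (Diff ?Y i)" for i unfolding T D by (rule dhom)
    show "cmod_iso C K (Term ?Y i) (Term X i) (\<Psi> i)" for i unfolding T by (rule iso)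
    fix i c Y assume c: "c \<in> Obj C" and Y: "Y \<in> carrier (Val (Term ?Y (Suc i)) c)"
    note Xd = C.cover_chain_diff[OF X] and Xm = C.cover_chain_cmod[OF X]
    show "\<Psi> i c (Diff ?Y i c Y) = Diff X i c (\<Psi> (Suc i) c Y)"
      unfolding D
    proof (rule ind_ext[OF N cmod_module[OF Xm c] lin_map_comp[OF hom_lin[OF dhom c] hom_lin[OF \<Psi>hom c]]
          lin_map_comp[OF hom_lin[OF \<Psi>hom c] hom_lin[OF Xd c]] _ Y[unfolded T]])
      fix b u x assume p: "(b, u) \<in> comma c" and x: "x \<in> carrier (Val (Term N (Suc i)) b)"
      have bu: "b \<in> Obj B" "u \<in> Hom C (FObj F b) c" using p by (auto simp: comma_iff)
      have fx: "f (Suc i) b x \<in> carrier (Val (Term X (Suc i)) (FObj F b))"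
        using f[of "Suc i"] bu(1) x by (auto simp: cmod_iso_def dest: hom_closed)
      have "\<Psi> i c (ind_map B C K F (Term N i) (Diff N i) c (icls (Term N (Suc i)) c (b, u) x)) =
          Act (Term X i) u (f i b (Diff N i b x))"
        using ind_map_icls[OF N N d p x] \<Psi>[OF c p hom_closed[OF d bu(1) x]] by simp
      also have "\<dots> = Diff X i c (Act (Term X (Suc i)) u (f (Suc i) b x))"
        using comm[OF bu(1) x] hom_nat[OF Xd bu(2) fx] by simp
      also have "\<dots> = Diff X i c (\<Psi> (Suc i) c (icls (Term N (Suc i)) c (b, u) x))" using \<Psi>[OF c p x] by simp
      finally show "\<Psi> i c (ind_map B C K F (Term N i) (Diff N i) c (icls (Term N (Suc i)) c (b, u) x)) =
          Diff X i c (\<Psi> (Suc i) c (icls (Term N (Suc i)) c (b, u) x))" .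
    qed
  qed
  then show ?thesis by blast
qed

end

section \<open>Full subcategories\<close>

lemma full_subcat_simps [simp]:
  "Obj (full_subcat C T) = Obj C \<inter> T" "Dom (full_subcat C T) = Dom C" "Cod (full_subcat C T) = Cod C"
  "Ide (full_subcat C T) = Ide C" "Comp (full_subcat C T) = Comp C"
  by (auto simp: full_subcat_def)

lemma Hom_full_subcat:
  "u \<in> Hom (full_subcat C T) a b \<longleftrightarrow> u \<in> Hom C a b \<and> a \<in> T \<and> b \<in> T"
  by (auto simp: Hom_def full_subcat_def)

lemma (in category) category_full_subcat: "category (full_subcat C T)"
proof
  fix u assume "u \<in> Arr (full_subcat C T)"
  then show "Dom (full_subcat C T) u \<in> Obj (full_subcat C T)" "Cod (full_subcat C T) u \<in> Obj (full_subcat C T)"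
    using Dom_closed Cod_closed by (auto simp: full_subcat_def)
qed (auto simp: Hom_full_subcat Ide_in_Hom Comp_Ide Ide_Comp intro: Comp_in_Hom Comp_assoc)

lemma cat_iso_full_subcat: "cat_iso (full_subcat C T) u \<Longrightarrow> cat_iso C u"
  by (auto simp: cat_iso_def Hom_full_subcat) (auto simp: full_subcat_def)

lemma (in graded_category) graded_full_subcat:
  assumes "T \<subseteq> S" shows "graded_category (full_subcat C T) (Obj (full_subcat C T)) ht"
proof -
  interpret T: category "full_subcat C T" by (rule category_full_subcat)
  show ?thesis
  proof
    fix u c assume "u \<in> Hom (full_subcat C T) c c"
    then show "u = Ide (full_subcat C T) c" using endo by (simp add: Hom_full_subcat)
  next
    fix u assume "cat_iso (full_subcat C T) u"
    then show "Dom (full_subcat C T) u = Cod (full_subcat C T) u"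
      using iso_endo[OF cat_iso_full_subcat] by simp
  next
    fix u a b assume "u \<in> Hom (full_subcat C T) a b" "a \<in> Obj (full_subcat C T)"
    then show "b \<in> Obj (full_subcat C T)" using T.Hom_objD by blast
  next
    fix u a b assume "u \<in> Hom (full_subcat C T) a b" "a \<in> Obj (full_subcat C T)" "a \<noteq> b"
    then show "ht a < ht b" using ht assms by (auto simp: Hom_full_subcat)
  qed auto
qed

lemma fully_faithful_inclusion: "fully_faithful (full_subcat C T) C func_id"
proof -
  have "Hom (full_subcat C T) a b = Hom C a b" if "a \<in> T" "b \<in> T" for a b
    using that by (auto simp: Hom_full_subcat)
  then have "bij_betw id (Hom (full_subcat C T) a b) (Hom C a b)" if "a \<in> T" "b \<in> T" for a b
    using that by simp
  moreover have "is_func (full_subcat C T) C func_id"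
    by (simp add: is_func_def func_id_def) (simp add: full_subcat_def Hom_def)
  ultimately show ?thesis by (simp add: fully_faithful_def func_id_def)
qed

lemma fully_faithful_comp:
  assumes F: "fully_faithful B C F" and G: "fully_faithful C D G"
  shows "fully_faithful B D (func_comp G F)"
proof -
  have f: "is_func B C F" and g: "is_func C D G" using F G by (auto simp: fully_faithful_def)
  have "is_func B D (func_comp G F)"
    unfolding is_func_def func_comp_def
  proof (intro conjI ballI impI)
    fix c assume "c \<in> Obj B"
    then show "FObj \<lparr>FObj = FObj G \<circ> FObj F, FArr = FArr G \<circ> FArr F\<rparr> c \<in> Obj D"
      "FArr \<lparr>FObj = FObj G \<circ> FObj F, FArr = FArr G \<circ> FArr F\<rparr> (Ide B c) =
        Ide D (FObj \<lparr>FObj = FObj G \<circ> FObj F, FArr = FArr G \<circ> FArr F\<rparr> c)"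
      using func_Obj[OF f] func_Obj[OF g] func_Ide[OF f] func_Ide[OF g] by auto
  next
    fix u assume u: "u \<in> Arr B"
    then show "FArr \<lparr>FObj = FObj G \<circ> FObj F, FArr = FArr G \<circ> FArr F\<rparr> u
      \<in> Hom D (FObj \<lparr>FObj = FObj G \<circ> FObj F, FArr = FArr G \<circ> FArr F\<rparr> (Dom B u))
          (FObj \<lparr>FObj = FObj G \<circ> FObj F, FArr = FArr G \<circ> FArr F\<rparr> (Cod B u))"
      using func_Hom[OF g func_Hom[OF f Arr_Hom[OF u]]] by simp
    fix v assume v: "v \<in> Arr B" "Dom B v = Cod B u"
    have uv: "u \<in> Hom B (Dom B u) (Cod B u)" "v \<in> Hom B (Cod B u) (Cod B v)" using u v by (auto simp: Hom_def)
    show "FArr \<lparr>FObj = FObj G \<circ> FObj F, FArr = FArr G \<circ> FArr F\<rparr> (Comp B v u) =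
        Comp D (FArr \<lparr>FObj = FObj G \<circ> FObj F, FArr = FArr G \<circ> FArr F\<rparr> v)
          (FArr \<lparr>FObj = FObj G \<circ> FObj F, FArr = FArr G \<circ> FArr F\<rparr> u)"
      using func_Comp[OF f uv] func_Comp[OF g func_Hom[OF f uv(1)] func_Hom[OF f uv(2)]] by simp
  qed
  then show ?thesis
    using F G func_Obj[OF f] by (auto simp: fully_faithful_def func_comp_def intro!: bij_betw_trans)
qed

text \<open>Isomorphisms being identities, an equivalence is an isomorphism of categories.\<close>

lemma equivalence_imp_iso:
  assumes B: "graded_category B S h" and B': "graded_category B' S' h'" and eq: "equivalence_of_cats B B' \<alpha>"
  shows "fully_faithful B B' \<alpha>" and "Obj B' \<subseteq> FObj \<alpha> ` Obj B"
proof -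
  interpret B: graded_category B S h by fact
  interpret B': graded_category B' S' h' by fact
  obtain G \<eta> \<theta> where \<alpha>: "is_func B B' \<alpha>" and G: "is_func B' B G"
    and \<eta>: "natural_iso B B (func_comp G \<alpha>) func_id \<eta>" and \<theta>: "natural_iso B' B' (func_comp \<alpha> G) func_id \<theta>"
    using eq by (auto simp: equivalence_of_cats_def)
  have e: "FObj G (FObj \<alpha> c) = c" "\<eta> c = Ide B c" if c: "c \<in> Obj B" for c
  proof -
    have h: "\<eta> c \<in> Hom B (FObj G (FObj \<alpha> c)) c" "cat_iso B (\<eta> c)"
      using \<eta> c by (auto simp: natural_iso_def func_comp_def func_id_def)
    show 1: "FObj G (FObj \<alpha> c) = c" using B.iso_endo[OF h(2)] h(1) by (auto simp: Hom_def)
    show "\<eta> c = Ide B c" using B.endo[of "\<eta> c" c] h(1) 1 by simp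
  qed
  have t: "FObj \<alpha> (FObj G c) = c" "\<theta> c = Ide B' c" if c: "c \<in> Obj B'" for c
  proof -
    have h: "\<theta> c \<in> Hom B' (FObj \<alpha> (FObj G c)) c" "cat_iso B' (\<theta> c)"
      using \<theta> c by (auto simp: natural_iso_def func_comp_def func_id_def)
    show 1: "FObj \<alpha> (FObj G c) = c" using B'.iso_endo[OF h(2)] h(1) by (auto simp: Hom_def)
    show "\<theta> c = Ide B' c" using B'.endo[of "\<theta> c" c] h(1) 1 by simp
  qed
  have ea: "FArr G (FArr \<alpha> u) = u" if u: "u \<in> Hom B a b" for u a b
  proof -
    note ab = B.Hom_objD[OF u]
    have w: "FArr G (FArr \<alpha> u) \<in> Hom B a b" using func_Hom[OF G func_Hom[OF \<alpha> u]] e ab by simp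
    have "Comp B (\<eta> b) (FArr G (FArr \<alpha> u)) = Comp B u (\<eta> a)"
      using \<eta> u by (auto simp: natural_iso_def func_comp_def func_id_def Hom_def)
    then show ?thesis using e ab B.Ide_Comp[OF w] B.Comp_Ide[OF u] by simp
  qed
  have ta: "FArr \<alpha> (FArr G u) = u" if u: "u \<in> Hom B' a b" for u a b
  proof -
    note ab = B'.Hom_objD[OF u]
    have w: "FArr \<alpha> (FArr G u) \<in> Hom B' a b" using func_Hom[OF \<alpha> func_Hom[OF G u]] t ab by simp
    have "Comp B' (\<theta> b) (FArr \<alpha> (FArr G u)) = Comp B' u (\<theta> a)"
      using \<theta> u by (auto simp: natural_iso_def func_comp_def func_id_def Hom_def)
    then show ?thesis using t ab B'.Ide_Comp[OF w] B'.Comp_Ide[OF u] by simp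
  qed
  show "fully_faithful B B' \<alpha>"
    unfolding fully_faithful_def
  proof (intro conjI ballI \<alpha>)
    fix a b assume ab: "a \<in> Obj B" "b \<in> Obj B"
    have "FArr G v \<in> Hom B a b" if "v \<in> Hom B' (FObj \<alpha> a) (FObj \<alpha> b)" for v
      using func_Hom[OF G that] e ab by simp
    then show "bij_betw (FArr \<alpha>) (Hom B a b) (Hom B' (FObj \<alpha> a) (FObj \<alpha> b))"
      using func_Hom[OF \<alpha>] ea ta by (intro bij_betw_byWitness[where f' = "FArr G"]) auto
  qed
  show "Obj B' \<subseteq> FObj \<alpha> ` Obj B"
  proof
    fix c assume c: "c \<in> Obj B'"
    then show "c \<in> FObj \<alpha> ` Obj B" using t(1)[OF c] func_Obj[OF G c] by (metis imageI)
  qed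
qed

section \<open>Toric rings\<close>

locale pointed_affine =
  fixes Q :: "('q, 'y) monoid_scheme" and r n :: nat and a :: "nat \<Rightarrow> 'q" and emb :: "'q \<Rightarrow> nat \<Rightarrow> int"
  assumes data: "pointed_affine_data Q r n a emb"
begin

abbreviation "C \<equiv> act_cat n r (emb \<circ> a)"
abbreviation "supp \<equiv> emb ` carrier Q"

definition height :: "(nat \<Rightarrow> int) \<Rightarrow> nat" where
  "height c = nat (\<Sum>j<r. c j)"

sublocale Q: comm_monoid Q
  using data by (simp add: pointed_affine_data_def affine_semigroup_def)

lemma a_closed: "i < n \<Longrightarrow> a i \<in> carrier Q"
  using data by (auto simp: pointed_affine_data_def minimal_generating_set_def monoid_generates_def)

lemma emb_add: "x \<in> carrier Q \<Longrightarrow> y \<in> carrier Q \<Longrightarrow> emb (x \<otimes>\<^bsub>Q\<^esub> y) j = emb x j + emb y j"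
  using data by (auto simp: pointed_affine_data_def hom_def Zvec_def)

lemma emb_closed: "x \<in> carrier Q \<Longrightarrow> emb x \<in> carrier (Zvec r)"
  using data by (auto simp: pointed_affine_data_def hom_def)

lemma emb_nonneg: "x \<in> carrier Q \<Longrightarrow> 0 \<le> emb x j"
  using data by (auto simp: pointed_affine_data_def)

lemma emb_inj: "x \<in> carrier Q \<Longrightarrow> y \<in> carrier Q \<Longrightarrow> emb x = emb y \<Longrightarrow> x = y"
  using data by (auto simp: pointed_affine_data_def inj_on_def)

lemma emb_one: "emb \<one>\<^bsub>Q\<^esub> j = 0"
  using emb_add[of "\<one>\<^bsub>Q\<^esub>" "\<one>\<^bsub>Q\<^esub>" j] by simp

text \<open>Every submonoid contains the identity, which is therefore superfluous in a generating set.\<close>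

lemma a_not_one: assumes "i < n" shows "a i \<noteq> \<one>\<^bsub>Q\<^esub>"
proof
  assume e: "a i = \<one>\<^bsub>Q\<^esub>"
  have m: "monoid_generates Q (a ` {..<n})" and
    min: "\<And>T. T \<subset> a ` {..<n} \<Longrightarrow> \<not> monoid_generates Q T"
    using data by (auto simp: pointed_affine_data_def minimal_generating_set_def)
  let ?T = "a ` {..<n} - {\<one>\<^bsub>Q\<^esub>}"
  have "?T \<subset> a ` {..<n}" using e assms by auto
  moreover have "monoid_generates Q ?T"
    unfolding monoid_generates_def
  proof (intro conjI allI impI)
    show "?T \<subseteq> carrier Q" using m by (auto simp: monoid_generates_def)
    fix H assume H: "submonoid H Q \<and> ?T \<subseteq> H"
    then have "\<one>\<^bsub>Q\<^esub> \<in> H" by (simp add: submonoid.one_closed)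
    then have "a ` {..<n} \<subseteq> H" using H by auto
    then show "H = carrier Q" using m H by (auto simp: monoid_generates_def)
  qed
  ultimately show False using min by blast
qed

lemma a_pos: assumes "i < n" shows "\<exists>j. 0 < emb (a i) j"
proof (rule ccontr)
  assume "\<not> ?thesis"
  then have "emb (a i) = emb \<one>\<^bsub>Q\<^esub>"
    using emb_nonneg[OF a_closed[OF assms]] by (auto simp: emb_one fun_eq_iff not_less intro: antisym)
  then show False using emb_inj[OF a_closed[OF assms]] a_not_one[OF assms] by simp
qed

definition monomial :: "(nat \<Rightarrow> nat) \<Rightarrow> 'q" where
  "monomial l = (\<Otimes>\<^bsub>Q\<^esub>i\<in>{..<n}. a i [^]\<^bsub>Q\<^esub> l i)"

lemma monomial_closed: "monomial l \<in> carrier Q"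
  unfolding monomial_def using a_closed by (intro Q.finprod_closed) auto

lemma emb_monomial: "emb (monomial l) j = (\<Sum>i<n. int (l i) * emb (a i) j)"
proof -
  have p: "emb (x [^]\<^bsub>Q\<^esub> (k::nat)) j = int k * emb x j" if "x \<in> carrier Q" for x k
    using that by (induction k) (simp_all add: emb_one emb_add distrib_right)
  have "emb (\<Otimes>\<^bsub>Q\<^esub>i\<in>{..<m}. a i [^]\<^bsub>Q\<^esub> l i) j = (\<Sum>i<m. int (l i) * emb (a i) j)" if "m \<le> n" for m
    using that
  proof (induction m)
    case 0 then show ?case by (simp add: emb_one)
  next
    case (Suc m)
    have c: "(\<lambda>i. a i [^]\<^bsub>Q\<^esub> l i) \<in> {..<m} \<rightarrow> carrier Q" "a m [^]\<^bsub>Q\<^esub> l m \<in> carrier Q"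
      using Suc.prems a_closed by auto
    have "(\<Otimes>\<^bsub>Q\<^esub>i\<in>{..<Suc m}. a i [^]\<^bsub>Q\<^esub> l i) = a m [^]\<^bsub>Q\<^esub> l m \<otimes>\<^bsub>Q\<^esub> (\<Otimes>\<^bsub>Q\<^esub>i\<in>{..<m}. a i [^]\<^bsub>Q\<^esub> l i)"
      using c by (simp add: lessThan_Suc Q.finprod_insert)
    then show ?case
      using Suc c p[of "a m" "l m"] a_closed[of m] by (simp add: emb_add Q.finprod_closed)
  qed
  then show ?thesis by (simp add: monomial_def)
qed

lemma Hom_C:
  "u \<in> Hom C c d \<longleftrightarrow> (\<exists>l. u = (c, l, d) \<and> c \<in> carrier (Zvec r) \<and> d \<in> carrier (Zvec r) \<and> (\<forall>i\<ge>n. l i = 0) \<and>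
     (\<forall>j. emb (monomial l) j = d j - c j))"
  by (simp add: in_Hom_act_cat emb_monomial)

lemma monomial_eq_zero:
  assumes "\<And>j. emb (monomial l) j = 0" "\<forall>i\<ge>n. l i = 0" shows "l = (\<lambda>_. 0)"
proof
  fix i show "l i = 0"
  proof (rule ccontr)
    assume li: "l i \<noteq> 0"
    then have i: "i < n" using assms(2) by (meson not_less)
    obtain j where j: "0 < emb (a i) j" using a_pos[OF i] by blast
    have "0 < int (l i) * emb (a i) j" using li j by simp
    also have "\<dots> \<le> (\<Sum>i<n. int (l i) * emb (a i) j)"
      by (rule member_le_sum) (use i emb_nonneg a_closed in auto)
    finally show False using assms(1)[of j] by (simp add: emb_monomial)
  qed
qed

lemma supp_sub: "supp \<subseteq> carrier (Zvec r)" using emb_closed by auto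

lemma Hom_le: "u \<in> Hom C c d \<Longrightarrow> c j \<le> d j"
  using emb_nonneg[OF monomial_closed] by (auto simp: Hom_C) (metis diff_ge_0_iff_ge)

lemma height_less:
  assumes "u \<in> Hom C c d" "c \<in> supp" "c \<noteq> d" shows "height c < height d"
proof -
  have le: "c j \<le> d j" for j using Hom_le[OF assms(1)] .
  have cd: "c \<in> carrier (Zvec r)" "d \<in> carrier (Zvec r)" using assms(1) by (auto simp: Hom_C)
  obtain j where j: "c j \<noteq> d j" using assms(3) by blast
  then have jr: "j < r" using cd by (auto simp: Zvec_def) (metis not_less)
  have "(\<Sum>j<r. c j) < (\<Sum>j<r. d j)"
    by (rule sum_strict_mono_ex1) (use le j jr in \<open>auto intro!: bexI[of _ j] simp: order.strict_iff_order\<close>)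
  moreover have "0 \<le> (\<Sum>j<r. c j)" using assms(2) emb_nonneg by (auto intro!: sum_nonneg)
  ultimately show ?thesis by (simp add: height_def)
qed

lemma countable_Zvec: "countable (carrier (Zvec r))"
proof -
  have "inj_on (\<lambda>v. map v [0..<r]) (carrier (Zvec r))"
  proof (rule inj_onI)
    fix v w :: "nat \<Rightarrow> int" assume vw: "v \<in> carrier (Zvec r)" "w \<in> carrier (Zvec r)" "map v [0..<r] = map w [0..<r]"
    show "v = w"
    proof
      fix j show "v j = w j"
        using vw by (cases "j < r") (auto simp: Zvec_def)
    qed
  qed
  then show ?thesis by (rule countable_image_inj_on[rotated]) (rule countableI_type)
qed

sublocale C: locally_finite_graded_category C supp height
proof -
  interpret C: category C by (rule category_act_cat)
  have S: "supp \<subseteq> Obj C" using supp_sub by (simp add: act_cat_def)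
  show "locally_finite_graded_category C supp height"
  proof
    show "supp \<subseteq> Obj C" by (rule S)
    fix u c assume "u \<in> Hom C c c"
    then obtain l where l: "u = (c, l, c)" "\<forall>i\<ge>n. l i = 0" "\<And>j. emb (monomial l) j = 0"
      by (auto simp: Hom_C)
    then show "u = Ide C c" using monomial_eq_zero[OF l(3,2)] by (simp add: act_cat_def)
  next
    fix u assume u: "cat_iso C u"
    then have h: "u \<in> Hom C (Dom C u) (Cod C u)" "\<exists>v. v \<in> Hom C (Cod C u) (Dom C u)"
      by (auto simp: cat_iso_def Hom_def)
    then show "Dom C u = Cod C u" using Hom_le by (meson ext order.antisym)
  next
    fix u c d assume u: "u \<in> Hom C c d" and "c \<in> supp"
    then obtain x where x: "x \<in> carrier Q" "c = emb x" by blast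
    obtain l where "\<And>j. emb (monomial l) j = d j - c j" using u by (auto simp: Hom_C)
    then have "emb (x \<otimes>\<^bsub>Q\<^esub> monomial l) = d"
      using x by (intro ext) (simp add: emb_add monomial_closed)
    then show "d \<in> supp" using x monomial_closed by auto
  next
    show "countable supp" by (rule countable_subset[OF supp_sub countable_Zvec])
  next
    fix c assume "c \<in> Obj C"
    let ?L = "{l :: nat \<Rightarrow> nat. \<forall>i. (i \<in> {..<n} \<longrightarrow> l i \<in> {..height c}) \<and> (i \<notin> {..<n} \<longrightarrow> l i = 0)}"
    have "finite ?L" by (rule finite_set_of_finite_funs) auto
    moreover have "{u \<in> Arr C. Cod C u = c \<and> Dom C u \<in> supp} \<subseteq> (\<lambda>l. (\<lambda>j. c j - emb (monomial l) j, l, c)) ` ?L"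
    proof
      fix u assume "u \<in> {u \<in> Arr C. Cod C u = c \<and> Dom C u \<in> supp}"
      then have h: "u \<in> Hom C (Dom C u) c" and s: "Dom C u \<in> supp" by (auto simp: Hom_def)
      let ?b = "Dom C u"
      obtain l where l: "u = (?b, l, c)" "\<forall>i\<ge>n. l i = 0" "\<And>j. emb (monomial l) j = c j - ?b j"
        using h unfolding Hom_C by blast
      \<comment> \<open>Every \<open>a i\<close> has a positive coordinate, so its multiplicity cannot exceed the height of the
        target.\<close>
      have "l i \<le> height c" if i: "i < n" for i
      proof -
        obtain j where j: "0 < emb (a i) j" using a_pos[OF i] by blast
        then have jr: "j < r" using emb_closed[OF a_closed[OF i]] by (auto simp: Zvec_def) (metis less_irrefl not_less)
        obtain x where x: "x \<in> carrier Q" "?b = emb x" using s by blast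
        have b0: "0 \<le> ?b k" for k unfolding x(2) by (rule emb_nonneg[OF x(1)])
        have c0: "0 \<le> c k" for k by (rule order_trans[OF b0 Hom_le[OF h]])
        have "int (l i) \<le> int (l i) * emb (a i) j" using j by (simp add: mult_le_cancel_left1)
        also have "\<dots> \<le> (\<Sum>i<n. int (l i) * emb (a i) j)"
          by (rule member_le_sum) (use i emb_nonneg a_closed in auto)
        also have "\<dots> = c j - ?b j" using l(3)[of j] by (simp add: emb_monomial)
        also have "\<dots> \<le> c j" using b0[of j] by simp
        also have "\<dots> \<le> (\<Sum>j<r. c j)" by (rule member_le_sum) (use jr c0 in auto)
        finally show ?thesis by (simp add: height_def)
      qed
      then have "l \<in> ?L" using l(2) by (auto simp: not_less)
      moreover have "u = (\<lambda>j. c j - emb (monomial l) j, l, c)"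
        using l(1,3) by simp
      ultimately show "u \<in> (\<lambda>l. (\<lambda>j. c j - emb (monomial l) j, l, c)) ` ?L" by blast
    qed
    ultimately show "finite {u \<in> Arr C. Cod C u = c \<and> Dom C u \<in> supp}" by (rule finite_surj)
  qed (use height_less in auto)
qed

text \<open>As \<open>emb\<close> is injective, a fibre has at most one element, and a toric ring is at most
  one-dimensional in each degree.\<close>

definition fibre :: "(nat \<Rightarrow> int) \<Rightarrow> 'q set" where
  "fibre c = {q \<in> carrier Q. emb q = c}"

lemma fibre_unique: "x \<in> fibre c \<Longrightarrow> y \<in> fibre c \<Longrightarrow> x = y"
  using emb_inj by (auto simp: fibre_def)

lemma fibre_shift:
  assumes "(c, l, d) \<in> Hom C c d" "x \<in> fibre c" shows "x \<otimes>\<^bsub>Q\<^esub> monomial l \<in> fibre d"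
proof -
  have "emb (monomial l) j = d j - c j" for j using assms(1) by (auto simp: Hom_C)
  then have "emb (x \<otimes>\<^bsub>Q\<^esub> monomial l) = d"
    using assms(2) by (intro ext) (auto simp: fibre_def emb_add monomial_closed)
  then show ?thesis using assms(2) monomial_closed by (auto simp: fibre_def)
qed

abbreviation "toric K \<equiv> toric_cmod K Q n a emb"

lemma Val_toric: "Val (toric K) c = free_mod K (fibre c)"
  by (simp add: toric_cmod_def fibre_def)

lemma Act_toric: "Act (toric K) (c, l, d) = free_map K (fibre c) (fibre d) (\<lambda>q. q \<otimes>\<^bsub>Q\<^esub> monomial l)"
  by (simp add: toric_cmod_def fibre_def monomial_def)

lemma toric_act:
  assumes "u \<in> Hom C c d"
  shows "\<exists>h. (\<forall>x\<in>fibre c. h x \<in> fibre d) \<and> Act (toric K) u = free_map K (fibre c) (fibre d) h"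
proof -
  obtain l where l: "u = (c, l, d)" using assms by (auto simp: Hom_C)
  show ?thesis
    using fibre_shift assms unfolding l Act_toric by (intro exI[of _ "\<lambda>q. q \<otimes>\<^bsub>Q\<^esub> monomial l"]) simp
qed

text \<open>Any two maps into a fibre agree, so all composites of the maps \<open>K[h]\<close> between fibres agree.\<close>

lemma free_map_fibre:
  assumes "cring K" "\<And>x. x \<in> X \<Longrightarrow> h x \<in> Y" "\<And>y. y \<in> Y \<Longrightarrow> g y \<in> fibre c"
    and "\<And>x. x \<in> X \<Longrightarrow> k x \<in> fibre c" "x \<in> carrier (free_mod K X)"
  shows "free_map K X (fibre c) k x = free_map K Y (fibre c) g (free_map K X Y h x)"
proof (rule free_map_comp[OF assms(1-3) _ assms(5)])
  show "k x = g (h x)" if "x \<in> X" for x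
    by (rule fibre_unique[OF assms(4)[OF that] assms(3)[OF assms(2)[OF that]]])
qed

lemma is_cmod_toric: assumes K: "cring K" shows "is_cmod C K (toric K)"
proof (rule is_cmodI)
  show "module K (Val (toric K) c)" for c unfolding Val_toric by (rule module_free[OF K])
  fix c d u assume u: "u \<in> Hom C c d"
  obtain h where h: "\<And>x. x \<in> fibre c \<Longrightarrow> h x \<in> fibre d" "Act (toric K) u = free_map K (fibre c) (fibre d) h"
    using toric_act[OF u] by blast
  show "lin_map K (Val (toric K) c) (Val (toric K) d) (Act (toric K) u)"
    unfolding Val_toric h(2) by (rule lin_map_free_map[OF K h(1)])
  fix e v x assume v: "v \<in> Hom C d e" and x: "x \<in> carrier (Val (toric K) c)"
  obtain g where g: "\<And>x. x \<in> fibre d \<Longrightarrow> g x \<in> fibre e" "Act (toric K) v = free_map K (fibre d) (fibre e) g"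
    using toric_act[OF v] by blast
  obtain k where k: "\<And>x. x \<in> fibre c \<Longrightarrow> k x \<in> fibre e" "Act (toric K) (Comp C v u) = free_map K (fibre c) (fibre e) k"
    using toric_act[OF C.Comp_in_Hom[OF u v]] by blast
  show "Act (toric K) (Comp C v u) x = Act (toric K) v (Act (toric K) u x)"
    unfolding h(2) g(2) k(2) by (rule free_map_fibre[OF K h(1) g(1) k(1) x[unfolded Val_toric]])
next
  fix c x assume c: "c \<in> Obj C" and x: "x \<in> carrier (Val (toric K) c)"
  obtain h where h: "\<And>x. x \<in> fibre c \<Longrightarrow> h x \<in> fibre c" "Act (toric K) (Ide C c) = free_map K (fibre c) (fibre c) h"
    using toric_act[OF C.Ide_in_Hom[OF c]] by blast
  show "Act (toric K) (Ide C c) x = x"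
    unfolding h(2) by (rule free_map_ident[OF K _ x[unfolded Val_toric]]) (use h(1) fibre_unique in blast)
qed

lemma supported_toric: assumes K: "cring K" shows "supported C supp (toric K)"
  unfolding supported_def
proof
  fix c assume "c \<in> Obj C - supp"
  then have "fibre c = {}" by (auto simp: fibre_def)
  then show "carrier (Val (toric K) c) = {\<zero>\<^bsub>Val (toric K) c\<^esub>}"
    by (auto simp: Val_toric free_mod_def dsum_mod_def)
qed

lemma finitely_spanned_toric: assumes K: "cring K" shows "finitely_spanned K (Val (toric K) c)"
proof -
  have "finite (fibre c)"
  proof (cases "fibre c = {}")
    case False
    then obtain x where "x \<in> fibre c" by blast
    then have "fibre c \<subseteq> {x}" using fibre_unique by blast
    then show ?thesis by (rule finite_subset) simp
  qed simp
  then show ?thesis unfolding Val_toric by (rule finitely_spanned_mbasis[OF mbasis_free[OF K]])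
qed

end

text \<open>On degrees in the support a toric ring is the constant functor with value \<open>K\<close>; hence any two
  toric rings agree there.\<close>

lemma toric_res_iso:
  assumes K: "cring K" and A: "pointed_affine Q r n a emb" and A': "pointed_affine Q' r' n' a' emb'"
    and F: "is_func B (act_cat n r (emb \<circ> a)) F" and F': "is_func B (act_cat n' r' (emb' \<circ> a')) F'"
    and B: "category B"
    and S: "\<And>c. c \<in> Obj B \<Longrightarrow> FObj F c \<in> emb ` carrier Q" and S': "\<And>c. c \<in> Obj B \<Longrightarrow> FObj F' c \<in> emb' ` carrier Q'"
  shows "\<exists>t. cmod_iso B K (res_cmod F' (toric_cmod K Q' n' a' emb')) (res_cmod F (toric_cmod K Q n a emb)) t"
proof -
  interpret A: pointed_affine Q r n a emb by fact
  interpret A': pointed_affine Q' r' n' a' emb' by fact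
  interpret B: category B by fact
  have "\<exists>q. q \<in> A.fibre (FObj F c)" if "c \<in> Obj B" for c using S[OF that] by (auto simp: A.fibre_def)
  then obtain q where q: "\<And>c. c \<in> Obj B \<Longrightarrow> q c \<in> A.fibre (FObj F c)" by metis
  have "\<exists>q. q \<in> A'.fibre (FObj F' c)" if "c \<in> Obj B" for c using S'[OF that] by (auto simp: A'.fibre_def)
  then obtain q' where q': "\<And>c. c \<in> Obj B \<Longrightarrow> q' c \<in> A'.fibre (FObj F' c)" by metis
  let ?T = "res_cmod F (A.toric K)" and ?T' = "res_cmod F' (A'.toric K)"
  define t where "t c = free_map K (A'.fibre (FObj F' c)) (A.fibre (FObj F c)) (\<lambda>_. q c)" for c
  define s where "s c = free_map K (A.fibre (FObj F c)) (A'.fibre (FObj F' c)) (\<lambda>_. q' c)" for c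
  have V: "Val ?T c = free_mod K (A.fibre (FObj F c))" "Val ?T' c = free_mod K (A'.fibre (FObj F' c))" for c
    by (simp_all add: A.Val_toric A'.Val_toric)
  have "cmod_hom B K ?T' ?T t"
  proof (rule cmod_homI)
    show "lin_map K (Val ?T' c) (Val ?T c) (t c)" if "c \<in> Obj B" for c
      unfolding V t_def by (rule lin_map_free_map[OF K q[OF that]])
    fix c d u x assume u: "u \<in> Hom B c d" and x: "x \<in> carrier (Val ?T' c)"
    note cd = B.Hom_objD[OF u]
    obtain h where h: "\<And>x. x \<in> A.fibre (FObj F c) \<Longrightarrow> h x \<in> A.fibre (FObj F d)"
      "Act (A.toric K) (FArr F u) = free_map K (A.fibre (FObj F c)) (A.fibre (FObj F d)) h"
      using A.toric_act[OF func_Hom[OF F u], of K] by blast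
    obtain h' where h': "\<And>x. x \<in> A'.fibre (FObj F' c) \<Longrightarrow> h' x \<in> A'.fibre (FObj F' d)"
      "Act (A'.toric K) (FArr F' u) = free_map K (A'.fibre (FObj F' c)) (A'.fibre (FObj F' d)) h'"
      using A'.toric_act[OF func_Hom[OF F' u], of K] by blast
    have "free_map K (A'.fibre (FObj F' c)) (A.fibre (FObj F d)) (\<lambda>_. q d) x =
        free_map K (A'.fibre (FObj F' d)) (A.fibre (FObj F d)) (\<lambda>_. q d)
          (free_map K (A'.fibre (FObj F' c)) (A'.fibre (FObj F' d)) h' x)"
      by (rule A.free_map_fibre[OF K h'(1) q[OF cd(2)] q[OF cd(2)] x[unfolded V]])
    moreover have "free_map K (A'.fibre (FObj F' c)) (A.fibre (FObj F d)) (\<lambda>_. q d) x =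
        free_map K (A.fibre (FObj F c)) (A.fibre (FObj F d)) h
          (free_map K (A'.fibre (FObj F' c)) (A.fibre (FObj F c)) (\<lambda>_. q c) x)"
      by (rule A.free_map_fibre[OF K q[OF cd(1)] h(1) q[OF cd(2)] x[unfolded V]])
    ultimately show "t d (Act ?T' u x) = Act ?T u (t c x)"
      by (simp add: h(2) h'(2) t_def)
  qed
  moreover have "bij_betw (t c) (carrier (Val ?T' c)) (carrier (Val ?T c))" if c: "c \<in> Obj B" for c
  proof (rule bij_betw_byWitness[where f' = "s c"])
    have lt: "lin_map K (Val ?T' c) (Val ?T c) (t c)" and ls: "lin_map K (Val ?T c) (Val ?T' c) (s c)"
      unfolding V t_def s_def by (rule lin_map_free_map[OF K q[OF c]], rule lin_map_free_map[OF K q'[OF c]])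
    show "t c ` carrier (Val ?T' c) \<subseteq> carrier (Val ?T c)" using lin_map_closed[OF lt] by blast
    show "s c ` carrier (Val ?T c) \<subseteq> carrier (Val ?T' c)" using lin_map_closed[OF ls] by blast
    show "\<forall>x\<in>carrier (Val ?T' c). s c (t c x) = x"
    proof
      fix x assume x: "x \<in> carrier (Val ?T' c)"
      have "free_map K (A'.fibre (FObj F' c)) (A'.fibre (FObj F' c)) (\<lambda>y. y) x = s c (t c x)"
        unfolding s_def t_def by (rule A'.free_map_fibre[OF K q[OF c] q'[OF c] _ x[unfolded V]])
      then show "s c (t c x) = x" using free_map_ident[OF K _ x[unfolded V], of "\<lambda>y. y"] by simp
    qed
    show "\<forall>x\<in>carrier (Val ?T c). t c (s c x) = x"
    proof
      fix x assume x: "x \<in> carrier (Val ?T c)"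
      have "free_map K (A.fibre (FObj F c)) (A.fibre (FObj F c)) (\<lambda>y. y) x = t c (s c x)"
        unfolding s_def t_def by (rule A.free_map_fibre[OF K q'[OF c] q[OF c] _ x[unfolded V]])
      then show "t c (s c x) = x" using free_map_ident[OF K _ x[unfolded V], of "\<lambda>y. y"] by simp
    qed
  qed
  ultimately show ?thesis by (auto simp: cmod_iso_def)
qed

section \<open>Toric rings with equivalent Betti categories\<close>

theorem theorem9p5:
  fixes K :: "('k, 'z) ring_scheme"
    and Q :: "('q, 'y) monoid_scheme" and Q' :: "('q', 'y') monoid_scheme"
    and r n r' n' :: nat
    and a :: "nat \<Rightarrow> 'q" and a' :: "nat \<Rightarrow> 'q'"
    and emb :: "'q \<Rightarrow> nat \<Rightarrow> int" and emb' :: "'q' \<Rightarrow> nat \<Rightarrow> int"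
    and \<alpha> :: "(nat \<Rightarrow> int, act_arr, nat \<Rightarrow> int, act_arr) func"
    and P' :: "(nat \<Rightarrow> int, act_arr, 'k, 'v) ccomplex"
  defines "\<C> \<equiv> act_cat n r (emb \<circ> a)"
    and "\<C>' \<equiv> act_cat n' r' (emb' \<circ> a')"
    and "\<B> \<equiv> toric_betti_cat K Q r n a emb"
    and "\<B>' \<equiv> toric_betti_cat K Q' r' n' a' emb'"
    and "\<rho> \<equiv> (func_id :: (nat \<Rightarrow> int, act_arr, nat \<Rightarrow> int, act_arr) func)"
    and "\<rho>' \<equiv> (func_id :: (nat \<Rightarrow> int, act_arr, nat \<Rightarrow> int, act_arr) func)"
  assumes "field K"
    and "pointed_affine_data Q r n a emb"
    and "pointed_affine_data Q' r' n' a' emb'"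
    and "equivalence_of_cats \<B> \<B>' \<alpha>"
    and "minimal_free_resolution \<C>' K P' (toric_cmod K Q' n' a' emb')"
  shows "minimal_free_resolution \<C> K
           (ind_ccomplex \<B> \<C> K \<rho> (res_ccomplex (func_comp \<rho>' \<alpha>) P'))
           (toric_cmod K Q n a emb)"
proof -
  interpret K: field K by fact
  have Kc: "cring K" by (rule K.is_cring)
  interpret A: pointed_affine Q r n a emb by (rule pointed_affine.intro) fact
  interpret A': pointed_affine Q' r' n' a' emb' by (rule pointed_affine.intro) fact
  let ?T = "toric_cmod K Q n a emb" and ?T' = "toric_cmod K Q' n' a' emb'"
  let ?S = "betti_obj \<C> K ?T" and ?S' = "betti_obj \<C>' K ?T'"
  let ?\<beta> = "func_comp \<rho>' \<alpha>"
  note T = A.is_cmod_toric[OF Kc, folded \<C>_def] A.supported_toric[OF Kc, folded \<C>_def]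
    A.finitely_spanned_toric[OF Kc]
  note T' = A'.is_cmod_toric[OF Kc, folded \<C>'_def] A'.supported_toric[OF Kc, folded \<C>'_def]
    A'.finitely_spanned_toric[OF Kc]
  interpret C: locally_finite_graded_category \<C> "emb ` carrier Q" "A.height"
    unfolding \<C>_def by (rule A.C.locally_finite_graded_category_axioms)
  interpret C': locally_finite_graded_category \<C>' "emb' ` carrier Q'" "A'.height"
    unfolding \<C>'_def by (rule A'.C.locally_finite_graded_category_axioms)
  have B: "\<B> = full_subcat \<C> ?S" and B': "\<B>' = full_subcat \<C>' ?S'"
    by (simp_all add: \<B>_def \<B>'_def \<C>_def \<C>'_def toric_betti_cat_def betti_cat_def)
  have S: "?S \<subseteq> emb ` carrier Q" by (rule C.betti_obj_subset[OF assms(7) T(2)])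
  have S': "?S' \<subseteq> emb' ` carrier Q'" by (rule C'.betti_obj_subset[OF assms(7) T'(2)])
  have OB: "Obj \<B> = ?S" and OB': "Obj \<B>' = ?S'" unfolding B B' by (auto simp: betti_obj_def)
  have gB: "graded_category \<B> (Obj \<B>) A.height" unfolding B by (rule C.graded_full_subcat[OF S])
  have gB': "graded_category \<B>' (Obj \<B>') A'.height" unfolding B' by (rule C'.graded_full_subcat[OF S'])
  interpret B: graded_category \<B> "Obj \<B>" A.height by (rule gB)
  have ff: "fully_faithful \<B> \<C> \<rho>" unfolding B \<rho>_def by (rule fully_faithful_inclusion)
  have ff': "fully_faithful \<B>' \<C>' \<rho>'" unfolding B' \<rho>'_def by (rule fully_faithful_inclusion)
  note iso = equivalence_imp_iso[OF gB gB' assms(10)]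
  have ff\<beta>: "fully_faithful \<B> \<C>' ?\<beta>" by (rule fully_faithful_comp[OF iso(1) ff'])
  have f\<rho>: "is_func \<B> \<C> \<rho>" and f\<beta>: "is_func \<B> \<C>' ?\<beta>" using ff ff\<beta> by (auto simp: fully_faithful_def)
  have \<rho>_obj: "FObj \<rho> c = c" for c by (simp add: \<rho>_def func_id_def)
  have \<beta>_obj: "FObj ?\<beta> c = FObj \<alpha> c" for c by (simp add: \<rho>'_def func_id_def func_comp_def)
  have \<beta>_im: "?S' \<subseteq> FObj ?\<beta> ` Obj \<B>" using iso(2) unfolding OB' \<beta>_obj .
  have \<alpha>_obj: "FObj \<alpha> c \<in> ?S'" if "c \<in> Obj \<B>" for c
    using iso(1) func_Obj[of \<B> \<B>' \<alpha> c] that by (auto simp: fully_faithful_def OB')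

  obtain \<epsilon>' where P': "cover_chain \<C>' K P' ?T' \<epsilon>'"
    using C'.minimal_free_resolution_imp_cover_chain[OF assms(11)] by blast
  obtain X :: "(nat \<Rightarrow> int, act_arr, 'k, nat \<Rightarrow> act_arr \<Rightarrow> 'k) ccomplex" and \<epsilon>
    where X: "cover_chain \<C> K X ?T \<epsilon>"
    using C.cover_chain_exists[OF assms(7) T] by blast
  have gensX: "b ` I \<subseteq> FObj \<rho> ` Obj \<B>" if "cbasis \<C> K (Term X i) I b e \<chi>"
    for i and I :: "'i set" and b e \<chi>
    using C.gens_in_betti_obj[OF assms(7) T X that] by (simp add: OB \<rho>_obj)
  have gensP: "b ` I \<subseteq> FObj ?\<beta> ` Obj \<B>" if "cbasis \<C>' K (Term P' i) I b e \<chi>"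
    for i and I :: "'i set" and b e \<chi>
    using C'.gens_in_betti_obj[OF assms(7) T' P' that] \<beta>_im by blast

  \<comment> \<open>Both resolutions restrict to minimal free resolutions over the Betti category of \<open>Q\<close>.\<close>
  let ?N = "res_ccomplex ?\<beta> P'"
  have N: "cover_chain \<B> K ?N (res_cmod ?\<beta> ?T') (\<lambda>c. \<epsilon>' (FObj ?\<beta> c))"
    by (rule cover_chain_res[OF assms(7) gB C'.graded_category_axioms ff\<beta> P' gensP])
  have XB: "cover_chain \<B> K (res_ccomplex \<rho> X) (res_cmod \<rho> ?T) (\<lambda>c. \<epsilon> (FObj \<rho> c))"
    by (rule cover_chain_res[OF assms(7) gB C.graded_category_axioms ff X gensX])
  obtain t where t: "cmod_iso \<B> K (res_cmod ?\<beta> ?T') (res_cmod \<rho> ?T) t"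
    using toric_res_iso[OF Kc A.pointed_affine_axioms A'.pointed_affine_axioms f\<rho>[unfolded \<C>_def] f\<beta>[unfolded \<C>'_def]
        B.category_axioms] S S' \<alpha>_obj by (auto simp: \<rho>_obj \<beta>_obj OB subset_iff)
  obtain f where f: "\<And>i. cmod_iso \<B> K (Term ?N i) (Term (res_ccomplex \<rho> X) i) (f i)"
    "\<And>i c x. c \<in> Obj \<B> \<Longrightarrow> x \<in> carrier (Val (Term ?N (Suc i)) c) \<Longrightarrow>
      Diff (res_ccomplex \<rho> X) i c (f (Suc i) c x) = f i c (Diff ?N i c x)"
    using B.cover_chain_unique[OF Kc N XB t] by blast
  interpret I: induction_along \<B> \<C> K \<rho>
    by (intro induction_along.intro induction_along_axioms.intro B.category_axioms C.category_axioms Kc f\<rho>)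
  have "\<exists>\<delta>. cover_chain \<C> K (ind_ccomplex \<B> \<C> K \<rho> ?N) ?T \<delta>"
  proof (rule I.cover_chain_ind[OF assms(7) ff X gensX])
    show "is_cmod \<B> K (Term ?N i)" for i by (rule B.cover_chain_cmod[OF N])
    show "cmod_hom \<B> K (Term ?N (Suc i)) (Term ?N i) (Diff ?N i)" for i by (rule B.cover_chain_diff[OF N])
    show "cmod_iso \<B> K (Term ?N i) (res_cmod \<rho> (Term X i)) (f i)" for i
      using f(1)[of i] by (simp add: res_ccomplex_def)
    show "Diff X i (FObj \<rho> c) (f (Suc i) c x) = f i c (Diff ?N i c x)"
      if "c \<in> Obj \<B>" "x \<in> carrier (Val (Term ?N (Suc i)) c)" for i c x
      using f(2)[OF that] by (simp add: res_ccomplex_def)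
  qed
  then show ?thesis using C.cover_chain_imp_minimal_free_resolution[OF Kc] by blast
qed

end
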